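(* Let $\alpha,\beta\in[1/2,1)$ be real numbers with $\beta\le\alpha$ and $\alpha+\beta\ge 7/4$. If $$2(5-6\beta)\alpha^2+(30\beta-17-8\beta^2)\alpha+4-7\beta-4\beta^2+4\beta^3\ge0,$$ then the subordination $$\frac{z(f*g)'(z)}{(f*g)(z)}\prec\frac{z(s_\alpha*s_\beta)'(z)}{(s_\alpha*s_\beta)(z)}$$ holds for all $f\in\mathcal{S}^*(\alpha)$ and $g\in\mathcal{S}^*(\beta)$.
   Context: $\mathbb{D}=\{z\in\mathbb{C}:|z|<1\}$. $\mathcal{A}_1$ is the set of holomorphic functions $f$ on $\mathbb{D}$ with $f(0)=0$, $f'(0)=1$. For $\alpha<1$, $\mathcal{S}^*(\alpha)$ is the class of $f\in\mathcal{A}_1$ that are starlike of order $\alpha$, i.e. $\inf_{z\in\mathbb{D}}\operatorname{Re}\frac{zf'(z)}{f(z)}\ge\alpha$. The function $s_\alpha(z)=z/(1-z)^{2(1-\alpha)}$ (principal branch) belongs to $\mathcal{S}^*(\alpha)$. For $f(z)=z+\sum_{n\ge2}a_nz^n$ and $g(z)=z+\sum_{n\ge2}b_nz^n$ in $\mathcal{A}_1$, the convolution (Hadamard product) is $(f*g)(z)=z+\sum_{n\ge2}a_nb_nz^n$. The quotients $z(f*g)'/(f*g)$ are taken to have the value $1$ at $z=0$ (removable singularity). For holomorphic functions $p,q$ on $\mathbb{D}$, $p\prec q$ ($p$ is subordinate to $q$) means that there is a holomorphic function $\omega$ on $\mathbb{D}$ with $\omega(0)=0$, $|\omega(z)|<1$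 and $p(z)=q(\omega(z))$ for all $z\in\mathbb{D}$. *)

theory Defs
  imports "HOL-Complex_Analysis.Complex_Analysis"
begin

abbreviation unit_disc :: "complex set" where
  "unit_disc \<equiv> ball 0 1"

definition normalized_holomorphic :: "(complex \<Rightarrow> complex) set" where
  "normalized_holomorphic = {f. f holomorphic_on unit_disc \<and> f 0 = 0 \<and> deriv f 0 = 1}"

text \<open>
  The quotient $z f'(z)/f(z)$. It is only used for $f$ with $f(0) = 0$ and $f'(0) = 1$, and its
  singularity at $0$ is then removable with value $1$.
\<close>

definition starlike_quotient :: "(complex \<Rightarrow> complex) \<Rightarrow> complex \<Rightarrow> complex" where
  "starlike_quotient f z = (if z = 0 then 1 else z * deriv f z / f z)"

text \<open>
  The infimum is taken in the extended reals, since the infimum of a set of reals that is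
  unbounded below is unspecified. That $f$ has no zero except $0$, i.e. that the quotient is defined
  throughout the disc, is an explicit requirement because division is total in HOL.
\<close>

definition starlike_of_order :: "real \<Rightarrow> (complex \<Rightarrow> complex) set" where
  "starlike_of_order \<alpha> =
     {f \<in> normalized_holomorphic.
        (\<forall>z \<in> unit_disc - {0}. f z \<noteq> 0) \<and>
        (INF z \<in> unit_disc. ereal (Re (starlike_quotient f z))) \<ge> ereal \<alpha>}"

definition extremal_starlike :: "real \<Rightarrow> complex \<Rightarrow> complex" where
  "extremal_starlike \<alpha> z = z / (1 - z) powr of_real (2 * (1 - \<alpha>))"

text \<open>
  The Hadamard product of the Taylor series at $0$. For normalized functions the terms
  with index $0$ and $1$ are $0$ and $z$.
\<close>

definition convolution ::
    "(complex \<Rightarrow> complex) \<Rightarrow> (complex \<Rightarrow> complex) \<Rightarrow> complex \<Rightarrow> complex" where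
  "convolution f g =
     eval_fps (Abs_fps (\<lambda>n. fps_nth (fps_expansion f 0) n * fps_nth (fps_expansion g 0) n))"

text \<open>
  Subordination is a relation between holomorphic functions on the disc. Holomorphy of the two
  functions is part of the relation, so subordination of a function \<^const>\<open>starlike_quotient\<close>
  \<open>f\<close> includes that \<open>f\<close> has no zero in the punctured disc: there
  the quotient would have a pole.
\<close>

definition subordinate :: "(complex \<Rightarrow> complex) \<Rightarrow> (complex \<Rightarrow> complex) \<Rightarrow> bool" where
  "subordinate p q \<longleftrightarrow>
     p holomorphic_on unit_disc \<and> q holomorphic_on unit_disc \<and>
     (\<exists>\<omega>. \<omega> holomorphic_on unit_disc \<and> \<omega> 0 = 0 \<and>
          (\<forall>z \<in> unit_disc. norm (\<omega> z) < 1 \<and> p z = q (\<omega> z)))"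

end

theory Submission
  imports Defs
begin

text \<open>
  Write $f = zF$, $g = zG$, $a = 2 - 2\alpha$, $b = 2 - 2\beta$, $H = (1-z)^{-a} * (1-z)^{-b}$ and
  $q = zH'/H$; the claim is $z(F*G)'/(F*G) \prec q$.

  Ruscheweyh's convolution method shows that $z(F*G)'/(F*G)$ maps $|z| < \rho$ into the closed convex
  hull of $q(|z| = \rho)$: a function starlike of order $1 - c/2$ is $z$ times $K * (1-z)^{-c}$ for a
  prestarlike kernel $K$, and convolution with $K$ acts on quotients as an average over a circle
  with a positive density. This is applied once with the kernel of $F$ and once with that of $G$.

  It remains to see that $q$ is univalent with convex image, i.e. that
  $\mathrm{Re}\,(1 + zq''/q') > 0$. As $H$ is the hypergeometric function ${}_2F_1(a,b;1;z)$, $q$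
  solves a Riccati equation, from which $q'$ and $q''$ are rational expressions in $z$ and $q$. With
  $\sigma = a + b$ and $r = ab/\sigma^2$ the cubic hypothesis gives $4r \le 1 - \sigma^2$, which is what
  the estimate near $|z| = 1$ needs; the minimum principle extends it to the disc.
\<close>

section \<open>Boundary extrema of holomorphic functions\<close>

lemma holomorphic_Re_attains_bound_imp_const:
  assumes f: "f holomorphic_on S" and S: "open S" "connected S" and z0: "z0 \<in> S"
    and le: "\<And>z. z \<in> S \<Longrightarrow> Re (f z0) \<le> Re (f z)" and z: "z \<in> S"
  shows "f z = f z0"
proof -
  have "(\<lambda>z. exp (- f z)) constant_on S"
    using S z0
    by (intro maximum_modulus_principle[where U = S and \<xi> = z0] holomorphic_intros f) (auto simp: le)
  then obtain c where c: "\<And>z. z \<in> S \<Longrightarrow> exp (- f z) = c"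
    by (auto simp: constant_on_def)
  have "Re (f w) = Re (f z0)" if "w \<in> S" for w
  proof -
    have "cmod (exp (- f w)) = cmod (exp (- f z0))" using c[OF that] c[OF z0] by simp
    thus ?thesis by simp
  qed
  then have "f constant_on S"
  proof -
    have d0: "deriv f w = 0" if "w \<in> S" for w
    proof -
      have fd: "(f has_field_derivative deriv f w) (at w)"
        using f S(1) that holomorphic_derivI by blast
      have "((\<lambda>z. exp (- f z)) has_field_derivative (exp (- f w) * (- deriv f w))) (at w)"
        by (auto intro!: derivative_eq_intros fd)
      moreover have "((\<lambda>z. exp (- f z)) has_field_derivative 0) (at w)"
        by (rule has_field_derivative_transform_within_open[of "\<lambda>_. c" _ _ S]) (use c that S in auto)
      ultimately have "exp (- f w) * (- deriv f w) = 0" by (rule DERIV_unique)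
      thus ?thesis by simp
    qed
    show ?thesis
      by (rule has_field_derivative_0_imp_constant_on[OF _ S(2,1)])
         (use d0 f S(1) holomorphic_derivI in force)
  qed
  thus ?thesis using z z0 by (auto simp: constant_on_def)
qed

lemma Re_greater_if_nonconst:
  assumes f: "f holomorphic_on S" and S: "open S" "connected S"
    and le: "\<And>z. z \<in> S \<Longrightarrow> c \<le> Re (f z)" and w: "w \<in> S" "c < Re (f w)" and z: "z \<in> S"
  shows "c < Re (f z)"
proof (rule ccontr)
  assume "\<not> ?thesis"
  with le[OF z] have "Re (f z) = c" by simp
  with holomorphic_Re_attains_bound_imp_const[OF f S z _ w(1)] le w(2) show False by force
qed

lemma Jack_Re:
  fixes g :: "complex \<Rightarrow> complex"
  assumes g: "(g has_field_derivative d) (at z0)" and z0: "z0 \<noteq> 0"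
    and le: "\<And>z. norm z \<le> norm z0 \<Longrightarrow> Re (g z0) \<le> Re (g z)"
  shows "Im (z0 * d) = 0" "Re (z0 * d) \<le> 0"
proof -
  have "((\<lambda>t. Re (g (z0 * exp (\<i> * of_real t)))) has_real_derivative Re (\<i> * z0 * d)) (at 0)"
  proof -
    have "((\<lambda>t. z0 * exp (\<i> * of_real t)) has_vector_derivative z0 * \<i>) (at 0)"
      by (rule has_vector_derivative_real_field) (auto intro!: derivative_eq_intros)
    from field_vector_diff_chain_at[OF this, of g d]
    have "((\<lambda>t. g (z0 * exp (\<i> * of_real t))) has_vector_derivative (z0 * \<i> * d)) (at 0)"
      using g by (simp add: o_def)
    thus ?thesis
      by (auto simp: has_real_derivative_iff_has_vector_derivative mult_ac
               dest: bounded_linear.has_vector_derivative[OF bounded_linear_Re])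
  qed
  hence "Re (\<i> * z0 * d) = 0"
    by (rule DERIV_local_min[of _ _ _ 1]) (auto intro!: le simp: norm_mult)
  thus "Im (z0 * d) = 0" by (simp add: algebra_simps)
  have D: "((\<lambda>t. Re (g (of_real t * z0))) has_real_derivative Re (z0 * d)) (at 1)"
  proof -
    have "((\<lambda>t. of_real t * z0) has_vector_derivative z0) (at 1)"
      by (rule has_vector_derivative_real_field) (auto intro!: derivative_eq_intros)
    from field_vector_diff_chain_at[OF this, of g d]
    have "((\<lambda>t. g (of_real t * z0)) has_vector_derivative (z0 * d)) (at 1)"
      using g by (simp add: o_def)
    thus ?thesis
      by (auto simp: has_real_derivative_iff_has_vector_derivative
               dest: bounded_linear.has_vector_derivative[OF bounded_linear_Re])
  qed
  show "Re (z0 * d) \<le> 0"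
  proof (rule ccontr)
    assume "\<not> ?thesis"
    with DERIV_pos_inc_left[OF D] obtain e where e: "e > 0"
      "\<And>h. 0 < h \<Longrightarrow> h < e \<Longrightarrow> Re (g (of_real (1 - h) * z0)) < Re (g z0)" by force
    define h where "h = min (e/2) (1/2)"
    have "0 < h" "h < e" "h \<le> 1/2" using e(1) by (auto simp: h_def min_def)
    moreover have "norm (of_real (1 - h) * z0) \<le> norm z0"
      unfolding norm_mult norm_of_real using \<open>0 < h\<close> \<open>h \<le> 1/2\<close>
      by (intro mult_left_le_one_le) auto
    ultimately show False using e(2)[of h] le[of "of_real (1 - h) * z0"] by force
  qed
qed

lemma holomorphic_logarithm:
  assumes f: "f holomorphic_on S" "\<And>z. z \<in> S \<Longrightarrow> f z \<noteq> 0" and S: "convex S" "open S"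
  obtains L where "L holomorphic_on S" "\<And>z. z \<in> S \<Longrightarrow> exp (L z) = f z"
    "\<And>z. z \<in> S \<Longrightarrow> (L has_field_derivative deriv f z / f z) (at z)"
proof (cases "S = {}")
  case False
  then obtain z0 where "z0 \<in> S" by auto
  from holomorphic_logarithm_exists[OF S f this] obtain L where
    L: "L holomorphic_on S" "\<And>z. z \<in> S \<Longrightarrow> exp (L z) = f z" by metis
  have "(L has_field_derivative deriv f z / f z) (at z)" if z: "z \<in> S" for z
  proof -
    have LD: "(L has_field_derivative deriv L z) (at z)"
      using L(1) S(2) z holomorphic_derivI by blast
    have "((\<lambda>z. exp (L z)) has_field_derivative (exp (L z) * deriv L z)) (at z)"
      by (auto intro!: derivative_eq_intros LD)
    then have "(f has_field_derivative (exp (L z) * deriv L z)) (at z)"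
      by (rule has_field_derivative_transform_within_open[where S = S]) (use L S z in auto)
    then have "deriv f z = f z * deriv L z" using L(2)[OF z] by (simp add: DERIV_imp_deriv)
    with LD f(2)[OF z] show ?thesis by simp
  qed
  with L that show ?thesis by blast
qed (use that[of "\<lambda>_. 0"] in auto)

text \<open>
  On a circle the argument of $e^{L}$ increases faster than half the negative of the polar angle,
  so after the correction by $\varphi/2$ it increases by exactly $\pi$ in one turn.
\<close>
lemma half_turn_increase:
  fixes L :: "complex \<Rightarrow> complex"
  assumes L: "\<And>z. norm z = norm \<zeta> \<Longrightarrow> (L has_field_derivative L' z) (at z)"
    and pos: "\<And>z. norm z = norm \<zeta> \<Longrightarrow> Re (z * L' z) > -1/2"
    and \<phi>: "0 < \<phi>" "\<phi> < 2 * pi"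
  shows "0 < Im (L (\<zeta> * exp (\<i> * of_real \<phi>)) - L \<zeta>) + \<phi> / 2"
    "Im (L (\<zeta> * exp (\<i> * of_real \<phi>)) - L \<zeta>) + \<phi> / 2 < pi"
proof -
  define g where "g t = Im (L (\<zeta> * exp (\<i> * of_real t))) + t / 2" for t :: real
  have n: "norm (\<zeta> * exp (\<i> * of_real t)) = norm \<zeta>" for t :: real by (simp add: norm_mult)
  have D: "(g has_real_derivative (Re (\<zeta> * exp (\<i> * of_real t) * L' (\<zeta> * exp (\<i> * of_real t))) + 1/2)) (at t)" for t
  proof -
    have "((\<lambda>t. \<zeta> * exp (\<i> * of_real t)) has_vector_derivative \<zeta> * (\<i> * exp (\<i> * of_real t))) (at t)"
      by (rule has_vector_derivative_real_field) (auto intro!: derivative_eq_intros)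
    from field_vector_diff_chain_at[OF this L[OF n]]
    have "((\<lambda>t. L (\<zeta> * exp (\<i> * of_real t))) has_vector_derivative
      (\<zeta> * (\<i> * exp (\<i> * of_real t)) * L' (\<zeta> * exp (\<i> * of_real t)))) (at t)" by (simp add: o_def)
    from bounded_linear.has_vector_derivative[OF bounded_linear_Im this]
    have "((\<lambda>t. Im (L (\<zeta> * exp (\<i> * of_real t)))) has_real_derivative
      Im (\<i> * (\<zeta> * exp (\<i> * of_real t) * L' (\<zeta> * exp (\<i> * of_real t))))) (at t)"
      by (simp only: has_real_derivative_iff_has_vector_derivative mult_ac)
    hence "((\<lambda>t. Im (L (\<zeta> * exp (\<i> * of_real t)))) has_real_derivative
      Re (\<zeta> * exp (\<i> * of_real t) * L' (\<zeta> * exp (\<i> * of_real t)))) (at t)" by simp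
    moreover have "((\<lambda>t. t / 2) has_real_derivative 1/2) (at t)"
      by (auto intro!: derivative_eq_intros)
    ultimately show ?thesis unfolding g_def by (rule DERIV_add)
  qed
  have mono: "g s < g t" if "s < t" for s t
  proof (rule DERIV_pos_imp_increasing[OF that])
    fix x
    have "0 < Re (\<zeta> * exp (\<i> * of_real x) * L' (\<zeta> * exp (\<i> * of_real x))) + 1/2"
      using pos[OF n[of x]] by linarith
    with D[of x] show "\<exists>y. (g has_real_derivative y) (at x) \<and> 0 < y" by blast
  qed
  have e: "exp (\<i> * of_real (2 * pi)) = 1" by (simp add: exp_eq_polar flip: cis_conv_exp)
  have "g 0 = Im (L \<zeta>)" "g (2 * pi) = Im (L \<zeta>) + pi"
    using e by (simp_all add: g_def del: of_real_mult)
  with mono[OF \<phi>(1)] mono[OF \<phi>(2)] show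
    "0 < Im (L (\<zeta> * exp (\<i> * of_real \<phi>)) - L \<zeta>) + \<phi> / 2"
    "Im (L (\<zeta> * exp (\<i> * of_real \<phi>)) - L \<zeta>) + \<phi> / 2 < pi"
    by (auto simp: g_def)
qed

lemma same_norm_rotate:
  fixes z \<zeta> :: complex
  assumes "norm z = norm \<zeta>" "z \<noteq> \<zeta>"
  obtains \<phi> where "0 < \<phi>" "\<phi> < 2 * pi" "z = \<zeta> * exp (\<i> * of_real \<phi>)"
proof -
  have "\<zeta> \<noteq> 0" using assms by auto
  define \<phi> where "\<phi> = Arg2pi (z / \<zeta>)"
  have "norm (z / \<zeta>) = 1" using assms \<open>\<zeta> \<noteq> 0\<close> by (simp add: norm_divide)
  with Arg2pi_eq[of "z / \<zeta>"] have *: "z / \<zeta> = exp (\<i> * of_real \<phi>)" by (simp add: \<phi>_def)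
  have "0 \<le> \<phi>" "\<phi> < 2 * pi" by (auto simp: \<phi>_def Arg2pi_ge_0 Arg2pi_lt_2pi)
  moreover have "\<phi> \<noteq> 0" using * assms(2) \<open>\<zeta> \<noteq> 0\<close> by auto
  moreover have "z = \<zeta> * exp (\<i> * of_real \<phi>)" using * \<open>\<zeta> \<noteq> 0\<close> by (simp add: field_simps)
  ultimately show ?thesis by (intro that[of \<phi>]) auto
qed

lemma one_minus_exp_i: "1 - exp (\<i> * of_real \<phi>) = of_real (2 * sin (\<phi>/2)) * exp (\<i> * of_real (\<phi>/2 - pi/2))"
proof -
  have "cos \<phi> = 1 - 2 * (sin (\<phi>/2))\<^sup>2" "sin \<phi> = 2 * sin (\<phi>/2) * cos (\<phi>/2)"
    using cos_double_sin[of "\<phi>/2"] sin_double[of "\<phi>/2"] by auto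
  thus ?thesis
    by (auto simp: complex_eq_iff Re_exp Im_exp cos_diff sin_diff power2_eq_square)
qed

section \<open>Convex univalent functions\<close>

lemma Re_nonneg_on_sphere_imp_ball:
  assumes f: "f holomorphic_on ball 0 1" and r: "0 < r" "r < 1"
    and le: "\<And>z. norm z = r \<Longrightarrow> 0 \<le> Re (f z)" and z: "norm z \<le> r"
  shows "0 \<le> Re (f z)"
proof -
  have "Re (- f z) \<le> 0"
  proof (rule maximum_real_frontier[where S = "cball 0 r" and f = "\<lambda>z. - f z"])
    show "(\<lambda>z. - f z) holomorphic_on interior (cball 0 r)"
      using r by (intro holomorphic_intros holomorphic_on_subset[OF f]) auto
    show "continuous_on (closure (cball 0 r)) (\<lambda>z. - f z)"
      using r by (intro continuous_intros continuous_on_subset[OF holomorphic_on_imp_continuous_on[OF f]]) auto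
  qed (use z le in \<open>auto simp: dist_norm\<close>)
  thus ?thesis by simp
qed

lemma half_plane_starlike_half:
  assumes G: "G holomorphic_on ball 0 1" "\<And>z. norm z < 1 \<Longrightarrow> G z \<noteq> 0"
    and pos: "\<And>z. norm z < 1 \<Longrightarrow> Re (z * deriv G z / G z) > -1/2"
    and \<zeta>: "0 < norm \<zeta>" "norm \<zeta> < 1" and u: "norm u < norm \<zeta>"
  shows "Re ((1 - u / \<zeta>) * G u / G \<zeta>) > 0"
proof -
  obtain L where L: "L holomorphic_on ball 0 1" "\<And>z. z \<in> ball 0 1 \<Longrightarrow> exp (L z) = G z"
    "\<And>z. z \<in> ball 0 1 \<Longrightarrow> (L has_field_derivative deriv G z / G z) (at z)"
    by (rule holomorphic_logarithm[of G "ball 0 1"]) (use G in auto)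
  define f where "f u = (1 - u / \<zeta>) * G u / G \<zeta>" for u
  have f: "f holomorphic_on ball 0 1"
    unfolding f_def using \<zeta> G by (intro holomorphic_intros) auto
  have z0: "\<zeta> \<noteq> 0" using \<zeta> by auto
  have sph: "0 \<le> Re (f z)" if z: "norm z = norm \<zeta>" for z
  proof (cases "z = \<zeta>")
    case False
    from same_norm_rotate[OF z False] obtain \<phi> where \<phi>: "0 < \<phi>" "\<phi> < 2 * pi" "z = \<zeta> * exp (\<i> * of_real \<phi>)" .
    have "0 < Im (L z - L \<zeta>) + \<phi> / 2 \<and> Im (L z - L \<zeta>) + \<phi> / 2 < pi"
      unfolding \<phi>(3)
      by (intro conjI half_turn_increase[where L' = "\<lambda>z. deriv G z / G z"] \<phi>(1,2))
         (use L(3) pos \<zeta> in \<open>auto simp: dist_norm\<close>)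
    hence c: "cos (Im (L z - L \<zeta>) + (\<phi> / 2 - pi / 2)) > 0"
      by (intro cos_gt_zero_pi) linarith+
    have "G z / G \<zeta> = exp (L z - L \<zeta>)"
      using L(2)[of z] L(2)[of \<zeta>] z \<zeta> by (simp add: exp_diff)
    moreover have "1 - z / \<zeta> = 1 - exp (\<i> * of_real \<phi>)" using \<phi>(3) z0 by simp
    ultimately have "f z = (1 - exp (\<i> * of_real \<phi>)) * exp (L z - L \<zeta>)"
      unfolding f_def by (simp only: times_divide_eq_right[symmetric])
    hence "f z = of_real (2 * sin (\<phi>/2)) * exp ((L z - L \<zeta>) + \<i> * of_real (\<phi>/2 - pi/2))"
      unfolding one_minus_exp_i exp_add by (simp only: mult_ac)
    hence "Re (f z) = 2 * sin (\<phi>/2) * (exp (Re (L z - L \<zeta>)) * cos (Im (L z - L \<zeta>) + (\<phi> / 2 - pi / 2)))"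
      by (simp add: Re_exp)
    moreover have "sin (\<phi>/2) > 0" using \<phi> by (intro sin_gt_zero) auto
    ultimately show ?thesis using c by (simp add: zero_le_mult_iff)
  qed (simp add: f_def z0)
  have nn: "0 \<le> Re (f z)" if "norm z \<le> norm \<zeta>" for z
    by (rule Re_nonneg_on_sphere_imp_ball[OF f \<zeta> sph that])
  have "Re (f u) \<noteq> 0"
  proof
    assume u0: "Re (f u) = 0"
    have const: "f z = f u" if "z \<in> ball 0 (norm \<zeta>)" for z
      by (rule holomorphic_Re_attains_bound_imp_const[where S = "ball 0 (norm \<zeta>)"])
         (use that u nn u0 \<zeta> in \<open>auto intro: holomorphic_on_subset[OF f]\<close>)
    have "f \<zeta> = f u"
    proof (rule continuous_constant_on_closure[where f = f and S = "ball 0 (norm \<zeta>)"])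
      show "continuous_on (closure (ball 0 (norm \<zeta>))) f"
        using \<zeta> by (intro continuous_on_subset[OF holomorphic_on_imp_continuous_on[OF f]]) auto
      show "\<zeta> \<in> closure (ball 0 (norm \<zeta>))" using \<zeta> by simp
    qed (rule const)
    moreover have "f 0 = f u" by (rule const) (use \<zeta> in auto)
    ultimately show False using G(2)[of 0] G(2)[of \<zeta>] \<zeta> z0 by (simp add: f_def)
  qed
  with nn[of u] u show ?thesis by (force simp: f_def)
qed

text \<open>The tangent to the image of the circle through $\zeta$ turns by exactly $2\pi$.\<close>
lemma convex_function_support:
  assumes f: "f holomorphic_on ball 0 1" and f': "\<And>z. norm z < 1 \<Longrightarrow> deriv f z \<noteq> 0"
    and pos: "\<And>z. norm z < 1 \<Longrightarrow> Re (1 + z * deriv (deriv f) z / deriv f z) > 0"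
    and \<zeta>: "0 < norm \<zeta>" "norm \<zeta> < 1" and z: "norm z \<le> norm \<zeta>" "z \<noteq> \<zeta>"
  shows "Re ((f \<zeta> - f z) / (\<zeta> * deriv f \<zeta>)) > 0"
proof -
  have df: "deriv f holomorphic_on ball 0 1" by (intro holomorphic_intros f) auto
  obtain L where L: "\<And>z. z \<in> ball 0 1 \<Longrightarrow> exp (L z) = deriv f z"
    "\<And>z. z \<in> ball 0 1 \<Longrightarrow> (L has_field_derivative deriv (deriv f) z / deriv f z) (at z)"
    by (rule holomorphic_logarithm[OF df]) (use f' in auto)
  define w where "w t = \<zeta> * exp (\<i> * of_real t)" for t :: real
  have nw: "norm (w t) = norm \<zeta>" for t by (simp add: w_def norm_mult)
  define A where "A t = Im (L (w t) - L \<zeta>) + t" for t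
  have incr: "0 < A t - A s" "A t - A s < 2 * pi" if "s < t" "t < s + 2 * pi" for s t
  proof -
    have *: "w t = w s * exp (\<i> * of_real (t - s))"
      by (simp add: w_def mult.assoc ring_distribs flip: exp_add)
    have hD: "((\<lambda>z. L z / 2) has_field_derivative deriv (deriv f) z / deriv f z / 2) (at z)"
      if z: "cmod z = cmod (w s)" for z
      by (intro DERIV_cdivide L(2)) (use z \<zeta> nw in auto)
    have hP: "-1/2 < Re (z * (deriv (deriv f) z / deriv f z / 2))" if z: "cmod z = cmod (w s)" for z
    proof -
      have "z * (deriv (deriv f) z / deriv f z / 2) = z * deriv (deriv f) z / deriv f z / 2" by simp
      also have "Re \<dots> = Re (z * deriv (deriv f) z / deriv f z) / 2" by (rule Re_divide_numeral)
      finally show ?thesis using pos[of z] z \<zeta> nw[of s] by simp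
    qed
    have "0 < Im (L (w t) / 2 - L (w s) / 2) + (t - s) / 2 \<and> Im (L (w t) / 2 - L (w s) / 2) + (t - s) / 2 < pi"
      unfolding * using that by (intro conjI half_turn_increase[OF hD hP]) auto
    thus "0 < A t - A s" "A t - A s < 2 * pi" by (simp_all add: A_def field_simps)
  qed
  have "w 0 = \<zeta>" by (simp add: w_def)
  hence A0: "A 0 = 0" by (simp add: A_def)
  define c where "c = \<zeta> * deriv f \<zeta>"
  have c: "c \<noteq> 0" using \<zeta> f'[of \<zeta>] by (auto simp: c_def)
  define k where "k t = Re ((f \<zeta> - f (w t)) / c)" for t
  have D: "(k has_real_derivative exp (Re (L (w t) - L \<zeta>)) * sin (A t)) (at t)" for t
  proof -
    have "(f has_field_derivative deriv f (w t)) (at (w t))"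
      using f \<zeta> by (intro holomorphic_derivI[where S = "ball 0 1"]) (auto simp: nw)
    moreover have "(w has_vector_derivative \<i> * w t) (at t)"
      unfolding w_def by (rule has_vector_derivative_real_field) (auto intro!: derivative_eq_intros)
    ultimately have "((\<lambda>t. f (w t)) has_vector_derivative \<i> * w t * deriv f (w t)) (at t)"
      using field_vector_diff_chain_at[of w "\<i> * w t" t f "deriv f (w t)"] by (simp add: o_def)
    hence "((\<lambda>t. (f \<zeta> - f (w t)) / c) has_vector_derivative (0 - \<i> * w t * deriv f (w t)) / c) (at t)"
      by (intro derivative_intros) auto
    from bounded_linear.has_vector_derivative[OF bounded_linear_Re this]
    have "(k has_real_derivative Re ((0 - \<i> * w t * deriv f (w t)) / c)) (at t)"
      by (simp add: k_def[abs_def] has_real_derivative_iff_has_vector_derivative)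
    also have "(0 - \<i> * w t * deriv f (w t)) / c = - \<i> * exp (L (w t) - L \<zeta> + \<i> * of_real t)"
      using c L(1)[of "w t"] L(1)[of \<zeta>] \<zeta> nw[of t]
      by (simp add: c_def w_def exp_add exp_diff field_simps)
    also have "Re \<dots> = exp (Re (L (w t) - L \<zeta>)) * sin (A t)"
      by (simp add: Im_exp A_def)
    finally show ?thesis .
  qed
  have kpos: "k t > 0" if t: "0 < t" "t < 2 * pi" for t
  proof (rule ccontr)
    assume neg: "\<not> ?thesis"
    have k0: "k 0 = 0" by (simp add: k_def w_def)
    have "exp (\<i> * of_real (2 * pi)) = 1" by (simp add: exp_eq_polar flip: cis_conv_exp)
    hence k2: "k (2 * pi) = 0" by (simp add: k_def w_def del: of_real_mult)
    obtain t1 where t1: "0 < t1" "t1 < t" "k t - k 0 = (t - 0) * (exp (Re (L (w t1) - L \<zeta>)) * sin (A t1))"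
      using MVT2[OF t(1), of k "\<lambda>t. exp (Re (L (w t) - L \<zeta>)) * sin (A t)"] D by blast
    obtain t2 where t2: "t < t2" "t2 < 2 * pi"
        "k (2 * pi) - k t = (2 * pi - t) * (exp (Re (L (w t2) - L \<zeta>)) * sin (A t2))"
      using MVT2[OF t(2), of k "\<lambda>t. exp (Re (L (w t) - L \<zeta>)) * sin (A t)"] D by blast
    have "sin (A t1) \<le> 0" using t1(3) k0 neg t by (simp add: zero_less_mult_iff not_less mult_le_0_iff)
    moreover have "0 < A t1" using incr[of 0 t1] A0 t1 t by simp
    ultimately have "pi \<le> A t1" using sin_gt_zero[of "A t1"] by fastforce
    have "0 \<le> sin (A t2)"
    proof -
      have "0 \<le> (2 * pi - t) * (exp (Re (L (w t2) - L \<zeta>)) * sin (A t2))" using t2(3) k2 neg by simp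
      thus ?thesis using t by (simp add: zero_le_mult_iff)
    qed
    moreover have "A t2 < 2 * pi" using incr[of 0 t2] A0 t2 t by simp
    ultimately have "A t2 \<le> pi" using sin_lt_zero[of "A t2"] by fastforce
    with \<open>pi \<le> A t1\<close> incr[of t1 t2] t1 t2 show False by simp
  qed
  have sph: "Re ((f \<zeta> - f z) / c) \<ge> 0" "z \<noteq> \<zeta> \<Longrightarrow> Re ((f \<zeta> - f z) / c) > 0" if zn: "norm z = norm \<zeta>" for z
  proof -
    show *: "Re ((f \<zeta> - f z) / c) > 0" if "z \<noteq> \<zeta>"
      using same_norm_rotate[OF zn that] kpos by (auto simp: k_def w_def)
    show "Re ((f \<zeta> - f z) / c) \<ge> 0" using * by (cases "z = \<zeta>") auto
  qed
  have hol: "(\<lambda>z. (f \<zeta> - f z) / c) holomorphic_on ball 0 1"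
    using c f by (intro holomorphic_intros) auto
  have nn: "Re ((f \<zeta> - f z) / c) \<ge> 0" if "norm z \<le> norm \<zeta>" for z
    by (rule Re_nonneg_on_sphere_imp_ball[OF hol \<zeta> sph(1) that])
  show ?thesis
  proof (cases "norm z = norm \<zeta>")
    case True with sph(2) z show ?thesis by (simp add: c_def)
  next
    case False
    with z have zl: "norm z < norm \<zeta>" by simp
    have "Re ((f \<zeta> - f z) / c) \<noteq> 0"
    proof
      assume u0: "Re ((f \<zeta> - f z) / c) = 0"
      have const: "(f \<zeta> - f w) / c = (f \<zeta> - f z) / c" if "w \<in> ball 0 (norm \<zeta>)" for w
        by (rule holomorphic_Re_attains_bound_imp_const[where S = "ball 0 (norm \<zeta>)" and f = "\<lambda>w. (f \<zeta> - f w) / c"])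
           (use that zl nn u0 \<zeta> in \<open>auto intro: holomorphic_on_subset[OF hol]\<close>)
      have "(f has_field_derivative 0) (at 0)"
      proof (rule has_field_derivative_transform_within_open[of "\<lambda>_. f z" _ _ "ball 0 (norm \<zeta>)"])
        show "f z = f w" if "w \<in> ball 0 (norm \<zeta>)" for w using const[OF that] c by simp
      qed (use \<zeta> in auto)
      with f'[of 0] show False by (simp add: DERIV_imp_deriv)
    qed
    with nn[of z] z show ?thesis by (simp add: c_def)
  qed
qed

lemma convex_function_inj_on:
  assumes f: "f holomorphic_on ball 0 1" and f': "\<And>z. norm z < 1 \<Longrightarrow> deriv f z \<noteq> 0"
    and pos: "\<And>z. norm z < 1 \<Longrightarrow> Re (1 + z * deriv (deriv f) z / deriv f z) > 0"
  shows "inj_on f (ball 0 1)"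
proof -
  have *: "f z \<noteq> f w" if "norm w < 1" "norm z \<le> norm w" "z \<noteq> w" for z w
    using convex_function_support[OF f f' pos, of w z] that by (cases "w = 0") auto
  show ?thesis
  proof (rule inj_onI, rule ccontr)
    fix z w assume "z \<in> ball 0 1" "w \<in> ball 0 1" "f z = f w" "z \<noteq> w"
    thus False using *[of w z] *[of z w] by (cases "norm z \<le> norm w") auto
  qed
qed

lemma convex_function_convex_image:
  assumes f: "f holomorphic_on ball 0 1" and f': "\<And>z. norm z < 1 \<Longrightarrow> deriv f z \<noteq> 0"
    and pos: "\<And>z. norm z < 1 \<Longrightarrow> Re (1 + z * deriv (deriv f) z / deriv f z) > 0"
    and \<rho>: "0 < \<rho>" "\<rho> < 1"
  shows "convex (f ` cball 0 \<rho>)"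
proof (rule ccontr)
  assume "\<not> ?thesis"
  then obtain z1 z2 u v where z12: "z1 \<in> cball 0 \<rho>" "z2 \<in> cball 0 \<rho>" and uv: "u \<ge> 0" "v \<ge> 0" "u + v = 1"
    and wn: "u *\<^sub>R f z1 + v *\<^sub>R f z2 \<notin> f ` cball 0 \<rho>" by (auto simp: convex_def)
  define w where "w = u *\<^sub>R f z1 + v *\<^sub>R f z2"
  have "continuous_on (cball 0 \<rho>) f"
    using \<rho> by (intro continuous_on_subset[OF holomorphic_on_imp_continuous_on[OF f]]) auto
  hence "continuous_on (cball 0 \<rho>) (\<lambda>z. norm (w - f z))" by (intro continuous_intros)
  with continuous_attains_inf[of "cball 0 \<rho>" "\<lambda>z. norm (w - f z)"] \<rho> obtain \<zeta> where
    \<zeta>: "\<zeta> \<in> cball 0 \<rho>" "\<And>z. z \<in> cball 0 \<rho> \<Longrightarrow> norm (w - f \<zeta>) \<le> norm (w - f z)" by force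
  define d where "d = w - f \<zeta>"
  have d: "d \<noteq> 0" using wn \<zeta>(1) by (auto simp: d_def w_def)
  define e where "e = cnj d * deriv f \<zeta>"
  have e: "e \<noteq> 0" using d f'[of \<zeta>] \<zeta>(1) \<rho> by (auto simp: e_def)
  have dir: "Re (e * x) \<le> 0" if x: "\<delta> > 0" "\<And>t. 0 < t \<Longrightarrow> t < \<delta> \<Longrightarrow> norm (\<zeta> + of_real t * x) \<le> \<rho>" for x \<delta>
  proof (rule ccontr)
    assume neg: "\<not> ?thesis"
    define X where "X t = w - f (\<zeta> + of_real t * x)" for t :: real
    have XD: "(X has_vector_derivative - (x * deriv f \<zeta>)) (at 0)"
    proof -
      have "((\<lambda>t. \<zeta> + of_real t * x) has_vector_derivative x) (at 0)"
        by (rule has_vector_derivative_real_field) (auto intro!: derivative_eq_intros)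
      moreover have "(f has_field_derivative deriv f \<zeta>) (at (\<zeta> + of_real 0 * x))"
        using f \<zeta> \<rho> by (auto intro!: holomorphic_derivI[where S = "ball 0 1"])
      ultimately have "((\<lambda>t. f (\<zeta> + of_real t * x)) has_vector_derivative x * deriv f \<zeta>) (at 0)"
        using field_vector_diff_chain_at[of "\<lambda>t. \<zeta> + of_real t * x" x 0 f "deriv f \<zeta>"] by (simp add: o_def)
      hence "(X has_vector_derivative 0 - (x * deriv f \<zeta>)) (at 0)"
        unfolding X_def[abs_def] by (intro derivative_intros) auto
      thus ?thesis by simp
    qed
    have R: "((\<lambda>t. Re (X t)) has_real_derivative - Re (x * deriv f \<zeta>)) (at 0)"
      and I: "((\<lambda>t. Im (X t)) has_real_derivative - Im (x * deriv f \<zeta>)) (at 0)"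
      using bounded_linear.has_vector_derivative[OF bounded_linear_Re XD]
        bounded_linear.has_vector_derivative[OF bounded_linear_Im XD]
      by (auto simp: has_real_derivative_iff_has_vector_derivative)
    have "((\<lambda>t. (Re (X t))\<^sup>2 + (Im (X t))\<^sup>2) has_real_derivative
        (2 * Re (X 0) * (- Re (x * deriv f \<zeta>)) + 2 * Im (X 0) * (- Im (x * deriv f \<zeta>)))) (at 0)"
      by (rule derivative_eq_intros R I refl)+ simp
    also have "2 * Re (X 0) * (- Re (x * deriv f \<zeta>)) + 2 * Im (X 0) * (- Im (x * deriv f \<zeta>)) = - 2 * Re (e * x)"
      by (simp add: X_def e_def d_def algebra_simps)
    finally obtain \<delta>' where \<delta>': "\<delta>' > 0" "\<And>t. 0 < t \<Longrightarrow> t < \<delta>' \<Longrightarrow>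
        (Re (X t))\<^sup>2 + (Im (X t))\<^sup>2 < (Re (X 0))\<^sup>2 + (Im (X 0))\<^sup>2"
      using DERIV_neg_dec_right[of "\<lambda>t. (Re (X t))\<^sup>2 + (Im (X t))\<^sup>2" "- 2 * Re (e * x)" 0] neg by force
    define t where "t = min \<delta> \<delta>' / 2"
    have t: "0 < t" "t < \<delta>" "t < \<delta>'" using x(1) \<delta>'(1) by (auto simp: t_def min_def)
    have "(norm (X t))\<^sup>2 < (norm (X 0))\<^sup>2" using \<delta>'(2)[OF t(1,3)] by (simp add: cmod_power2)
    hence "norm (X t) < norm (X 0)" by (rule power2_less_imp_less) simp
    with \<zeta>(2)[of "\<zeta> + of_real t * x"] x(2)[OF t(1,2)] show False by (simp add: X_def)
  qed
  have n\<zeta>: "norm \<zeta> = \<rho>"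
  proof (rule ccontr)
    assume "norm \<zeta> \<noteq> \<rho>"
    with \<zeta>(1) have lt: "norm \<zeta> < \<rho>" by simp
    have "Re (e * cnj e) \<le> 0"
    proof (rule dir[of "(\<rho> - norm \<zeta>) / norm e"])
      fix t :: real assume t: "0 < t" "t < (\<rho> - norm \<zeta>) / norm e"
      have "norm (\<zeta> + of_real t * cnj e) \<le> norm \<zeta> + t * norm e"
        using norm_triangle_ineq[of \<zeta> "of_real t * cnj e"] t by (simp add: norm_mult)
      also have "\<dots> \<le> \<rho>" using t e by (simp add: field_simps)
      finally show "norm (\<zeta> + of_real t * cnj e) \<le> \<rho>" .
    qed (use lt e in auto)
    thus False using e by (simp add: complex_eq_iff sum_power2_le_zero_iff flip: power2_eq_square)
  qed
  hence \<zeta>0: "0 < norm \<zeta>" "norm \<zeta> < 1" using \<rho> by auto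
  have lin: "Re (e * \<zeta> * (-1 + \<i> * of_real y)) \<le> 0" for y :: real
  proof -
    have "Re (e * (\<zeta> * (-1 + \<i> * of_real y))) \<le> 0"
    proof (rule dir[of "1 / (1 + y\<^sup>2)"])
      fix t :: real assume t: "0 < t" "t < 1 / (1 + y\<^sup>2)"
      have y: "1 + y\<^sup>2 > 0" by (simp add: add_pos_nonneg)
      have "(norm (1 + of_real t * (-1 + \<i> * of_real y)))\<^sup>2 = 1 - 2 * t + t * (t * (1 + y\<^sup>2))"
        by (simp add: cmod_power2) algebra
      also have "t * (1 + y\<^sup>2) < 1" using t y by (simp add: field_simps)
      hence "t * (t * (1 + y\<^sup>2)) \<le> t * 1" using t by (intro mult_left_mono) auto
      hence "1 - 2 * t + t * (t * (1 + y\<^sup>2)) \<le> 1\<^sup>2" using t by simp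
      finally have "norm (1 + of_real t * (-1 + \<i> * of_real y)) \<le> 1" by (rule power2_le_imp_le) simp
      hence "norm \<zeta> * norm (1 + of_real t * (-1 + \<i> * of_real y)) \<le> norm \<zeta>" by (simp add: mult_left_le)
      thus "norm (\<zeta> + of_real t * (\<zeta> * (-1 + \<i> * of_real y))) \<le> \<rho>"
        unfolding n\<zeta>[symmetric] norm_mult[symmetric] by (simp add: algebra_simps)
    qed (simp add: add_pos_nonneg)
    thus ?thesis by (simp add: mult.assoc)
  qed
  have Im0: "Im (e * \<zeta>) = 0"
  proof (rule ccontr)
    assume neq: "Im (e * \<zeta>) \<noteq> 0"
    define y where "y = - (1 + \<bar>Re (e * \<zeta>)\<bar>) / Im (e * \<zeta>)"
    have "- Re (e * \<zeta>) - Im (e * \<zeta>) * y \<le> 0" using lin[of y] by (simp add: algebra_simps)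
    moreover have "Im (e * \<zeta>) * y = - (1 + \<bar>Re (e * \<zeta>)\<bar>)" using neq by (simp add: y_def)
    ultimately show False by linarith
  qed
  have "Re (e * \<zeta>) \<ge> 0" using lin[of 0] by simp
  moreover have "e * \<zeta> \<noteq> 0" using e \<zeta>0 by auto
  ultimately have Re0: "Re (e * \<zeta>) > 0" using Im0 by (auto simp: complex_eq_iff less_le)
  have Re_cr: "Re (of_real l * X) = l * Re X" for l X by simp
  have half: "Re ((f z - f \<zeta>) * cnj d) \<le> 0" if z: "z \<in> cball 0 \<rho>" for z
  proof (cases "z = \<zeta>")
    case False
    have c: "\<zeta> * deriv f \<zeta> \<noteq> 0" using \<zeta>0 f'[of \<zeta>] by auto
    have p: "Re ((f \<zeta> - f z) / (\<zeta> * deriv f \<zeta>)) > 0"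
      using convex_function_support[OF f f' pos \<zeta>0, of z] z False by (simp add: n\<zeta>)
    obtain l where l: "e * \<zeta> = of_real l" "l > 0"
      using Im0 Re0 by (metis complex_is_Real_iff of_real_Re)
    have "(f z - f \<zeta>) * cnj d = - (e * \<zeta> * ((f \<zeta> - f z) / (\<zeta> * deriv f \<zeta>)))"
      using c by (simp add: e_def field_simps)
    hence "Re ((f z - f \<zeta>) * cnj d) = - (l * Re ((f \<zeta> - f z) / (\<zeta> * deriv f \<zeta>)))"
      by (simp only: l uminus_complex.sel Re_cr)
    also have "\<dots> \<le> 0" using mult_pos_pos[OF l(2) p] by linarith
    finally show ?thesis .
  qed simp
  have "(w - f \<zeta>) * cnj d = of_real u * ((f z1 - f \<zeta>) * cnj d) + of_real v * ((f z2 - f \<zeta>) * cnj d)"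
  proof -
    have "v = 1 - u" using uv(3) by simp
    hence "w - f \<zeta> = of_real u * (f z1 - f \<zeta>) + of_real v * (f z2 - f \<zeta>)"
      unfolding w_def \<open>v = 1 - u\<close> by (simp add: scaleR_conv_of_real algebra_simps)
    thus ?thesis by (simp only: distrib_right mult.assoc)
  qed
  hence "Re ((w - f \<zeta>) * cnj d) = u * Re ((f z1 - f \<zeta>) * cnj d) + v * Re ((f z2 - f \<zeta>) * cnj d)" by simp
  also have "\<dots> \<le> 0" using uv half[OF z12(1)] half[OF z12(2)]
    by (intro add_nonpos_nonpos mult_nonneg_nonpos) auto
  finally have "Re (d * cnj d) \<le> 0" by (simp add: d_def)
  thus False using d by (simp add: complex_eq_iff sum_power2_le_zero_iff flip: power2_eq_square)
qed

section \<open>Hadamard products\<close>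

definition taylor_coeff :: "(complex \<Rightarrow> complex) \<Rightarrow> nat \<Rightarrow> complex" where
  "taylor_coeff f n = fps_nth (fps_expansion f 0) n"

lemma taylor_coeff_sums:
  assumes "f holomorphic_on ball 0 R" "norm z < R"
  shows "(\<lambda>n. taylor_coeff f n * z ^ n) sums f z"
  using holomorphic_power_series[OF assms(1), of z] assms(2)
  by (simp add: taylor_coeff_def fps_expansion_def)

lemma taylor_coeff_abs_summable:
  assumes "f holomorphic_on ball 0 R" "0 \<le> r" "r < R"
  shows "summable (\<lambda>n. norm (taylor_coeff f n) * r ^ n)"
proof -
  obtain r' where r': "r < r'" "r' < R" using assms dense by blast
  have "summable (\<lambda>n. taylor_coeff f n * of_real r' ^ n)"
    using taylor_coeff_sums[OF assms(1), of "of_real r'"] r' assms by (auto simp: sums_iff)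
  from powser_insidea[OF this, of "of_real r"] r' assms show ?thesis
    by (simp add: norm_mult norm_power)
qed

lemma sums_imp_holomorphic_taylor_coeff:
  assumes "R > 0" and s: "\<And>z. norm z < R \<Longrightarrow> (\<lambda>n. a n * z ^ n) sums f z"
  shows "f holomorphic_on ball 0 R" "taylor_coeff f n = a n"
proof -
  show "f holomorphic_on ball 0 R"
    by (rule power_series_holomorphic[where a = a]) (use s in auto)
  have "f has_fps_expansion Abs_fps a"
  proof (rule has_fps_expansionI)
    have "eventually (\<lambda>z. z \<in> ball 0 R) (nhds (0::complex))"
      using \<open>R > 0\<close> by (intro eventually_nhds_in_open) auto
    thus "eventually (\<lambda>u. (\<lambda>n. fps_nth (Abs_fps a) n * u ^ n) sums f u) (nhds 0)"
      by eventually_elim (use s in auto)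
  qed
  from fps_nth_fps_expansion[OF this, of n] show "taylor_coeff f n = a n"
    by (simp add: taylor_coeff_def fps_expansion_def)
qed

lemma taylor_coeff_cong:
  assumes "R > 0" "\<And>z. norm z < R \<Longrightarrow> f z = g z"
  shows "taylor_coeff f = taylor_coeff g"
proof -
  have "eventually (\<lambda>z. z \<in> ball 0 R) (nhds (0::complex))"
    using \<open>R > 0\<close> by (intro eventually_nhds_in_open) auto
  hence "eventually (\<lambda>z. f z = g z) (nhds 0)"
    by eventually_elim (use assms in auto)
  from fps_expansion_cong[OF this] show ?thesis by (simp add: taylor_coeff_def fun_eq_iff)
qed

lemma convolution_eq: "convolution f g z = (\<Sum>n. taylor_coeff f n * taylor_coeff g n * z ^ n)"
  by (simp add: convolution_def eval_fps_def taylor_coeff_def)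

lemma convolution_commute: "convolution f g = convolution g f"
  by (simp add: convolution_eq fun_eq_iff mult.commute)

lemma convolution_cong:
  assumes "R > 0" "\<And>z. norm z < R \<Longrightarrow> f z = g z"
  shows "convolution K f = convolution K g"
  using taylor_coeff_cong[OF assms] by (simp add: convolution_eq fun_eq_iff)

context
  fixes K f :: "complex \<Rightarrow> complex" and R :: real
  assumes K: "K holomorphic_on ball 0 1" and f: "f holomorphic_on ball 0 R" and R: "R > 0"
begin

lemma convolution_sums:
  assumes z: "norm z < R"
  shows "(\<lambda>n. taylor_coeff K n * taylor_coeff f n * z ^ n) sums convolution K f z"
proof -
  have "norm z / R < 1" using z R by simp
  then obtain \<rho> where \<rho>: "norm z / R < \<rho>" "\<rho> < 1" using dense by blast
  have \<rho>0: "\<rho> > 0" using \<rho>(1) R by (metis divide_nonneg_pos le_less_trans norm_ge_zero)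
  have s1: "summable (\<lambda>n. norm (taylor_coeff K n) * \<rho> ^ n)"
    by (rule taylor_coeff_abs_summable[OF K]) (use \<rho> \<rho>0 in auto)
  then obtain C where C: "\<And>n. norm (taylor_coeff K n) * \<rho> ^ n \<le> C"
    using \<rho>0 summable_imp_Bseq[OF s1] unfolding Bseq_def
    by (metis abs_ge_self order.trans real_norm_def)
  have s2: "summable (\<lambda>n. norm (taylor_coeff f n) * (norm z / \<rho>) ^ n)"
    by (rule taylor_coeff_abs_summable[OF f]) (use \<rho> \<rho>0 R in \<open>auto simp: field_simps\<close>)
  have "summable (\<lambda>n. taylor_coeff K n * taylor_coeff f n * z ^ n)"
  proof (rule summable_comparison_test'[where N = 0])
    show "summable (\<lambda>n. C * (norm (taylor_coeff f n) * (norm z / \<rho>) ^ n))" by (intro summable_mult s2)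
    fix n :: nat
    have "norm (taylor_coeff K n * taylor_coeff f n * z ^ n) =
      (norm (taylor_coeff K n) * \<rho> ^ n) * (norm (taylor_coeff f n) * (norm z / \<rho>) ^ n)"
      using \<rho>0 by (simp add: norm_mult norm_power field_simps)
    also have "\<dots> \<le> C * (norm (taylor_coeff f n) * (norm z / \<rho>) ^ n)"
      using \<rho>0 by (intro mult_right_mono C) auto
    finally show "norm (taylor_coeff K n * taylor_coeff f n * z ^ n) \<le>
      C * (norm (taylor_coeff f n) * (norm z / \<rho>) ^ n)" .
  qed
  thus ?thesis unfolding convolution_eq by (rule summable_sums)
qed

lemma convolution_holomorphic: "convolution K f holomorphic_on ball 0 R"
  by (rule sums_imp_holomorphic_taylor_coeff[OF R convolution_sums])

lemma taylor_coeff_convolution: "taylor_coeff (convolution K f) n = taylor_coeff K n * taylor_coeff f n"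
  by (rule sums_imp_holomorphic_taylor_coeff[OF R convolution_sums])

lemma convolution_contour_integral:
  assumes z: "norm z < r" "r < R"
  shows "((\<lambda>u. K (z / u) * f u / u) has_contour_integral (2 * pi * \<i> * convolution K f z)) (circlepath 0 r)"
proof -
  have r0: "0 < r" using z(1) by (meson norm_ge_zero le_less_trans)
  define g where "g N u = (\<Sum>n<N. taylor_coeff K n * z ^ n * (f u / u ^ Suc n))" for N u
  have fc: "continuous_on (cball 0 r) f"
    using z by (intro holomorphic_on_imp_continuous_on holomorphic_on_subset[OF f]) auto
  have fh: "f holomorphic_on ball 0 r" using z by (intro holomorphic_on_subset[OF f]) auto
  have *: "((\<lambda>u. taylor_coeff K n * z ^ n * (f u / u ^ Suc n)) has_contour_integral
       taylor_coeff K n * z ^ n * (2 * pi * \<i> * taylor_coeff f n)) (circlepath 0 r)" for n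
    using Cauchy_has_contour_integral_higher_derivative_circlepath[OF fc fh, of 0 n] r0
    by (intro has_contour_integral_lmul) (simp add: taylor_coeff_def fps_expansion_def)
  have gi: "(g N has_contour_integral (\<Sum>n<N. taylor_coeff K n * z ^ n * (2 * pi * \<i> * taylor_coeff f n)))
      (circlepath 0 r)" for N
    unfolding g_def by (intro has_contour_integral_sum *) auto
  have ul: "uniform_limit (sphere 0 r) g (\<lambda>u. K (z / u) * f u / u) sequentially"
  proof -
    have "bounded (f ` sphere 0 r)"
      by (intro compact_imp_bounded compact_continuous_image continuous_on_subset[OF fc]) auto
    then obtain B where B: "\<And>u. u \<in> sphere 0 r \<Longrightarrow> norm (f u) \<le> B"
      unfolding bounded_iff by blast
    have ul0: "uniform_limit (sphere 0 r) (\<lambda>N u. \<Sum>n<N. taylor_coeff K n * z ^ n * (f u / u ^ Suc n))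
        (\<lambda>u. \<Sum>n. taylor_coeff K n * z ^ n * (f u / u ^ Suc n)) sequentially"
    proof (rule Weierstrass_m_test)
      show "summable (\<lambda>n. norm (taylor_coeff K n) * (norm z / r) ^ n * (B / r))"
        by (intro summable_mult2 taylor_coeff_abs_summable[OF K]) (use z r0 in auto)
      fix n and u :: complex assume u: "u \<in> sphere 0 r"
      have "norm (taylor_coeff K n * z ^ n * (f u / u ^ Suc n)) =
        norm (taylor_coeff K n) * (norm z / r) ^ n * (norm (f u) / r)"
        using u r0 by (simp add: norm_mult norm_power norm_divide field_simps)
      also have "\<dots> \<le> norm (taylor_coeff K n) * (norm z / r) ^ n * (B / r)"
        using r0 B[OF u] by (intro mult_left_mono divide_right_mono) auto
      finally show "norm (taylor_coeff K n * z ^ n * (f u / u ^ Suc n)) \<le>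
        norm (taylor_coeff K n) * (norm z / r) ^ n * (B / r)" .
    qed
    have eq: "(\<Sum>n. taylor_coeff K n * z ^ n * (f u / u ^ Suc n)) = K (z / u) * f u / u"
      if u: "u \<in> sphere 0 r" for u
    proof -
      have "norm (z / u) < 1" using u z r0 by (simp add: norm_divide)
      from sums_mult2[OF taylor_coeff_sums[OF K this], of "f u / u"]
      have "(\<lambda>n. taylor_coeff K n * (z / u) ^ n * (f u / u)) sums (K (z / u) * f u / u)" by simp
      moreover have "taylor_coeff K n * (z / u) ^ n * (f u / u) = taylor_coeff K n * z ^ n * (f u / u ^ Suc n)" for n
        by (simp add: power_divide)
      ultimately show ?thesis by (simp add: sums_iff)
    qed
    show ?thesis unfolding g_def by (rule iffD1[OF uniform_limit_cong' ul0]) (simp_all only: eq)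
  qed
  have gc: "\<forall>\<^sub>F N in sequentially. g N contour_integrable_on circlepath 0 r"
    by (intro always_eventually allI has_contour_integral_integrable[OF gi])
  have ci: "(\<lambda>u. K (z / u) * f u / u) contour_integrable_on circlepath 0 r"
    and lim: "(\<lambda>N. contour_integral (circlepath 0 r) (g N)) \<longlonglongrightarrow>
      contour_integral (circlepath 0 r) (\<lambda>u. K (z / u) * f u / u)"
    using contour_integral_uniform_limit_circlepath[OF gc ul _ r0] by simp_all
  have "(\<lambda>n. 2 * pi * \<i> * (taylor_coeff K n * taylor_coeff f n * z ^ n)) sums (2 * pi * \<i> * convolution K f z)"
    by (intro sums_mult convolution_sums) (use z in auto)
  hence "(\<lambda>N. contour_integral (circlepath 0 r) (g N)) \<longlonglongrightarrow> 2 * pi * \<i> * convolution K f z"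
    unfolding contour_integral_unique[OF gi] sums_def by (simp add: mult_ac)
  with lim have "contour_integral (circlepath 0 r) (\<lambda>u. K (z / u) * f u / u) = 2 * pi * \<i> * convolution K f z"
    by (rule LIMSEQ_unique)
  with has_contour_integral_integral[OF ci] show ?thesis by simp
qed

end

lemma convolution_0:
  assumes "K holomorphic_on ball 0 1" "f holomorphic_on ball 0 R" "R > 0"
  shows "convolution K f 0 = K 0 * f 0"
  by (simp add: convolution_eq taylor_coeff_def fps_expansion_def)
     (subst suminf_finite[of "{0}"], auto)

lemma taylor_coeff_theta:
  assumes f: "f holomorphic_on ball 0 R" "R > 0"
  shows "taylor_coeff (\<lambda>z. z * deriv f z) n = of_nat n * taylor_coeff f n"
proof -
  have "(\<lambda>n. of_nat n * taylor_coeff f n * z ^ n) sums (z * deriv f z)" if z: "norm z < R" for z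
  proof -
    have df: "deriv f holomorphic_on ball 0 R" by (intro holomorphic_intros f) auto
    have c: "taylor_coeff (deriv f) n = of_nat (Suc n) * taylor_coeff f (Suc n)" for n
      by (simp add: taylor_coeff_def fps_expansion_def funpow_Suc_right del: funpow.simps of_nat_Suc)
    from sums_mult[OF taylor_coeff_sums[OF df z], of z]
    have "(\<lambda>n. of_nat (Suc n) * taylor_coeff f (Suc n) * z ^ Suc n) sums (z * deriv f z)"
      by (simp add: c mult_ac)
    from sums_Suc[OF this] show ?thesis by simp
  qed
  from sums_imp_holomorphic_taylor_coeff(2)[OF f(2) this] show ?thesis .
qed

lemma convolution_theta:
  assumes "K holomorphic_on ball 0 1" "f holomorphic_on ball 0 R" "norm z < R"
  shows "convolution K (\<lambda>z. z * deriv f z) z = z * deriv (convolution K f) z"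
proof -
  have R: "R > 0" using assms(3) by (meson norm_ge_zero le_less_trans)
  have h: "convolution K f holomorphic_on ball 0 R" using assms R by (intro convolution_holomorphic)
  have "(\<lambda>n. taylor_coeff (\<lambda>z. z * deriv (convolution K f) z) n * z ^ n) sums (z * deriv (convolution K f) z)"
    by (rule taylor_coeff_sums) (use assms h in \<open>auto intro!: holomorphic_intros\<close>)
  thus ?thesis
    unfolding convolution_eq[of K "\<lambda>z. z * deriv f z"] taylor_coeff_theta[OF assms(2) R]
      taylor_coeff_theta[OF h R] taylor_coeff_convolution[OF assms(1,2) R]
    by (simp add: sums_iff mult_ac)
qed

lemma taylor_coeff_dilate:
  assumes f: "f holomorphic_on ball 0 R" "R > 0"
  shows "taylor_coeff (\<lambda>z. f (c * z)) n = c ^ n * taylor_coeff f n"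
proof -
  have "(\<lambda>n. c ^ n * taylor_coeff f n * z ^ n) sums f (c * z)" if "norm z < R / (norm c + 1)" for z
  proof -
    have "norm z * (norm c + 1) < R" using that by (simp add: pos_less_divide_eq add_nonneg_pos)
    hence "norm (c * z) < R" by (simp add: norm_mult algebra_simps) (smt (verit) norm_ge_zero)
    from taylor_coeff_sums[OF f(1) this] show ?thesis by (simp add: power_mult_distrib mult_ac)
  qed
  moreover have "R / (norm c + 1) > 0" using f(2) by (intro divide_pos_pos add_nonneg_pos) auto
  ultimately show ?thesis by (intro sums_imp_holomorphic_taylor_coeff(2))
qed

lemma convolution_dilate:
  assumes f: "f holomorphic_on ball 0 R" "R > 0"
  shows "convolution K (\<lambda>z. f (c * z)) z = convolution K f (c * z)"
  unfolding convolution_eq taylor_coeff_dilate[OF f] by (simp add: power_mult_distrib algebra_simps)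

lemma convolution_linear:
  assumes K: "K holomorphic_on ball 0 1" and f: "f holomorphic_on ball 0 R" "g holomorphic_on ball 0 R"
    and z: "norm z < R"
  shows "convolution K (\<lambda>u. a * f u + b * g u) z = a * convolution K f z + b * convolution K g z"
proof -
  have R: "R > 0" using z by (meson norm_ge_zero le_less_trans)
  have s: "(\<lambda>n. (a * taylor_coeff f n + b * taylor_coeff g n) * u ^ n) sums (a * f u + b * g u)" if "norm u < R" for u
    using sums_add[OF sums_mult[OF taylor_coeff_sums[OF f(1) that], of a] sums_mult[OF taylor_coeff_sums[OF f(2) that], of b]]
    by (simp add: algebra_simps)
  have c: "taylor_coeff (\<lambda>u. a * f u + b * g u) n = a * taylor_coeff f n + b * taylor_coeff g n" for n
    by (rule sums_imp_holomorphic_taylor_coeff(2)[OF R s])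
  have "(\<lambda>n. a * (taylor_coeff K n * taylor_coeff f n * z ^ n) + b * (taylor_coeff K n * taylor_coeff g n * z ^ n))
     sums (a * convolution K f z + b * convolution K g z)"
    by (intro sums_add sums_mult convolution_sums[OF K f(1) R z] convolution_sums[OF K f(2) R z])
  thus ?thesis unfolding convolution_eq[of K "\<lambda>u. a * f u + b * g u"] c
    by (simp add: sums_iff algebra_simps)
qed

lemma convolution_assoc:
  assumes "K holomorphic_on ball 0 1" "f holomorphic_on ball 0 1" "g holomorphic_on ball 0 1"
  shows "convolution (convolution K f) g = convolution K (convolution f g)"
  using assms by (simp add: convolution_eq[of "convolution K f"] convolution_eq[of K "convolution f g"]
    taylor_coeff_convolution[where R = 1] fun_eq_iff mult_ac)

lemma contour_integral_circlepath_real_integral: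
  assumes "(f has_contour_integral I) (circlepath 0 \<rho>)"
  shows "((\<lambda>t. f (of_real \<rho> * exp (2 * of_real pi * \<i> * of_real t)) *
      (2 * of_real pi * \<i> * (of_real \<rho> * exp (2 * of_real pi * \<i> * of_real t)))) has_integral I) {0..1}"
  using assms unfolding has_contour_integral
  by (rule has_integral_eq[rotated]) (subst vector_derivative_circlepath, simp add: circlepath mult_ac)

lemma circle_average_positive:
  assumes int: "((\<lambda>u. g u / u) has_contour_integral (2 * pi * \<i> * I)) (circlepath 0 \<rho>)"
    and g: "continuous_on (sphere 0 \<rho>) g" and \<rho>: "\<rho> > 0"
    and pos: "\<And>u. norm u = \<rho> \<Longrightarrow> Re (g u) > 0"
  shows "Re I > 0"
proof -
  have "continuous_on (sphere 0 \<rho>) (\<lambda>u. Re (g u))" by (intro continuous_intros g)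
  then obtain u0 where u0: "norm u0 = \<rho>" "\<And>u. norm u = \<rho> \<Longrightarrow> Re (g u0) \<le> Re (g u)"
    using continuous_attains_inf[of "sphere 0 \<rho>" "\<lambda>u. Re (g u)"] \<rho> by auto
  have "((\<lambda>t. 2 * pi * \<i> * g (of_real \<rho> * exp (2 * of_real pi * \<i> * of_real t))) has_integral (2 * pi * \<i> * I)) {0..1}"
    using contour_integral_circlepath_real_integral[OF int] \<rho> by (simp add: mult_ac)
  from has_integral_mult_right[OF this, of "1 / (2 * pi * \<i>)"]
  have "((\<lambda>t. g (of_real \<rho> * exp (2 * of_real pi * \<i> * of_real t))) has_integral I) {0..1}" by simp
  from has_integral_linear[OF this bounded_linear_Re]
  have I1: "((\<lambda>t. Re (g (of_real \<rho> * exp (2 * of_real pi * \<i> * of_real t)))) has_integral Re I) {0..1}"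
    by (simp add: o_def)
  have I2: "((\<lambda>t::real. Re (g u0)) has_integral Re (g u0)) {0..1}"
    using has_integral_const_real[of "Re (g u0)" 0 1] by simp
  have "Re (g u0) \<le> Re I"
  proof (rule has_integral_le[OF I2 I1])
    show "Re (g u0) \<le> Re (g (of_real \<rho> * exp (2 * of_real pi * \<i> * of_real t)))" for t
      by (rule u0(2)) (use \<rho> in \<open>simp add: norm_mult\<close>)
  qed
  with pos[OF u0(1)] show ?thesis by simp
qed

text \<open>
  The normalised functional $p \mapsto (K * Sp)(z)/(K * S)(z)$ is a circle average with the density
  $2\,\mathrm{Re}\,m - 1$, where $m$ is its value on the Cauchy kernels $1/(1 - xu)$.
\<close>
lemma convolution_quotient_positive:
  assumes K: "K holomorphic_on ball 0 1" and S: "S holomorphic_on ball 0 1" and p: "p holomorphic_on ball 0 1"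
    and z: "norm z < \<rho>" "\<rho> < 1" and a: "convolution K S z \<noteq> 0"
    and M: "\<And>x. norm x = 1 / \<rho> \<Longrightarrow> Re (convolution K (\<lambda>u. S u / (1 - x * u)) z / convolution K S z) > 1/2"
    and pos: "\<And>u. norm u = \<rho> \<Longrightarrow> Re (p u) > 0"
  shows "Re (convolution K (\<lambda>u. S u * p u) z / convolution K S z) > 0"
proof -
  define a where "a = convolution K S z"
  have a0: "a \<noteq> 0" using \<open>convolution K S z \<noteq> 0\<close> by (simp add: a_def)
  obtain r where r: "norm z < r" "r < \<rho>" using z dense by blast
  have r0: "r > 0" using r by (meson norm_ge_zero le_less_trans)
  have \<rho>0: "\<rho> > 0" using r r0 by simp
  define k where "k u = K (z / u) * S u / u" for u
  have kc: "continuous_on (sphere 0 r) k"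
  proof -
    have "continuous_on (sphere 0 r) S"
      using r z by (intro continuous_on_subset[OF holomorphic_on_imp_continuous_on[OF S]]) auto
    moreover have "continuous_on (sphere 0 r) (\<lambda>u. K (z / u))"
    proof (rule continuous_on_compose2[OF holomorphic_on_imp_continuous_on[OF K]])
      show "continuous_on (sphere 0 r) (\<lambda>u. z / u)" using r0 by (intro continuous_intros) auto
      show "(\<lambda>u. z / u) ` sphere 0 r \<subseteq> ball 0 1" using r r0 by (auto simp: norm_divide)
    qed
    ultimately show ?thesis unfolding k_def using r0 by (intro continuous_intros) auto
  qed
  define lam where "lam j = convolution K (\<lambda>u. S u * u ^ j) z / a" for j
  define m where "m x = convolution K (\<lambda>u. S u / (1 - x * u)) z / a" for x
  have hk: "((\<lambda>u. k u * q u) has_contour_integral (2 * pi * \<i> * convolution K (\<lambda>u. S u * q u) z)) (circlepath 0 r)"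
    if "q holomorphic_on ball 0 R" "r < R" for q R
  proof -
    have "(\<lambda>u. S u * q u) holomorphic_on ball 0 (min 1 R)"
      by (intro holomorphic_intros holomorphic_on_subset[OF S] holomorphic_on_subset[OF that(1)]) auto
    from convolution_contour_integral[OF K this _ r(1)] r0 r z that(2) show ?thesis
      by (simp add: k_def mult_ac)
  qed
  have hm: "((\<lambda>u. k u / (1 - x * u)) has_contour_integral (2 * pi * \<i> * (a * m x))) (circlepath 0 r)"
    if x: "norm x < 1 / r" for x
  proof -
    obtain R where R: "r < R" "R * norm x < 1"
    proof (cases "x = 0")
      case False
      obtain R where "r < R" "R < 1 / norm x"
        using x dense[of r "1 / norm x"] False r0 by (auto simp: field_simps)
      with False show ?thesis by (intro that[of R]) (auto simp: field_simps)
    qed (use that[of "r + 1"] in auto)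
    have "1 - x * u \<noteq> 0" if "norm u < R" for u
    proof
      assume "1 - x * u = 0"
      hence "norm x * norm u = 1" by (metis norm_mult norm_one right_minus_eq)
      moreover have "norm x * norm u \<le> norm x * R" using that by (intro mult_left_mono) auto
      ultimately show False using R by (simp add: mult.commute)
    qed
    hence "(\<lambda>u. 1 / (1 - x * u)) holomorphic_on ball 0 R" by (intro holomorphic_intros) auto
    from hk[OF this R(1)] a0 show ?thesis by (simp add: m_def)
  qed
  have m_sums: "(\<lambda>j. lam j * x ^ j) sums m x" if x: "norm x < 1 / r" for x
  proof -
    have xr: "norm x * r < 1" using x r0 by (simp add: field_simps)
    define g where "g N u = (\<Sum>j<N. x ^ j * (k u * u ^ j))" for N u
    have gi: "(g N has_contour_integral (\<Sum>j<N. x ^ j * (2 * pi * \<i> * convolution K (\<lambda>u. S u * u ^ j) z))) (circlepath 0 r)" for N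
      unfolding g_def by (intro has_contour_integral_sum has_contour_integral_lmul hk[where R = 1])
        (use r z in \<open>auto intro!: holomorphic_intros\<close>)
    have "uniform_limit (sphere 0 r) g (\<lambda>u. k u / (1 - x * u)) sequentially"
    proof -
      have "bounded (k ` sphere 0 r)" by (intro compact_imp_bounded compact_continuous_image kc) auto
      then obtain B where B: "\<And>u. u \<in> sphere 0 r \<Longrightarrow> norm (k u) \<le> B" unfolding bounded_iff by blast
      have ul0: "uniform_limit (sphere 0 r) (\<lambda>N u. \<Sum>j<N. x ^ j * (k u * u ^ j)) (\<lambda>u. \<Sum>j. x ^ j * (k u * u ^ j)) sequentially"
      proof (rule Weierstrass_m_test)
        show "summable (\<lambda>j. (norm x * r) ^ j * B)"
          using xr r0 by (intro summable_mult2 summable_geometric) auto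
        fix j and u :: complex assume u: "u \<in> sphere 0 r"
        have "norm (x ^ j * (k u * u ^ j)) = (norm x * r) ^ j * norm (k u)"
          using u by (simp add: norm_mult norm_power power_mult_distrib)
        also have "\<dots> \<le> (norm x * r) ^ j * B" using B[OF u] r0 by (intro mult_left_mono) auto
        finally show "norm (x ^ j * (k u * u ^ j)) \<le> (norm x * r) ^ j * B" .
      qed
      have eq: "(\<Sum>j. x ^ j * (k u * u ^ j)) = k u / (1 - x * u)" if "u \<in> sphere 0 r" for u
      proof -
        have "norm (x * u) < 1" using that xr by (simp add: norm_mult)
        from sums_mult[OF geometric_sums[OF this], of "k u"] show ?thesis
          by (simp add: sums_iff power_mult_distrib mult_ac)
      qed
      show ?thesis unfolding g_def by (rule iffD1[OF uniform_limit_cong' ul0]) (simp_all only: eq)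
    qed
    moreover have "\<forall>\<^sub>F N in sequentially. g N contour_integrable_on circlepath 0 r"
      by (intro always_eventually allI has_contour_integral_integrable[OF gi])
    ultimately have "(\<lambda>N. contour_integral (circlepath 0 r) (g N)) \<longlonglongrightarrow> contour_integral (circlepath 0 r) (\<lambda>u. k u / (1 - x * u))"
      using r0 by (intro contour_integral_uniform_limit_circlepath(2)) auto
    hence "(\<lambda>N. \<Sum>j<N. x ^ j * (2 * pi * \<i> * (a * lam j))) \<longlonglongrightarrow> 2 * pi * \<i> * (a * m x)"
      unfolding contour_integral_unique[OF gi] contour_integral_unique[OF hm[OF x]] using a0 by (simp add: lam_def)
    hence "(\<lambda>j. x ^ j * (2 * pi * \<i> * (a * lam j))) sums (2 * pi * \<i> * (a * m x))" by (simp add: sums_def)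
    from sums_mult[OF this, of "1 / (2 * pi * \<i> * a)"] a0 show ?thesis by (simp add: mult_ac)
  qed
  have m_hol: "m holomorphic_on ball 0 (1 / r)"
    by (rule power_series_holomorphic[where a = lam]) (use m_sums in auto)
  have m0: "m 0 = 1" by (simp add: m_def) (use a0 in \<open>simp add: a_def\<close>)
  define P where "P = convolution K (\<lambda>u. S u * p u) z / a"
  have pc: "continuous_on (cball 0 \<rho>) p" and ph: "p holomorphic_on ball 0 \<rho>"
    using z by (auto intro!: holomorphic_on_imp_continuous_on holomorphic_on_subset[OF p])
  have inv: "norm (1 / v) < 1 / r" if "norm v = \<rho>" for v :: complex
    using that r r0 by (simp add: norm_divide field_simps)
  have A: "((\<lambda>v. p v * m (1 / v) / v) has_contour_integral (2 * pi * \<i> * P)) (circlepath 0 \<rho>)"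
  proof -
    define f where "f u v = k u * p v / (v - u)" for u v
    have fc: "continuous_on (path_image (circlepath 0 r) \<times> path_image (circlepath 0 \<rho>)) (\<lambda>(u, v). f u v)"
    proof -
      have "continuous_on (sphere 0 r \<times> sphere 0 \<rho>) (\<lambda>x. k (fst x) * p (snd x) / (snd x - fst x))"
        by (intro continuous_intros continuous_on_compose2[OF kc] continuous_on_compose2[OF pc])
           (use r in auto)
      thus ?thesis unfolding f_def using r0 \<rho>0 by (simp add: case_prod_beta)
    qed
    have "contour_integral (circlepath 0 r) (\<lambda>u. contour_integral (circlepath 0 \<rho>) (f u)) =
          contour_integral (circlepath 0 \<rho>) (\<lambda>v. contour_integral (circlepath 0 r) (\<lambda>u. f u v))"
      by (rule contour_integral_swap[OF fc])
         (auto simp: vector_derivative_circlepath intro!: continuous_intros)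
    also have "contour_integral (circlepath 0 r) (\<lambda>u. contour_integral (circlepath 0 \<rho>) (f u)) =
          contour_integral (circlepath 0 r) (\<lambda>u. 2 * pi * \<i> * (k u * p u))"
    proof (rule contour_integral_cong[OF refl])
      fix u assume "u \<in> path_image (circlepath 0 r)"
      hence u: "norm u = r" using r0 by simp
      have "((\<lambda>v. k u * (p v / (v - u))) has_contour_integral (k u * (2 * pi * \<i> * p u))) (circlepath 0 \<rho>)"
        using Cauchy_integral_circlepath[OF pc ph, of u] u r by (intro has_contour_integral_lmul) auto
      moreover have "f u = (\<lambda>v. k u * (p v / (v - u)))" by (simp add: f_def fun_eq_iff)
      ultimately show "contour_integral (circlepath 0 \<rho>) (f u) = 2 * pi * \<i> * (k u * p u)"
        by (simp only: contour_integral_unique mult_ac)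
    qed
    also have "\<dots> = 2 * pi * \<i> * (2 * pi * \<i> * (a * P))"
      by (intro contour_integral_unique has_contour_integral_lmul)
         (use hk[OF p] r z a0 in \<open>simp add: P_def\<close>)
    also have "contour_integral (circlepath 0 \<rho>) (\<lambda>v. contour_integral (circlepath 0 r) (\<lambda>u. f u v)) =
          contour_integral (circlepath 0 \<rho>) (\<lambda>v. 2 * pi * \<i> * a * (p v * m (1 / v) / v))"
    proof (rule contour_integral_cong[OF refl])
      fix v assume "v \<in> path_image (circlepath 0 \<rho>)"
      hence v: "norm v = \<rho>" using \<rho>0 by simp
      hence v0: "v \<noteq> 0" using \<rho>0 by auto
      have "((\<lambda>u. p v / v * (k u / (1 - 1 / v * u))) has_contour_integral (p v / v * (2 * pi * \<i> * (a * m (1 / v))))) (circlepath 0 r)"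
        by (intro has_contour_integral_lmul hm inv v)
      moreover have "p v / v * (k u / (1 - 1 / v * u)) = f u v" if "u \<in> path_image (circlepath 0 r)" for u
      proof -
        have "norm u = r" using that r0 by simp
        hence "v - u \<noteq> 0" using v r by auto
        thus ?thesis using v0 by (simp add: f_def field_simps)
      qed
      ultimately have "((\<lambda>u. f u v) has_contour_integral (p v / v * (2 * pi * \<i> * (a * m (1 / v))))) (circlepath 0 r)"
        by (rule has_contour_integral_eq)
      from contour_integral_unique[OF this]
      show "contour_integral (circlepath 0 r) (\<lambda>u. f u v) = 2 * pi * \<i> * a * (p v * m (1 / v) / v)"
        by (simp only: times_divide_eq_left times_divide_eq_right mult_ac)
    qed
    finally have e: "contour_integral (circlepath 0 \<rho>) (\<lambda>v. 2 * pi * \<i> * a * (p v * m (1 / v) / v)) =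
       2 * pi * \<i> * (2 * pi * \<i> * (a * P))" by simp
    have "continuous_on (sphere 0 \<rho>) (\<lambda>v. p v * m (1 / v) / v)"
      by (intro continuous_intros continuous_on_compose2[OF holomorphic_on_imp_continuous_on[OF m_hol]]
           continuous_on_subset[OF pc]) (use inv \<rho>0 in auto)
    hence ci: "(\<lambda>v. p v * m (1 / v) / v) contour_integrable_on circlepath 0 \<rho>"
      using \<rho>0 by (intro contour_integrable_continuous_circlepath) simp
    have "2 * pi * \<i> * a * contour_integral (circlepath 0 \<rho>) (\<lambda>v. p v * m (1 / v) / v) =
        2 * pi * \<i> * a * (2 * pi * \<i> * P)"
      using e unfolding contour_integral_lmul[OF ci] by (simp only: mult_ac)
    hence "contour_integral (circlepath 0 \<rho>) (\<lambda>v. p v * m (1 / v) / v) = 2 * pi * \<i> * P"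
      using a0 by simp
    with has_contour_integral_integral[OF ci] show ?thesis by simp
  qed
  define mc where "mc v = cnj (m (cnj (v / of_real (\<rho>\<^sup>2))))" for v
  have mc_hol: "mc holomorphic_on ball 0 (\<rho>\<^sup>2 / r)"
  proof -
    have im: "cnj ` ball 0 (1 / r) = ball 0 (1 / r)"
    proof (intro equalityI subsetI)
      fix x :: complex assume "x \<in> ball 0 (1 / r)"
      thus "x \<in> cnj ` ball 0 (1 / r)" by (intro image_eqI[of _ _ "cnj x"]) auto
    qed auto
    have "(cnj \<circ> m \<circ> cnj) holomorphic_on ball 0 (1 / r)"
      by (rule holomorphic_on_compose_cnj_cnj) (use m_hol in \<open>auto simp: im\<close>)
    hence "((cnj \<circ> m \<circ> cnj) \<circ> (\<lambda>v. v / of_real (\<rho>\<^sup>2))) holomorphic_on ball 0 (\<rho>\<^sup>2 / r)"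
      by (rule holomorphic_on_compose_gen[rotated])
         (use r0 \<rho>0 in \<open>auto intro!: holomorphic_intros simp: norm_divide norm_power field_simps\<close>)
    thus ?thesis by (simp add: mc_def[abs_def] o_def)
  qed
  have \<rho>r: "\<rho> < \<rho>\<^sup>2 / r" using r r0 \<rho>0 by (simp add: power2_eq_square field_simps)
  have mc_eq: "mc v = cnj (m (1 / v))" if v: "norm v = \<rho>" for v
  proof -
    have "v \<noteq> 0" using v \<rho>0 by auto
    have "v * cnj v = of_real (\<rho>\<^sup>2)" using v complex_norm_square[of v] by simp
    moreover have "(of_real (\<rho>\<^sup>2) :: complex) \<noteq> 0" using \<rho>0 by simp
    ultimately have "cnj (v / of_real (\<rho>\<^sup>2)) = 1 / v"
      using \<open>v \<noteq> 0\<close> by (simp add: divide_eq_eq eq_divide_eq mult.commute)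
    thus ?thesis by (simp add: mc_def)
  qed
  have B: "((\<lambda>v. p v * (mc v - 1) / v) has_contour_integral 0) (circlepath 0 \<rho>)"
  proof -
    have "((\<lambda>v. p v * (mc v - 1) / (v - 0)) has_contour_integral (2 * of_real pi * \<i> * (p 0 * (mc 0 - 1)))) (circlepath 0 \<rho>)"
    proof (rule Cauchy_integral_circlepath)
      show "continuous_on (cball 0 \<rho>) (\<lambda>v. p v * (mc v - 1))"
        using \<rho>r by (intro continuous_intros pc continuous_on_subset[OF holomorphic_on_imp_continuous_on[OF mc_hol]]) auto
      show "(\<lambda>v. p v * (mc v - 1)) holomorphic_on ball 0 \<rho>"
        using \<rho>r by (intro holomorphic_intros ph holomorphic_on_subset[OF mc_hol]) auto
    qed (use \<rho>0 in auto)
    moreover have "mc 0 = 1" by (simp add: mc_def m0)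
    ultimately show ?thesis by simp
  qed
  define g where "g v = p v * of_real (2 * Re (m (1 / v)) - 1)" for v
  have I1: "((\<lambda>v. g v / v) has_contour_integral (2 * pi * \<i> * P)) (circlepath 0 \<rho>)"
  proof (rule has_contour_integral_eq)
    show "((\<lambda>v. p v * m (1 / v) / v + p v * (mc v - 1) / v) has_contour_integral (2 * pi * \<i> * P)) (circlepath 0 \<rho>)"
      using has_contour_integral_add[OF A B] by simp
    fix v assume "v \<in> path_image (circlepath 0 \<rho>)"
    hence v: "norm v = \<rho>" using \<rho>0 by simp
    have "of_real (2 * Re (m (1 / v)) - 1) = m (1 / v) + (mc v - 1)"
      unfolding mc_eq[OF v] by (simp add: complex_eq_iff)
    hence "g v = p v * (m (1 / v) + (mc v - 1))" by (simp add: g_def)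
    thus "p v * m (1 / v) / v + p v * (mc v - 1) / v = g v / v"
      by (simp add: ring_distribs add_divide_distrib)
  qed
  have I2: "continuous_on (sphere 0 \<rho>) g"
    unfolding g_def
    by (intro continuous_intros continuous_on_compose2[OF holomorphic_on_imp_continuous_on[OF m_hol]]
         continuous_on_subset[OF pc]) (use inv \<rho>0 in auto)
  have I3: "Re (g v) > 0" if v: "norm v = \<rho>" for v
  proof -
    have "Re (m (1 / v)) > 1/2" using M[of "1 / v"] v by (simp add: m_def a_def norm_divide)
    thus ?thesis using pos[OF v] by (simp add: g_def)
  qed
  from circle_average_positive[OF I1 I2 \<rho>0 I3] have "Re P > 0" .
  thus ?thesis by (simp add: P_def a_def)
qed

section \<open>Binomial kernels\<close>

definition binom_coeff :: "real \<Rightarrow> nat \<Rightarrow> complex" where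
  "binom_coeff c n = of_real (pochhammer c n / fact n)"

lemma binom_coeff_Suc: "of_nat (Suc n) * binom_coeff c (Suc n) = (of_real c + of_nat n) * binom_coeff c n"
  by (simp add: binom_coeff_def pochhammer_Suc field_simps del: of_nat_Suc)

lemma norm_binom_coeff_le:
  assumes "0 < c" "c \<le> 1"
  shows "norm (binom_coeff c n) \<le> 1"
proof -
  have "0 \<le> pochhammer c n \<and> pochhammer c n \<le> fact n"
  proof (induction n)
    case (Suc n)
    have "pochhammer c n * (c + real n) \<le> fact n * (1 + real n)"
      using Suc assms by (intro mult_mono) auto
    thus ?case using Suc assms by (simp add: pochhammer_Suc algebra_simps)
  qed simp
  thus ?thesis by (simp add: binom_coeff_def norm_divide)
qed

lemma binom_coeff_sums:
  assumes "norm u < 1"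
  shows "(\<lambda>n. binom_coeff c n * u ^ n) sums ((1 - u) powr (- of_real c))"
proof -
  have "((- of_real c) gchoose n) * (- u) ^ n = binom_coeff c n * u ^ n" for n
    by (simp add: gbinomial_pochhammer binom_coeff_def power_minus[of u] pochhammer_of_real)
  with gen_binomial_complex[of "- u" "- of_real c"] assms show ?thesis by simp
qed

lemma one_minus_powr_holomorphic: "(\<lambda>u. (1 - u) powr a) holomorphic_on ball 0 1"
proof (intro holomorphic_intros)
  fix u :: complex assume "u \<in> ball 0 1"
  hence "Re u < 1" using complex_Re_le_cmod[of u] by simp
  thus "1 - u \<notin> \<real>\<^sub>\<le>\<^sub>0" by (auto simp: complex_nonpos_Reals_iff)
qed

lemma taylor_coeff_one_minus_powr: "taylor_coeff (\<lambda>u. (1 - u) powr (- of_real c)) n = binom_coeff c n"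
  by (rule sums_imp_holomorphic_taylor_coeff(2)[OF zero_less_one binom_coeff_sums])

context
  fixes K :: "complex \<Rightarrow> complex" and c :: real
  assumes K: "K holomorphic_on ball 0 1" and c: "0 < c" "c \<le> 1"
begin

text \<open>
  \<open>N x y\<close> is the convolution of \<open>K\<close> with $(1-yu)^{-c}/(1-xu)$, evaluated at $u = 1$. It satisfies a
  first order differential equation in \<open>y\<close> whose inhomogeneity, and the values on the diagonal,
  only involve \<open>E\<close>; this makes Jack's lemma applicable at the first point where the real part of
  \<open>N x y / E y\<close> drops to $\frac12$.
\<close>

private definition cN :: "nat \<Rightarrow> complex \<Rightarrow> complex \<Rightarrow> complex" where
  "cN n x y = taylor_coeff K n * (\<Sum>j\<le>n. x ^ (n - j) * (binom_coeff c j * y ^ j))"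

private definition N :: "complex \<Rightarrow> complex \<Rightarrow> complex" where "N x y = (\<Sum>n. cN n x y)"

private lemma cN_bound:
  assumes "norm x \<le> \<rho>" "norm y \<le> \<rho>"
  shows "norm (cN n x y) \<le> norm (taylor_coeff K n) * ((1 + real n) * \<rho> ^ n)"
proof -
  have \<rho>: "\<rho> \<ge> 0" using assms(1) norm_ge_zero order.trans by blast
  have "norm (\<Sum>j\<le>n. x ^ (n - j) * (binom_coeff c j * y ^ j)) \<le> (\<Sum>j\<le>n. \<rho> ^ n)"
  proof (rule sum_norm_le)
    fix j assume j: "j \<in> {..n}"
    have "norm (x ^ (n - j) * (binom_coeff c j * y ^ j)) \<le> \<rho> ^ (n - j) * (1 * \<rho> ^ j)"
      unfolding norm_mult norm_power using assms norm_binom_coeff_le[OF c] \<rho>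
      by (intro mult_mono power_mono) auto
    also have "\<dots> = \<rho> ^ n" using j by (simp flip: power_add)
    finally show "norm (x ^ (n - j) * (binom_coeff c j * y ^ j)) \<le> \<rho> ^ n" .
  qed
  thus ?thesis unfolding cN_def norm_mult by (intro mult_left_mono) auto
qed

private lemma bound_summable:
  assumes "0 \<le> \<rho>" "\<rho> < 1"
  shows "summable (\<lambda>n. norm (taylor_coeff K n) * ((1 + real n) * \<rho> ^ n))"
proof -
  have "summable (\<lambda>n. norm (taylor_coeff (\<lambda>z. z * deriv K z) n) * \<rho> ^ n)"
    by (rule taylor_coeff_abs_summable[where R = 1]) (use assms K in \<open>auto intro!: holomorphic_intros\<close>)
  from summable_add[OF taylor_coeff_abs_summable[OF K assms] this] show ?thesis
    by (simp add: taylor_coeff_theta[OF K] norm_mult algebra_simps)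
qed

private lemma N_sums: "norm x < 1 \<Longrightarrow> norm y < 1 \<Longrightarrow> (\<lambda>n. cN n x y) sums N x y"
  unfolding N_def
  by (intro summable_sums summable_comparison_test'[OF bound_summable[of "max (norm x) (norm y)"] cN_bound])
     (auto simp: le_max_iff_disj)

private lemma N_continuous:
  assumes "0 \<le> \<rho>" "\<rho> < 1"
  shows "continuous_on (cball 0 \<rho> \<times> cball 0 \<rho>) (\<lambda>(x, y). N x y)"
proof -
  have "uniform_limit (cball 0 \<rho> \<times> cball 0 \<rho>) (\<lambda>m p. \<Sum>n<m. cN n (fst p) (snd p)) (\<lambda>p. \<Sum>n. cN n (fst p) (snd p)) sequentially"
    by (rule Weierstrass_m_test[OF _ bound_summable[OF assms]]) (auto intro!: cN_bound)
  hence "continuous_on (cball 0 \<rho> \<times> cball 0 \<rho>) (\<lambda>p. \<Sum>n. cN n (fst p) (snd p))"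
    by (rule uniform_limit_theorem[rotated])
       (auto intro!: always_eventually continuous_intros simp: cN_def)
  thus ?thesis by (simp add: N_def case_prod_beta)
qed

private lemma N_holomorphic_fst:
  assumes y: "norm y < 1"
  shows "(\<lambda>x. N x y) holomorphic_on ball 0 1"
proof -
  have "(\<lambda>x. N x y) field_differentiable at x" if x: "x \<in> ball 0 1" for x
  proof -
    obtain \<rho> where \<rho>: "max (norm x) (norm y) < \<rho>" "\<rho> < 1"
      using dense[of "max (norm x) (norm y)" 1] x y by auto
    hence "norm x < \<rho>" by simp
    hence \<rho>0: "0 \<le> \<rho>" using norm_ge_zero[of x] by linarith
    have hol: "(\<lambda>x. cN n x y) holomorphic_on UNIV" for n
      unfolding cN_def by (intro holomorphic_intros)
    obtain g g' where g: "\<forall>x\<in>ball 0 \<rho>. ((\<lambda>n. cN n x y) sums g x) \<and>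
        ((\<lambda>n. deriv (\<lambda>x. cN n x y) x) sums g' x) \<and> (g has_field_derivative g' x) (at x)"
    proof (rule series_and_derivative_comparison[of "ball 0 \<rho>" "\<lambda>n. norm (taylor_coeff K n) * ((1 + real n) * \<rho> ^ n)"
          "\<lambda>n x. cN n x y" "\<lambda>n. deriv (\<lambda>x. cN n x y)"])
      show "\<forall>\<^sub>F n in sequentially. \<forall>x\<in>ball 0 \<rho>. cmod (cN n x y) \<le> cmod (taylor_coeff K n) * ((1 + real n) * \<rho> ^ n)"
        using \<rho> by (auto intro!: always_eventually cN_bound)
      show "((\<lambda>x. cN n x y) has_field_derivative deriv (\<lambda>x. cN n x y) x) (at x)" for n x
        using holomorphic_derivI[OF hol, of x] by simp
    qed (use bound_summable[OF \<rho>0 \<rho>(2)] in \<open>blast+\<close>)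
    have xb: "x \<in> ball 0 \<rho>" using \<rho> by simp
    have "((\<lambda>x. N x y) has_field_derivative g' x) (at x)"
      by (rule has_field_derivative_transform_within_open[where S = "ball 0 \<rho>" and f = g])
         (use g xb in \<open>auto simp: N_def sums_iff\<close>)
    thus ?thesis by (auto simp: field_differentiable_def)
  qed
  thus ?thesis by (auto simp: holomorphic_on_def intro: field_differentiable_at_within)
qed

private definition E :: "complex \<Rightarrow> complex" where "E = convolution K (\<lambda>u. (1 - u) powr (- of_real c))"

private lemma E_sums: "norm y < 1 \<Longrightarrow> (\<lambda>n. taylor_coeff K n * binom_coeff c n * y ^ n) sums E y"
  using convolution_sums[OF K one_minus_powr_holomorphic[of "- of_real c"], of y]
  by (simp add: E_def taylor_coeff_one_minus_powr)

private lemma E_holomorphic: "E holomorphic_on ball 0 1"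
  unfolding E_def by (intro convolution_holomorphic K one_minus_powr_holomorphic) auto

private lemma E_theta_sums:
  assumes "norm y < 1"
  shows "(\<lambda>n. of_nat n * (taylor_coeff K n * binom_coeff c n * y ^ n)) sums (y * deriv E y)"
proof -
  have tE: "taylor_coeff E n = taylor_coeff K n * binom_coeff c n" for n
    unfolding E_def using taylor_coeff_convolution[OF K one_minus_powr_holomorphic[of "- of_real c"]]
    by (simp add: taylor_coeff_one_minus_powr)
  have "(\<lambda>n. taylor_coeff (\<lambda>z. z * deriv E z) n * y ^ n) sums (y * deriv E y)"
    by (rule taylor_coeff_sums[where R = 1]) (use assms E_holomorphic in \<open>auto intro!: holomorphic_intros\<close>)
  thus ?thesis by (simp add: taylor_coeff_theta[OF E_holomorphic] tE mult_ac)
qed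

private lemma N_0: "N 0 y = E y"
proof -
  have "cN n 0 y = taylor_coeff K n * binom_coeff c n * y ^ n" for n
  proof -
    have "(\<Sum>j\<le>n. (0::complex) ^ (n - j) * (binom_coeff c j * y ^ j)) = (\<Sum>j\<in>{n}. binom_coeff c j * y ^ j)"
      by (rule sum.mono_neutral_cong_right) (auto simp: power_0_left)
    thus ?thesis by (simp add: cN_def)
  qed
  thus ?thesis
    using taylor_coeff_one_minus_powr[of c] by (simp add: N_def E_def convolution_eq)
qed

private definition dN :: "nat \<Rightarrow> complex \<Rightarrow> complex \<Rightarrow> complex" where
  "dN n x y = taylor_coeff K n * (\<Sum>j\<le>n. x ^ (n - j) * (binom_coeff c j * (of_nat j * y ^ (j - 1))))"

private lemma cN_derivative: "((\<lambda>y. cN n x y) has_field_derivative dN n x y) (at y)"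
  unfolding cN_def dN_def by (auto intro!: derivative_eq_intros sum.cong)

private lemma dN_eq: "(x - y) * dN n x y =
    of_real c * cN n x y - (of_real c + of_nat n) * (taylor_coeff K n * binom_coeff c n * y ^ n)"
proof -
  have poly: "(x - y) * (\<Sum>j\<le>m. x ^ (m - j) * (binom_coeff c j * (of_nat j * y ^ (j - 1)))) =
     of_real c * (\<Sum>j\<le>m. x ^ (m - j) * (binom_coeff c j * y ^ j)) - (of_real c + of_nat m) * (binom_coeff c m * y ^ m)" for m
  proof (induction m)
    case (Suc m)
    have 1: "(\<Sum>j\<le>Suc m. x ^ (Suc m - j) * (binom_coeff c j * F j)) =
        x * (\<Sum>j\<le>m. x ^ (m - j) * (binom_coeff c j * F j)) + binom_coeff c (Suc m) * F (Suc m)" for F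
      by (simp add: sum_distrib_left Suc_diff_le mult_ac)
    have "(x - y) * (\<Sum>j\<le>Suc m. x ^ (Suc m - j) * (binom_coeff c j * (of_nat j * y ^ (j - 1)))) =
       x * ((x - y) * (\<Sum>j\<le>m. x ^ (m - j) * (binom_coeff c j * (of_nat j * y ^ (j - 1))))) +
       (x - y) * (of_nat (Suc m) * binom_coeff c (Suc m)) * y ^ m"
      unfolding 1 by (simp add: algebra_simps del: of_nat_Suc)
    also have "\<dots> = x * (of_real c * (\<Sum>j\<le>m. x ^ (m - j) * (binom_coeff c j * y ^ j))) -
       y * (of_nat (Suc m) * binom_coeff c (Suc m)) * y ^ m"
      unfolding Suc.IH binom_coeff_Suc by (simp add: algebra_simps)
    also have "\<dots> = of_real c * (\<Sum>j\<le>Suc m. x ^ (Suc m - j) * (binom_coeff c j * y ^ j)) -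
       (of_real c + of_nat (Suc m)) * (binom_coeff c (Suc m) * y ^ Suc m)"
      unfolding 1 by (simp add: algebra_simps)
    finally show ?case .
  qed (simp add: binom_coeff_def)
  have "(x - y) * dN n x y = taylor_coeff K n * ((x - y) * (\<Sum>j\<le>n. x ^ (n - j) * (binom_coeff c j * (of_nat j * y ^ (j - 1)))))"
    by (simp only: dN_def mult_ac)
  thus ?thesis unfolding poly by (simp add: cN_def algebra_simps)
qed

private lemma N_derivative:
  assumes x: "norm x < 1" and y: "norm y < 1"
  obtains D where "((\<lambda>y. N x y) has_field_derivative D) (at y)"
    "(x - y) * D = of_real c * (N x y - E y) - y * deriv E y"
proof -
  define D where "D n y = dN n x y" for n y
  have D: "\<And>n y. ((\<lambda>y. cN n x y) has_field_derivative D n y) (at y)"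
    "\<And>n y. (x - y) * D n y = of_real c * cN n x y - (of_real c + of_nat n) * (taylor_coeff K n * binom_coeff c n * y ^ n)"
    unfolding D_def by (rule cN_derivative, rule dN_eq)
  obtain \<rho> where \<rho>: "max (norm x) (norm y) < \<rho>" "\<rho> < 1"
    using dense[of "max (norm x) (norm y)" 1] x y by auto
  hence "norm x < \<rho>" by simp
  hence \<rho>0: "0 \<le> \<rho>" using norm_ge_zero[of x] by linarith
  obtain g g' where g0: "\<forall>y\<in>ball 0 \<rho>. ((\<lambda>n. cN n x y) sums g y) \<and> ((\<lambda>n. D n y) sums g' y) \<and> (g has_field_derivative g' y) (at y)"
  proof (rule series_and_derivative_comparison[of "ball 0 \<rho>" "\<lambda>n. norm (taylor_coeff K n) * ((1 + real n) * \<rho> ^ n)" "\<lambda>n y. cN n x y" D])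
    show "\<forall>\<^sub>F n in sequentially. \<forall>y\<in>ball 0 \<rho>. cmod (cN n x y) \<le> cmod (taylor_coeff K n) * ((1 + real n) * \<rho> ^ n)"
      using \<rho> by (auto intro!: always_eventually cN_bound)
  qed (use D(1) bound_summable[OF \<rho>0 \<rho>(2)] in \<open>blast+\<close>)
  note g = bspec[OF g0]
  have Ng: "N x y = g y" if "y \<in> ball 0 \<rho>" for y using g[OF that] by (simp add: N_def sums_iff)
  have yb: "y \<in> ball 0 \<rho>" using \<rho> by simp
  have "((\<lambda>y. N x y) has_field_derivative g' y) (at y)"
    by (rule has_field_derivative_transform_within_open[where S = "ball 0 \<rho>" and f = g])
       (use g[OF yb] Ng yb in auto)
  moreover have "(\<lambda>n. (x - y) * D n y) sums (of_real c * (N x y - E y) - y * deriv E y)"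
  proof -
    have "(\<lambda>n. of_real c * cN n x y - (of_real c * (taylor_coeff K n * binom_coeff c n * y ^ n) +
        of_nat n * (taylor_coeff K n * binom_coeff c n * y ^ n))) sums
        (of_real c * N x y - (of_real c * E y + y * deriv E y))"
      by (intro sums_diff sums_add sums_mult N_sums E_sums E_theta_sums x y)
    thus ?thesis unfolding D(2) by (simp add: algebra_simps)
  qed
  moreover have "(\<lambda>n. (x - y) * D n y) sums ((x - y) * g' y)" using g[OF yb] by (intro sums_mult) auto
  ultimately show ?thesis by (intro that) (auto dest: sums_unique2)
qed

private lemma N_diag:
  assumes x: "norm x < 1"
  shows "of_real c * N x x = of_real c * E x + x * deriv E x"
proof -
  obtain D where "(x - x) * D = of_real c * (N x x - E x) - x * deriv E x"
    using N_derivative[OF x x] by blast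
  thus ?thesis by (simp add: algebra_simps)
qed

context
  assumes E0: "\<And>z. norm z < 1 \<Longrightarrow> E z \<noteq> 0"
    and pos: "\<And>z. norm z < 1 \<Longrightarrow> Re (z * deriv E z / E z) > - c / 2"
begin

private lemma N_diag_quotient:
  assumes x: "norm x < 1"
  shows "Re (N x x / E x) > 1/2" "x * deriv E x / E x = of_real c * (N x x / E x - 1)"
proof -
  show *: "x * deriv E x / E x = of_real c * (N x x / E x - 1)"
    using N_diag[OF x] E0[OF x] by (simp add: field_simps)
  have "- c / 2 < c * (Re (N x x / E x) - 1)" using pos[OF x] unfolding * by simp
  hence "c * (1/2 - (Re (N x x / E x))) < 0" by (simp add: algebra_simps)
  thus "Re (N x x / E x) > 1/2" using c by (simp add: mult_less_0_iff)
qed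

private lemma N_half_plane:
  assumes "norm x1 < 1" "norm y1 < 1"
  shows "Re (N x1 y1 / E y1) > 1/2"
proof (rule ccontr)
  assume bad: "\<not> ?thesis"
  define M where "M x y = N x y / E y" for x y
  define \<rho>1 where "\<rho>1 = max (norm x1) (norm y1)"
  have \<rho>1: "0 \<le> \<rho>1" "\<rho>1 < 1" using assms by (auto simp: \<rho>1_def le_max_iff_disj)
  have Mc: "continuous_on (cball 0 \<rho>1 \<times> cball 0 \<rho>1) (\<lambda>(x, y). M x y)"
  proof -
    have "continuous_on (cball 0 \<rho>1 \<times> cball 0 \<rho>1) (\<lambda>p. E (snd p))"
      using \<rho>1 by (intro continuous_on_compose2[OF holomorphic_on_imp_continuous_on[OF E_holomorphic]] continuous_intros) auto
    thus ?thesis unfolding M_def using N_continuous[OF \<rho>1] E0 \<rho>1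
      by (auto simp: case_prod_beta intro!: continuous_intros)
  qed
  define Z where "Z = {p \<in> cball 0 \<rho>1 \<times> cball 0 \<rho>1. Re (M (fst p) (snd p)) \<le> 1/2}"
  have "compact Z"
  proof -
    have "closed Z" unfolding Z_def
      using Mc by (intro continuous_closed_preimage_constant continuous_on_closed_Collect_le closed_Times)
        (auto simp: case_prod_beta intro!: continuous_intros)
    moreover have "Z = (cball 0 \<rho>1 \<times> cball 0 \<rho>1) \<inter> Z" by (auto simp: Z_def)
    ultimately show ?thesis by (metis compact_Int_closed compact_Times compact_cball)
  qed
  moreover have "(x1, y1) \<in> Z" using bad by (auto simp: Z_def M_def \<rho>1_def not_less)
  hence "Z \<noteq> {}" by blast
  moreover have "continuous_on Z (\<lambda>p. max (norm (fst p)) (norm (snd p)))" by (intro continuous_intros)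
  ultimately obtain x0 y0 where xy0: "(x0, y0) \<in> Z"
    and minimal: "\<And>x y. (x, y) \<in> Z \<Longrightarrow> max (norm x0) (norm y0) \<le> max (norm x) (norm y)"
    using continuous_attains_inf[of Z "\<lambda>p. max (norm (fst p)) (norm (snd p))"] by fastforce
  define \<rho> where "\<rho> = max (norm x0) (norm y0)"
  have n0: "norm x0 \<le> \<rho>" "norm y0 \<le> \<rho>" by (auto simp: \<rho>_def)
  have \<rho>: "\<rho> \<le> \<rho>1" "\<rho> < 1" using xy0 \<rho>1 by (auto simp: Z_def \<rho>_def)
  have le: "Re (M x0 y0) \<le> 1/2" using xy0 by (simp add: Z_def)
  have M0: "M 0 y = 1" if "norm y < 1" for y using E0[OF that] by (simp add: M_def N_0)
  have gt: "Re (M x y) > 1/2" if "norm x < \<rho>" "norm y < \<rho>" for x y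
  proof (rule ccontr)
    assume "\<not> ?thesis"
    hence "(x, y) \<in> Z" using that \<rho> by (auto simp: Z_def)
    from minimal[OF this] have "\<rho> \<le> max (norm x) (norm y)" by (simp only: \<rho>_def)
    moreover have "max (norm x) (norm y) < \<rho>" using that by simp
    ultimately show False by (rule leD[THEN notE])
  qed
  have "\<rho> > 0"
  proof (rule ccontr)
    assume "\<not> \<rho> > 0"
    hence "norm x0 \<le> 0" "norm y0 \<le> 0" using n0 by linarith+
    hence "x0 = 0" "y0 = 0" by simp_all
    with le M0[of 0] show False by simp
  qed
  have ge: "Re (M x y) \<ge> 1/2" if xy: "norm x \<le> \<rho>" "norm y \<le> \<rho>" for x y
  proof -
    have "continuous_on {0..1} (\<lambda>t. Re (M (of_real t * x) (of_real t * y)))"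
    proof -
      have "continuous_on {0..1} (\<lambda>t. (\<lambda>(x, y). M x y) (of_real t * x, of_real t * y))"
      proof (rule continuous_on_compose2[OF Mc])
        show "(\<lambda>t::real. (of_real t * x, of_real t * y)) ` {0..1} \<subseteq> cball 0 \<rho>1 \<times> cball 0 \<rho>1"
          using xy \<rho> by (auto simp: norm_mult intro!: order.trans[OF mult_left_le_one_le])
      qed (intro continuous_intros)
      thus ?thesis by (intro continuous_intros) auto
    qed
    hence "continuous_on (closure {0..<1}) (\<lambda>t. Re (M (of_real t * x) (of_real t * y)))" by simp
    hence "1/2 \<le> Re (M (of_real 1 * x) (of_real 1 * y))"
    proof (rule continuous_ge_on_closure)
      show "(1::real) \<in> closure {0..<1}" by simp
      fix t :: real assume t: "t \<in> {0..<1}"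
      have *: "t * norm w < \<rho>" if "norm w \<le> \<rho>" for w :: complex
      proof -
        have "t * norm w \<le> t * \<rho>" using that t by (intro mult_left_mono) auto
        also have "t * \<rho> < \<rho>" using t \<open>\<rho> > 0\<close> by simp
        finally show ?thesis .
      qed
      from *[OF xy(1)] *[OF xy(2)]
      have "Re (M (of_real t * x) (of_real t * y)) > 1/2" using t by (intro gt) (auto simp: norm_mult)
      thus "1/2 \<le> Re (M (of_real t * x) (of_real t * y))" by simp
    qed
    thus ?thesis by simp
  qed
  have eq: "Re (M x0 y0) = 1/2" using le ge[OF n0] by simp
  have ge': "Re (M x0 y0) \<le> Re (M x y)" if "norm x \<le> \<rho>" "norm y \<le> \<rho>" for x y
    using ge[OF that] eq by simp
  have y1: "norm y0 < 1" and x1: "norm x0 < 1" using n0 \<rho> by auto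
  have nx: "norm x0 = \<rho>"
  proof (rule ccontr)
    assume "norm x0 \<noteq> \<rho>"
    hence lt: "norm x0 < \<rho>" using n0 by simp
    have "M 0 y0 = M x0 y0"
    proof (rule holomorphic_Re_attains_bound_imp_const[where S = "ball 0 \<rho>" and f = "\<lambda>x. M x y0"])
      show "(\<lambda>x. M x y0) holomorphic_on ball 0 \<rho>" unfolding M_def
        using \<rho> E0[OF y1] by (intro holomorphic_intros holomorphic_on_subset[OF N_holomorphic_fst[OF y1]]) auto
    qed (use lt \<open>\<rho> > 0\<close> n0 in \<open>auto intro!: ge'\<close>)
    thus False using M0[OF y1] eq by simp
  qed
  have Nd: "(\<lambda>y. N x0 y) field_differentiable at y" if "norm y < 1" for y
    using N_derivative[OF x1 that] by (metis field_differentiable_def)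
  have Mh: "(\<lambda>y. M x0 y) holomorphic_on ball 0 1"
  proof -
    have "(\<lambda>y. N x0 y) holomorphic_on ball 0 1"
      using Nd by (auto simp: holomorphic_on_def intro: field_differentiable_at_within)
    thus ?thesis unfolding M_def using E0 by (intro holomorphic_intros E_holomorphic) auto
  qed
  have diag: "Re (M x0 x0) > 1/2" using N_diag_quotient(1)[OF x1] by (simp add: M_def)
  have ny: "norm y0 = \<rho>"
  proof (rule ccontr)
    assume "norm y0 \<noteq> \<rho>"
    hence lt: "norm y0 < \<rho>" using n0 by simp
    have const: "M x0 y = M x0 y0" if "y \<in> ball 0 \<rho>" for y
    proof (rule holomorphic_Re_attains_bound_imp_const[where S = "ball 0 \<rho>" and f = "\<lambda>y. M x0 y"])
      show "(\<lambda>y. M x0 y) holomorphic_on ball 0 \<rho>" using \<rho> by (intro holomorphic_on_subset[OF Mh]) auto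
    qed (use lt \<open>\<rho> > 0\<close> n0 that in \<open>auto intro!: ge'\<close>)
    have "M x0 x0 = M x0 y0"
    proof (rule continuous_constant_on_closure[where f = "\<lambda>y. M x0 y" and S = "ball 0 \<rho>"])
      show "continuous_on (closure (ball 0 \<rho>)) (\<lambda>y. M x0 y)"
        using \<rho> \<open>\<rho> > 0\<close> by (intro continuous_on_subset[OF holomorphic_on_imp_continuous_on[OF Mh]]) auto
      show "x0 \<in> closure (ball 0 \<rho>)" using n0 \<open>\<rho> > 0\<close> by simp
    qed (rule const)
    with diag eq show False by simp
  qed
  have neq: "x0 \<noteq> y0" using diag eq by auto
  obtain D where D: "((\<lambda>y. N x0 y) has_field_derivative D) (at y0)"
    "(x0 - y0) * D = of_real c * (N x0 y0 - E y0) - y0 * deriv E y0"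
    using N_derivative[OF x1 y1] .
  have ED: "(E has_field_derivative deriv E y0) (at y0)"
    using y1 by (intro holomorphic_derivI[OF E_holomorphic]) auto
  define d where "d = (D * E y0 - N x0 y0 * deriv E y0) / (E y0 * E y0)"
  have "((\<lambda>y. M x0 y) has_field_derivative d) (at y0)"
    unfolding M_def d_def using E0[OF y1] by (auto intro!: derivative_eq_intros D(1) ED)
  moreover have "y0 \<noteq> 0" using ny \<open>\<rho> > 0\<close> by auto
  moreover have "Re (M x0 y0) \<le> Re (M x0 z)" if "norm z \<le> norm y0" for z
    using that ny n0 by (intro ge') auto
  ultimately have J: "Im (y0 * d) = 0" "Re (y0 * d) \<le> 0"
    using Jack_Re[of "M x0" d y0] by blast+
  define k where "k = y0 / (x0 - y0)"
  define J0 where "J0 = N y0 y0 / E y0"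
  have J0: "Re J0 > 1/2" using N_diag_quotient(1)[OF y1] by (simp add: J0_def)
  have Re_k: "Re k = -1/2"
  proof -
    have "k + cnj k = -1"
    proof -
      have "x0 * cnj x0 = y0 * cnj y0" using complex_norm_square[of x0] complex_norm_square[of y0] nx ny by simp
      hence "y0 * cnj (x0 - y0) + cnj y0 * (x0 - y0) = - ((x0 - y0) * cnj (x0 - y0))"
        by (simp add: algebra_simps)
      moreover have "x0 - y0 \<noteq> 0" "cnj (x0 - y0) \<noteq> 0" using neq by auto
      ultimately show ?thesis unfolding k_def by (simp add: divide_simps)
    qed
    thus ?thesis by (simp add: complex_eq_iff)
  qed
  have yd: "y0 * d = of_real c * (k * (M x0 y0 - J0) - M x0 y0 * (J0 - 1))"
  proof -
    have e1: "y0 * deriv E y0 / E y0 = of_real c * (J0 - 1)" using N_diag_quotient(2)[OF y1] by (simp add: J0_def)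
    have "y0 * d = y0 * D / E y0 - M x0 y0 * (y0 * deriv E y0 / E y0)"
      using E0[OF y1] by (simp add: d_def M_def field_simps)
    also have "y0 * D / E y0 = k * ((x0 - y0) * D / E y0)" using neq by (simp add: k_def)
    also have "(x0 - y0) * D / E y0 = of_real c * (M x0 y0 - 1) - y0 * deriv E y0 / E y0"
      unfolding D(2) using E0[OF y1] by (simp add: M_def diff_divide_distrib right_diff_distrib)
    finally show ?thesis unfolding e1 by (simp add: algebra_simps)
  qed
  define \<mu> where "\<mu> = Im (M x0 y0)"
  have Mxy: "M x0 y0 = Complex (1/2) \<mu>" using eq by (simp add: complex_eq_iff \<mu>_def)
  define X where "X = k * (M x0 y0 - J0) - M x0 y0 * (J0 - 1)"
  have X: "y0 * d = of_real c * X" using yd by (simp add: X_def)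
  have "Im X = 0" "Re X \<le> 0" using J c unfolding X by (auto simp: mult_le_0_iff)
  moreover have "Im X = (1/2 - Re J0) * (\<mu> + Im k)"
    by (simp add: X_def Mxy Re_k algebra_simps)
  ultimately have "Im k = - \<mu>" using J0 by simp
  hence "Re X = 1/4 + \<mu>\<^sup>2"
    by (simp add: X_def Mxy Re_k algebra_simps power2_eq_square)
  with \<open>Re X \<le> 0\<close> show False using zero_le_power2[of \<mu>] by linarith
qed

private lemma convolution_kernel_eq_N:
  assumes z: "norm z < 1" "norm (x * z) < 1"
  shows "convolution K (\<lambda>u. (1 - u) powr (- of_real c) / (1 - x * u)) z = N (x * z) z"
proof -
  define R where "R = 1 / (1 + norm x)"
  have R: "0 < R" "R \<le> 1" by (auto simp: R_def add_pos_nonneg)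
  have "(\<lambda>n. (\<Sum>j\<le>n. x ^ (n - j) * binom_coeff c j) * u ^ n) sums ((1 - u) powr (- of_real c) / (1 - x * u))"
    if u: "norm u < R" for u
  proof -
    have u1: "norm u < 1" using u R by simp
    have "norm u * (1 + norm x) < 1" using u by (simp add: R_def field_simps add_pos_nonneg)
    hence xu: "norm (x * u) < 1" by (simp add: norm_mult algebra_simps) (smt (verit) norm_ge_zero)
    have "(\<lambda>n. \<Sum>j\<le>n. (binom_coeff c j * u ^ j) * (x * u) ^ (n - j)) sums
      ((\<Sum>n. binom_coeff c n * u ^ n) * (\<Sum>n. (x * u) ^ n))"
    proof (rule Cauchy_product_sums)
      show "summable (\<lambda>n. norm (binom_coeff c n * u ^ n))"
        by (rule summable_comparison_test'[OF summable_geometric[of "norm u"], where N = 0])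
           (use u1 norm_binom_coeff_le[OF c] in \<open>auto simp: norm_mult norm_power intro!: mult_left_le_one_le\<close>)
      show "summable (\<lambda>n. norm ((x * u) ^ n))"
        using xu by (simp add: norm_power summable_geometric)
    qed
    moreover have "(\<Sum>j\<le>n. (binom_coeff c j * u ^ j) * (x * u) ^ (n - j)) = (\<Sum>j\<le>n. x ^ (n - j) * binom_coeff c j) * u ^ n" for n
      unfolding sum_distrib_right
    proof (rule sum.cong[OF refl])
      fix j assume "j \<in> {..n}"
      hence "u ^ n = u ^ j * u ^ (n - j)" by (simp flip: power_add)
      thus "(binom_coeff c j * u ^ j) * (x * u) ^ (n - j) = x ^ (n - j) * binom_coeff c j * u ^ n"
        by (simp add: power_mult_distrib)
    qed
    ultimately show ?thesis
      using binom_coeff_sums[OF u1, of c] geometric_sums[OF xu] by (simp add: sums_iff)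
  qed
  from sums_imp_holomorphic_taylor_coeff(2)[OF R(1) this]
  have "convolution K (\<lambda>u. (1 - u) powr (- of_real c) / (1 - x * u)) z =
      (\<Sum>n. taylor_coeff K n * (\<Sum>j\<le>n. x ^ (n - j) * binom_coeff c j) * z ^ n)"
    by (simp add: convolution_eq)
  also have "\<dots> = (\<Sum>n. cN n (x * z) z)"
  proof (rule suminf_cong)
    fix n
    have "(\<Sum>j\<le>n. x ^ (n - j) * binom_coeff c j) * z ^ n = (\<Sum>j\<le>n. (x * z) ^ (n - j) * (binom_coeff c j * z ^ j))"
      unfolding sum_distrib_right
    proof (rule sum.cong[OF refl])
      fix j assume "j \<in> {..n}"
      hence "z ^ n = z ^ j * z ^ (n - j)" by (simp flip: power_add)
      thus "x ^ (n - j) * binom_coeff c j * z ^ n = (x * z) ^ (n - j) * (binom_coeff c j * z ^ j)"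
        by (simp add: power_mult_distrib)
    qed
    thus "taylor_coeff K n * (\<Sum>j\<le>n. x ^ (n - j) * binom_coeff c j) * z ^ n = cN n (x * z) z"
      by (simp add: cN_def mult.assoc)
  qed
  finally show ?thesis by (simp add: N_def)
qed

lemma convolution_binomial_kernel_half_plane:
  assumes "norm z < 1" "norm (x * z) < 1"
  shows "Re (convolution K (\<lambda>u. (1 - u) powr (- of_real c) / (1 - x * u)) z / E z) > 1/2"
  using N_half_plane[OF assms(2,1)] convolution_kernel_eq_N[OF assms] by simp

end

lemmas convolution_binomial_kernel_half_plane' = convolution_binomial_kernel_half_plane[unfolded E_def]

end

section \<open>Convolution with prestarlike kernels\<close>

abbreviation theta_quotient :: "(complex \<Rightarrow> complex) \<Rightarrow> complex \<Rightarrow> complex" where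
  "theta_quotient f z \<equiv> z * deriv f z / f z"

lemma Re_geometric_gt:
  fixes w :: complex
  assumes "norm w < 1"
  shows "Re (w / (1 - w)) > -1/2"
proof -
  have w: "1 - w \<noteq> 0" using assms by auto
  define D where "D = (1 - Re w)\<^sup>2 + (Im w)\<^sup>2"
  have D: "D > 0"
  proof -
    have "D = (norm (1 - w))\<^sup>2" by (simp add: D_def cmod_power2)
    thus ?thesis using w by simp
  qed
  have "(Re w)\<^sup>2 + (Im w)\<^sup>2 < 1"
    using assms by (simp add: cmod_def)
  hence "-1/2 * D < Re w * (1 - Re w) - (Im w)\<^sup>2"
    by (simp add: D_def power2_eq_square algebra_simps)
  hence "-1/2 < (Re w * (1 - Re w) - (Im w)\<^sup>2) / D"
    using D by (simp only: pos_less_divide_eq)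
  also have "\<dots> = Re (w / (1 - w))"
    by (simp add: Re_divide D_def power2_eq_square)
  finally show ?thesis .
qed

lemma one_minus_mult_powr_has_derivative:
  fixes x u a :: complex
  assumes "norm (x * u) < 1"
  shows "((\<lambda>u. (1 - x * u) powr a) has_field_derivative (- a * x / (1 - x * u) * (1 - x * u) powr a)) (at u)"
proof -
  have "Re (x * u) < 1" using assms complex_Re_le_cmod[of "x * u"] by linarith
  hence "1 - x * u \<notin> \<real>\<^sub>\<le>\<^sub>0" by (auto simp: complex_nonpos_Reals_iff)
  moreover from this have "1 - x * u \<noteq> 0" by auto
  ultimately show ?thesis
    by (auto intro!: derivative_eq_intros simp: powr_diff)
qed

lemma one_minus_mult_powr_holomorphic:
  "norm x \<le> 1 \<Longrightarrow> (\<lambda>u::complex. (1 - x * u) powr a) holomorphic_on ball 0 1"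
proof (rule holomorphic_onI, rule field_differentiable_at_within)
  fix u :: complex assume "norm x \<le> 1" "u \<in> ball 0 1"
  hence "norm x * norm u \<le> norm u" "norm u < 1" by (auto intro: mult_left_le_one_le)
  hence "norm (x * u) < 1" by (simp add: norm_mult)
  from one_minus_mult_powr_has_derivative[OF this, of a]
  show "(\<lambda>u. (1 - x * u) powr a) field_differentiable at u" by (auto simp: field_differentiable_def)
qed

text \<open>
  In Ruscheweyh's terminology: $zK$ is prestarlike of order $1 - c/2$.
\<close>
locale prestarlike_kernel =
  fixes K :: "complex \<Rightarrow> complex" and c :: real
  assumes K: "K holomorphic_on ball 0 1" and c: "0 < c" "c \<le> 1"
    and E_nonzero: "\<And>z. norm z < 1 \<Longrightarrow> convolution K (\<lambda>u. (1 - u) powr (- of_real c)) z \<noteq> 0"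
    and E_pos: "\<And>z. norm z < 1 \<Longrightarrow>
      Re (theta_quotient (convolution K (\<lambda>u. (1 - u) powr (- of_real c))) z) > - c / 2"
begin

lemma convolution_linear_fraction_nonzero:
  assumes S: "S holomorphic_on ball 0 1" and S0: "\<And>z. norm z < 1 \<Longrightarrow> S z \<noteq> 0"
    and Spos: "\<And>z. norm z < 1 \<Longrightarrow> Re (theta_quotient S z) > - c / 2"
    and x: "norm x = 1" and \<zeta>: "norm \<zeta> < 1" and z: "norm z < norm \<zeta>"
  shows "convolution K (\<lambda>u. S u * (1 - u / \<zeta>) / (1 - x * u)) z \<noteq> 0"
proof -
  have x0: "x \<noteq> 0" and \<zeta>0: "\<zeta> \<noteq> 0" using x z by auto
  have xu: "norm (x * u) = norm u" for u using x by (simp add: norm_mult)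
  have xu1: "1 - x * u \<noteq> 0" if "norm u < 1" for u using xu[of u] that by auto
  define B where "B u = (1 - x * u) powr (- of_real (1 - c))" for u
  define G where "G u = B u * S u" for u
  have Bh: "B holomorphic_on ball 0 1" unfolding B_def by (rule one_minus_mult_powr_holomorphic) (use x in simp)
  have B0: "B u \<noteq> 0" if "norm u < 1" for u using xu1[OF that] by (simp add: B_def)
  have Bd: "(B has_field_derivative (of_real (1 - c) * x / (1 - x * u) * B u)) (at u)" if "norm u < 1" for u
    unfolding B_def using one_minus_mult_powr_has_derivative[of x u "- of_real (1 - c)"] that xu[of u] by simp
  have Gh: "G holomorphic_on ball 0 1" unfolding G_def by (intro holomorphic_intros Bh S)
  have G0: "G u \<noteq> 0" if "norm u < 1" for u using B0[OF that] S0[OF that] by (simp add: G_def)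
  have Gpos: "Re (theta_quotient G u) > -1/2" if u: "norm u < 1" for u
  proof -
    have "(S has_field_derivative deriv S u) (at u)" using u by (intro holomorphic_derivI[OF S]) auto
    hence "(G has_field_derivative (of_real (1 - c) * x / (1 - x * u) * B u * S u + deriv S u * B u)) (at u)"
      unfolding G_def by (intro DERIV_mult Bd u)
    hence "deriv G u = of_real (1 - c) * x / (1 - x * u) * B u * S u + deriv S u * B u"
      by (rule DERIV_imp_deriv)
    moreover have "u * (k * x / d * b * t + t' * b) / (b * t) = k * (x * u / d) + u * t' / t"
      if "b \<noteq> 0" "t \<noteq> 0" "d \<noteq> 0" for k b t t' d :: complex
      using that by (simp add: field_simps)
    ultimately have "theta_quotient G u = of_real (1 - c) * (x * u / (1 - x * u)) + theta_quotient S u"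
      using B0[OF u] S0[OF u] xu1[OF u] by (simp only: G_def) blast
    moreover have "Re (of_real l * X + Y) = l * Re X + Re Y" for l X Y by simp
    ultimately have "Re (theta_quotient G u) = (1 - c) * Re (x * u / (1 - x * u)) + Re (theta_quotient S u)"
      by (simp only:)
    moreover have "(1 - c) * Re (x * u / (1 - x * u)) \<ge> (1 - c) * (-1/2)"
      using Re_geometric_gt[of "x * u"] xu[of u] u c by (intro mult_left_mono) auto
    ultimately show ?thesis using Spos[OF u] by (simp add: field_simps)
  qed
  obtain \<rho> where \<rho>: "norm z < \<rho>" "\<rho> < norm \<zeta>" using dense[OF z] by blast
  have \<rho>0: "0 < \<rho>" using \<rho>(1) by (meson norm_ge_zero le_less_trans)
  define P where "P u = (1 - u / \<zeta>) * G u / G \<zeta>" for u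
  have Ph: "P holomorphic_on ball 0 1" unfolding P_def
    using \<zeta>0 G0[OF \<zeta>] by (intro holomorphic_intros Gh) auto
  define A where "A u = (1 - u) powr (- of_real c)" for u :: complex
  have Ah: "A holomorphic_on ball 0 1" unfolding A_def by (rule one_minus_powr_holomorphic)
  have rot: "norm (u / x) = norm u" for u using x by (simp add: norm_divide)
  have rot_hol: "(\<lambda>v. P (v / x)) holomorphic_on ball 0 1"
  proof -
    have "(P \<circ> (\<lambda>v. v / x)) holomorphic_on ball 0 1"
      by (rule holomorphic_on_compose_gen[OF _ Ph]) (use rot x0 in \<open>auto intro!: holomorphic_intros\<close>)
    thus ?thesis by (simp add: o_def)
  qed
  have "Re (convolution K (\<lambda>u. A u * P (u / x)) (x * z) / convolution K A (x * z)) > 0"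
  proof (rule convolution_quotient_positive[OF K Ah rot_hol, where \<rho> = \<rho>])
    show "norm (x * z) < \<rho>" "\<rho> < 1" using \<rho> \<zeta> xu by auto
    show "convolution K A (x * z) \<noteq> 0" unfolding A_def[abs_def]
      by (rule E_nonzero) (use xu z \<zeta> in auto)
    show "Re (P (u / x)) > 0" if "norm u = \<rho>" for u
      unfolding P_def
      by (rule half_plane_starlike_half[OF Gh G0 Gpos]) (use that rot[of u] \<rho> \<zeta> \<zeta>0 in auto)
    show "Re (convolution K (\<lambda>u. A u / (1 - x' * u)) (x * z) / convolution K A (x * z)) > 1/2"
      if x': "norm x' = 1 / \<rho>" for x'
      unfolding A_def[abs_def]
    proof (rule convolution_binomial_kernel_half_plane'[OF K c E_nonzero E_pos])
      show "norm (x * z) < 1" using xu[of z] z \<zeta> by simp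
      have "norm (x' * (x * z)) = norm z / \<rho>" by (simp add: norm_mult x x')
      thus "norm (x' * (x * z)) < 1" using \<rho> \<rho>0 by simp
    qed
  qed
  moreover have "convolution K (\<lambda>u. A u * P (u / x)) (x * z) = convolution K (\<lambda>u. A (x * u) * P (x * u / x)) z"
    by (rule convolution_dilate[symmetric, where R = 1]) (auto intro!: holomorphic_intros Ah rot_hol)
  moreover have "convolution K (\<lambda>u. A (x * u) * P (x * u / x)) z =
      convolution K (\<lambda>u. 1 / G \<zeta> * (S u * (1 - u / \<zeta>) / (1 - x * u)) + 0 * 0) z"
  proof (rule fun_cong[where x = z], rule convolution_cong[OF zero_less_one])
    fix u :: complex assume u: "norm u < 1"
    have "A (x * u) * B u = 1 / (1 - x * u)"
    proof -
      have "A (x * u) * B u = (1 - x * u) powr (- of_real c + - of_real (1 - c))"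
        unfolding A_def B_def by (rule powr_add[symmetric])
      also have "- of_real c + - of_real (1 - c) = (-1 :: complex)" by simp
      finally show ?thesis using xu1[OF u] by (simp add: powr_minus divide_inverse)
    qed
    moreover have "A (x * u) * P (x * u / x) = (A (x * u) * B u) * ((1 - u / \<zeta>) * S u / G \<zeta>)"
      using x0 by (simp add: P_def G_def)
    ultimately have "A (x * u) * P (x * u / x) = 1 / (1 - x * u) * ((1 - u / \<zeta>) * S u / G \<zeta>)"
      by (simp only:)
    thus "A (x * u) * P (x * u / x) = 1 / G \<zeta> * (S u * (1 - u / \<zeta>) / (1 - x * u)) + 0 * 0"
      by (simp add: mult_ac)
  qed
  moreover have "\<dots> = 1 / G \<zeta> * convolution K (\<lambda>u. S u * (1 - u / \<zeta>) / (1 - x * u)) z + 0 * convolution K (\<lambda>_. 0) z"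
    by (rule convolution_linear[OF K, where R = 1])
       (use xu1 \<zeta>0 z \<zeta> in \<open>auto intro!: holomorphic_intros S\<close>)
  ultimately show ?thesis by auto
qed

lemma convolution_starlike_half_plane:
  assumes S: "S holomorphic_on ball 0 1" and S0: "\<And>z. norm z < 1 \<Longrightarrow> S z \<noteq> 0"
    and Spos: "\<And>z. norm z < 1 \<Longrightarrow> Re (theta_quotient S z) > - c / 2"
    and x: "norm x = 1" and z: "norm z < 1"
  shows "convolution K S z \<noteq> 0" "Re (convolution K (\<lambda>u. S u / (1 - x * u)) z / convolution K S z) > 1/2"
proof -
  define a where "a = convolution K S"
  define N where "N = convolution K (\<lambda>u. S u / (1 - x * u))"
  have xu1: "1 - x * u \<noteq> 0" if "norm u < 1" for u
  proof -
    have "norm (x * u) < 1" using that x by (simp add: norm_mult)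
    thus ?thesis by auto
  qed
  have Nh: "(\<lambda>u. S u / (1 - x * u)) holomorphic_on ball 0 1" using xu1 by (intro holomorphic_intros S) auto
  have x0: "x \<noteq> 0" using x by auto
  obtain R where R: "norm z < R" "R < 1" using dense[OF z] by blast
  have R0: "0 < R" using R by (meson norm_ge_zero le_less_trans)
  have ne: "norm (N w - a w) \<noteq> R * norm (N w)" if w: "norm w < R" for w
  proof
    assume eq: "norm (N w - a w) = R * norm (N w)"
    define \<zeta> where "\<zeta> = (if N w = 0 then of_real R else (N w - a w) / (x * N w))"
    have n\<zeta>: "norm \<zeta> = R" using eq x R0 by (auto simp: \<zeta>_def norm_divide norm_mult)
    have \<zeta>0: "\<zeta> \<noteq> 0" using n\<zeta> R0 by auto
    have "convolution K (\<lambda>u. S u * (1 - u / \<zeta>) / (1 - x * u)) w =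
          convolution K (\<lambda>u. 1 / (x * \<zeta>) * S u + (1 - 1 / (x * \<zeta>)) * (S u / (1 - x * u))) w"
    proof (rule fun_cong[where x = w], rule convolution_cong[OF zero_less_one])
      fix u :: complex assume "norm u < 1"
      from xu1[OF this] show "S u * (1 - u / \<zeta>) / (1 - x * u) =
          1 / (x * \<zeta>) * S u + (1 - 1 / (x * \<zeta>)) * (S u / (1 - x * u))"
        using x0 \<zeta>0 by (simp add: field_simps)
    qed
    also have "\<dots> = 1 / (x * \<zeta>) * a w + (1 - 1 / (x * \<zeta>)) * N w"
      unfolding a_def N_def using w R by (intro convolution_linear[OF K S Nh]) auto
    also have "\<dots> = 0"
    proof (cases "N w = 0")
      case True
      with eq show ?thesis by simp
    next
      case False
      hence "x * \<zeta> * N w = N w - a w" using x0 by (simp add: \<zeta>_def)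
      thus ?thesis using x0 \<zeta>0 by (simp add: field_simps)
    qed
    finally show False
      using convolution_linear_fraction_nonzero[OF S S0 Spos x, of \<zeta> w] n\<zeta> w R by auto
  qed
  have lt: "norm (N z - a z) < R * norm (N z)"
  proof (rule ccontr)
    assume neg: "\<not> ?thesis"
    define h where "h t = norm (N (of_real t * z) - a (of_real t * z)) - R * norm (N (of_real t * z))" for t :: real
    have tz: "norm (of_real t * z) \<le> norm z" if "t \<in> {0..1}" for t :: real
      using that by (auto simp: norm_mult intro: mult_left_le_one_le)
    have "a holomorphic_on ball 0 1" "N holomorphic_on ball 0 1"
      unfolding a_def N_def by (intro convolution_holomorphic K S Nh zero_less_one)+
    moreover have "continuous_on {0..1} (\<lambda>t::real. f (of_real t * z))" if f: "f holomorphic_on ball 0 1" for f :: "complex \<Rightarrow> complex"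
    proof (rule continuous_on_compose2[OF holomorphic_on_imp_continuous_on[OF f]])
      show "continuous_on {0..1} (\<lambda>t::real. of_real t * z)" by (intro continuous_intros)
      show "(\<lambda>t::real. of_real t * z) ` {0..1} \<subseteq> ball 0 1"
      proof safe
        fix t :: real assume "t \<in> {0..1}"
        from tz[OF this] z show "of_real t * z \<in> ball 0 1" by simp
      qed
    qed
    ultimately have "continuous_on {0..1} (\<lambda>t::real. a (of_real t * z))" "continuous_on {0..1} (\<lambda>t::real. N (of_real t * z))"
      by blast+
    hence "continuous_on {0..1} h" unfolding h_def by (intro continuous_intros)
    moreover have "h 0 \<le> 0"
    proof -
      have "N 0 = K 0 * S 0" "a 0 = K 0 * S 0"
        unfolding N_def a_def using convolution_0[OF K Nh] convolution_0[OF K S] by auto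
      thus ?thesis using R0 by (simp add: h_def)
    qed
    moreover have "0 \<le> h 1" using neg by (simp add: h_def)
    ultimately obtain t where "0 \<le> t" "t \<le> 1" "h t = 0" using IVT'[of h 0 0 1] by auto
    with ne[of "of_real t * z"] tz[of t] R show False by (auto simp: h_def)
  qed
  have lt': "norm (N z - a z) < norm (N z)"
  proof -
    have "R * norm (N z) \<le> norm (N z)" using R by (intro mult_left_le_one_le) (use R0 in auto)
    with lt show ?thesis by linarith
  qed
  show a0: "convolution K S z \<noteq> 0" using lt' by (auto simp: a_def)
  have N0: "N z \<noteq> 0" using lt' by auto
  define w where "w = (N z - a z) / N z"
  have w: "norm w < 1" using lt' N0 by (simp add: w_def norm_divide)
  have "N z / a z = 1 / (1 - w)" using N0 a0 by (simp add: w_def a_def field_simps)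
  also have "\<dots> = 1 + w / (1 - w)"
  proof -
    have "1 - w \<noteq> 0" using w by auto
    thus ?thesis by (simp add: field_simps)
  qed
  finally have "Re (N z / a z) = 1 + Re (w / (1 - w))" by simp
  with Re_geometric_gt[OF w] show "Re (convolution K (\<lambda>u. S u / (1 - x * u)) z / convolution K S z) > 1/2"
    by (simp add: N_def a_def)
qed

lemma convolution_starlike_quotient_positive:
  assumes S: "S holomorphic_on ball 0 1" and S0: "\<And>z. norm z < 1 \<Longrightarrow> S z \<noteq> 0"
    and Spos: "\<And>z. norm z < 1 \<Longrightarrow> Re (theta_quotient S z) > - c / 2"
    and p: "p holomorphic_on ball 0 1" and z: "norm z < \<rho>" "\<rho> < 1"
    and pos: "\<And>u. norm u = \<rho> \<Longrightarrow> Re (p u) > 0"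
  shows "Re (convolution K (\<lambda>u. S u * p u) z / convolution K S z) > 0"
proof (rule convolution_quotient_positive[OF K S p z _ _ pos])
  have \<rho>: "\<rho> > 0" using z by (meson norm_ge_zero le_less_trans)
  show "convolution K S z \<noteq> 0"
    by (rule convolution_starlike_half_plane(1)[OF S S0 Spos norm_one]) (use z in auto)
  fix x :: complex assume x: "norm x = 1 / \<rho>"
  define S' where "S' u = S (of_real \<rho> * u)" for u
  have n\<rho>: "norm (of_real \<rho> * u) < 1" if "norm u < 1" for u :: complex
  proof -
    have "\<rho> * norm u \<le> \<rho> * 1" using that \<rho> by (intro mult_left_mono) auto
    hence "\<rho> * norm u < 1" using z(2) by linarith
    thus ?thesis using \<rho> by (simp add: norm_mult)
  qed
  have S'h: "S' holomorphic_on ball 0 1"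
  proof -
    have "(S \<circ> (\<lambda>u. of_real \<rho> * u)) holomorphic_on ball 0 1"
      by (rule holomorphic_on_compose_gen[OF _ S]) (use n\<rho> in \<open>auto intro!: holomorphic_intros\<close>)
    thus ?thesis by (simp add: S'_def[abs_def] o_def)
  qed
  have tq: "theta_quotient S' u = theta_quotient S (of_real \<rho> * u)" if u: "norm u < 1" for u
  proof -
    have "(S has_field_derivative deriv S (of_real \<rho> * u)) (at (of_real \<rho> * u))"
      using n\<rho>[OF u] by (intro holomorphic_derivI[OF S]) auto
    hence "((\<lambda>u. S (of_real \<rho> * u)) has_field_derivative deriv S (of_real \<rho> * u) * of_real \<rho>) (at u)"
      by (rule DERIV_chain2) (auto intro!: derivative_eq_intros)
    hence "deriv S' u = deriv S (of_real \<rho> * u) * of_real \<rho>"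
      unfolding S'_def[abs_def] by (rule DERIV_imp_deriv)
    thus ?thesis by (simp add: S'_def mult_ac)
  qed
  have *: "Re (convolution K (\<lambda>u. S' u / (1 - x * of_real \<rho> * u)) (z / of_real \<rho>) / convolution K S' (z / of_real \<rho>)) > 1/2"
  proof (rule convolution_starlike_half_plane(2)[OF S'h])
    show "norm (x * of_real \<rho>) = 1" using x \<rho> by (simp add: norm_mult)
    show "norm (z / of_real \<rho>) < 1" using z \<rho> by (simp add: norm_divide)
    show "S' u \<noteq> 0" if "norm u < 1" for u
      using S0[OF n\<rho>[OF that]] by (simp add: S'_def)
    show "Re (theta_quotient S' u) > - c / 2" if "norm u < 1" for u
      unfolding tq[OF that] by (rule Spos[OF n\<rho>[OF that]])
  qed
  have xn: "1 - x * u \<noteq> 0" if "norm u < \<rho>" for u :: complex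
  proof
    assume "1 - x * u = 0"
    hence "norm x * norm u = 1" by (metis norm_mult norm_one right_minus_eq)
    thus False using x \<rho> that by (simp add: field_simps)
  qed
  have "(\<lambda>u. S u / (1 - x * u)) holomorphic_on ball 0 \<rho>"
    using z xn by (intro holomorphic_intros holomorphic_on_subset[OF S]) auto
  from convolution_dilate[OF this \<rho>, of K "of_real \<rho>" "z / of_real \<rho>"] convolution_dilate[OF S, of K "of_real \<rho>" "z / of_real \<rho>"]
  show "Re (convolution K (\<lambda>u. S u / (1 - x * u)) z / convolution K S z) > 1/2"
    using * \<rho> by (simp add: S'_def[abs_def] mult.assoc)
qed

lemma convolution_starlike_quotient_mem:
  assumes S: "S holomorphic_on ball 0 1" and S0: "\<And>z. norm z < 1 \<Longrightarrow> S z \<noteq> 0"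
    and Spos: "\<And>z. norm z < 1 \<Longrightarrow> Re (theta_quotient S z) > - c / 2"
    and p: "p holomorphic_on ball 0 1" and z: "norm z < \<rho>" "\<rho> < 1"
    and C: "convex C" "closed C" "p ` sphere 0 \<rho> \<subseteq> C"
  shows "convolution K (\<lambda>u. S u * p u) z / convolution K S z \<in> C"
proof (rule ccontr)
  assume notin: "\<not> ?thesis"
  define w where "w = convolution K (\<lambda>u. S u * p u) z / convolution K S z"
  obtain d b where db: "inner d w < b" "\<And>y. y \<in> C \<Longrightarrow> inner d y > b"
    using separating_hyperplane_closed_point[OF C(1,2), of w] notin by (auto simp: w_def)
  have inner: "inner d y = Re (cnj d * y)" for y by (simp add: inner_complex_def)
  have nz: "convolution K S z \<noteq> 0"
    by (rule convolution_starlike_half_plane(1)[OF S S0 Spos norm_one]) (use z in auto)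
  have "Re (convolution K (\<lambda>u. S u * (cnj d * p u - of_real b)) z / convolution K S z) > 0"
  proof (rule convolution_starlike_quotient_positive[OF S S0 Spos _ z])
    show "(\<lambda>u. cnj d * p u - of_real b) holomorphic_on ball 0 1" by (intro holomorphic_intros p)
    show "Re (cnj d * p u - of_real b) > 0" if "norm u = \<rho>" for u
    proof -
      have "p u \<in> C" using C(3) that by auto
      from db(2)[OF this] show ?thesis unfolding inner by simp
    qed
  qed
  also have "(\<lambda>u. S u * (cnj d * p u - of_real b)) = (\<lambda>u. cnj d * (S u * p u) + (- of_real b) * S u)"
    by (simp add: fun_eq_iff algebra_simps)
  also have "convolution K \<dots> z = cnj d * convolution K (\<lambda>u. S u * p u) z + (- of_real b) * convolution K S z"
    by (rule convolution_linear[OF K, where R = 1]) (use z in \<open>auto intro!: holomorphic_intros S p\<close>)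
  also have "\<dots> / convolution K S z = cnj d * w - of_real b"
    using nz by (simp add: w_def diff_divide_distrib)
  finally have "inner d w > b" unfolding inner by simp
  with db(1) show False by simp
qed

lemma theta_quotient_convolution_mem:
  assumes S: "S holomorphic_on ball 0 1" and S0: "\<And>z. norm z < 1 \<Longrightarrow> S z \<noteq> 0"
    and Spos: "\<And>z. norm z < 1 \<Longrightarrow> Re (theta_quotient S z) > - c / 2"
    and z: "norm z < \<rho>" "\<rho> < 1"
    and C: "convex C" "closed C" "\<And>u. norm u = \<rho> \<Longrightarrow> theta_quotient S u \<in> C"
  shows "theta_quotient (convolution K S) z \<in> C"
proof -
  have ph: "theta_quotient S holomorphic_on ball 0 1"
    using S0 by (intro holomorphic_intros S) auto
  have "convolution K (\<lambda>u. S u * theta_quotient S u) z / convolution K S z \<in> C"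
    by (rule convolution_starlike_quotient_mem[OF S S0 Spos ph z C(1,2)]) (use C(3) in auto)
  also have "convolution K (\<lambda>u. S u * theta_quotient S u) = convolution K (\<lambda>u. u * deriv S u)"
    by (rule convolution_cong[OF zero_less_one]) (use S0 in auto)
  also have "convolution K (\<lambda>u. u * deriv S u) z = z * deriv (convolution K S) z"
    by (rule convolution_theta[OF K S]) (use z in auto)
  finally show ?thesis .
qed

end

lemma norm_binom_coeff_ge:
  assumes "0 < c"
  shows "norm (binom_coeff c n) * (c + real n) \<ge> c"
proof (cases n)
  case 0 thus ?thesis by (simp add: binom_coeff_def)
next
  case (Suc m)
  have "norm (binom_coeff c n) * (c + real n) \<ge> c" for n
  proof (induction n)
    case (Suc n)
    have "norm (of_nat (Suc n) * binom_coeff c (Suc n)) = norm ((of_real c + of_nat n) * binom_coeff c n)"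
      by (simp only: binom_coeff_Suc)
    also have "(of_real c + of_nat n :: complex) = of_real (c + real n)" by simp
    finally have "real (Suc n) * norm (binom_coeff c (Suc n)) = (c + real n) * norm (binom_coeff c n)"
      using assms by (simp add: norm_mult del: of_nat_Suc of_real_add)
    moreover have "real (Suc n) * norm (binom_coeff c (Suc n)) \<le> (c + real (Suc n)) * norm (binom_coeff c (Suc n))"
      using assms by (intro mult_right_mono) auto
    ultimately show ?case using Suc by (simp add: mult.commute)
  qed (simp add: binom_coeff_def)
  thus ?thesis .
qed

lemma theta_quotient_cong:
  assumes "\<And>u. norm u < 1 \<Longrightarrow> f u = g u" "norm z < 1"
  shows "theta_quotient f z = theta_quotient g z"
proof -
  have "eventually (\<lambda>u. u \<in> ball 0 1) (nhds z)" using assms(2) by (intro eventually_nhds_in_open) auto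
  hence "eventually (\<lambda>u. f u = g u) (nhds z)" by eventually_elim (use assms in auto)
  from deriv_cong_ev[OF this refl] assms show ?thesis by simp
qed

lemma prestarlike_kernel_exists:
  assumes G: "G holomorphic_on ball 0 1" and c: "0 < c" "c \<le> 1"
    and G0: "\<And>z. norm z < 1 \<Longrightarrow> G z \<noteq> 0" and Gpos: "\<And>z. norm z < 1 \<Longrightarrow> Re (theta_quotient G z) > - c / 2"
  obtains K where "prestarlike_kernel K c"
    "\<And>z. norm z < 1 \<Longrightarrow> convolution K (\<lambda>u. (1 - u) powr (- of_real c)) z = G z"
proof -
  define k where "k n = taylor_coeff G n / binom_coeff c n" for n
  have e0: "binom_coeff c n \<noteq> 0" for n using norm_binom_coeff_ge[OF c(1), of n] c by auto
  have bound: "norm (k n) \<le> norm (taylor_coeff G n) + 1 / c * norm (taylor_coeff (\<lambda>z. z * deriv G z) n)" for n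
  proof -
    have "norm (k n) = norm (taylor_coeff G n) * (1 / norm (binom_coeff c n))" by (simp add: k_def norm_divide)
    also have "1 / norm (binom_coeff c n) \<le> (c + real n) / c"
      using norm_binom_coeff_ge[OF c(1), of n] e0[of n] c by (simp add: divide_simps mult.commute)
    hence "norm (taylor_coeff G n) * (1 / norm (binom_coeff c n)) \<le> norm (taylor_coeff G n) * ((c + real n) / c)"
      by (rule mult_left_mono) simp
    also have "\<dots> = norm (taylor_coeff G n) + 1 / c * norm (taylor_coeff (\<lambda>z. z * deriv G z) n)"
      using c by (simp add: taylor_coeff_theta[OF G] norm_mult field_simps)
    finally show ?thesis .
  qed
  define K where "K z = (\<Sum>n. k n * z ^ n)" for z
  have Ks: "(\<lambda>n. k n * z ^ n) sums K z" if z: "norm z < 1" for z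
  proof -
    let ?h = "\<lambda>n. norm (taylor_coeff G n) * norm z ^ n + 1 / c * (norm (taylor_coeff (\<lambda>z. z * deriv G z) n) * norm z ^ n)"
    have zh: "(\<lambda>z. z * deriv G z) holomorphic_on ball 0 1" by (intro holomorphic_intros G) auto
    have "summable ?h"
      by (rule summable_add[OF taylor_coeff_abs_summable[OF G norm_ge_zero z]
            summable_mult[OF taylor_coeff_abs_summable[OF zh norm_ge_zero z]]])
    moreover have "norm (k n * z ^ n) \<le> ?h n" for n
    proof -
      have "norm (k n * z ^ n) \<le> (norm (taylor_coeff G n) + 1 / c * norm (taylor_coeff (\<lambda>z. z * deriv G z) n)) * norm z ^ n"
        unfolding norm_mult norm_power by (rule mult_right_mono[OF bound]) simp
      thus ?thesis by (simp only: distrib_right mult.assoc)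
    qed
    ultimately have "summable (\<lambda>n. k n * z ^ n)" by (rule summable_comparison_test'[where N = 0])
    thus ?thesis unfolding K_def by (rule summable_sums)
  qed
  have Kh: "K holomorphic_on ball 0 1"
    by (rule sums_imp_holomorphic_taylor_coeff(1)[OF zero_less_one Ks])
  have Kc: "taylor_coeff K n = k n" for n
    by (rule sums_imp_holomorphic_taylor_coeff(2)[OF zero_less_one Ks])
  have eq: "convolution K (\<lambda>u. (1 - u) powr (- of_real c)) z = G z" if z: "norm z < 1" for z
    unfolding convolution_eq Kc taylor_coeff_one_minus_powr
    using taylor_coeff_sums[OF G z] e0 by (simp add: k_def sums_iff)
  have "prestarlike_kernel K c"
  proof
    show "convolution K (\<lambda>u. (1 - u) powr (- of_real c)) z \<noteq> 0" if "norm z < 1" for z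
      using eq[OF that] G0[OF that] by simp
    show "Re (theta_quotient (convolution K (\<lambda>u. (1 - u) powr (- of_real c))) z) > - c / 2" if "norm z < 1" for z
    proof -
      have "theta_quotient (convolution K (\<lambda>u. (1 - u) powr (- of_real c))) z = theta_quotient G z"
        by (rule theta_quotient_cong[OF eq that])
      with Gpos[OF that] show ?thesis by (simp only:)
    qed
  qed (use Kh c in auto)
  thus ?thesis using eq by (rule that)
qed

lemma theta_quotient_one_minus_powr:
  assumes "norm z < 1"
  shows "theta_quotient (\<lambda>u. (1 - u) powr (- of_real c)) z = of_real c * (z / (1 - z))"
proof -
  have "1 - z \<noteq> 0" using assms by auto
  moreover have "deriv (\<lambda>u. (1 - u) powr (- of_real c)) z = of_real c / (1 - z) * (1 - z) powr (- of_real c)"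
    using one_minus_mult_powr_has_derivative[of 1 z "- of_real c"] assms by (intro DERIV_imp_deriv) simp
  ultimately show ?thesis by simp
qed

lemma Re_theta_quotient_one_minus_powr:
  assumes "norm z < 1" "0 < c"
  shows "Re (theta_quotient (\<lambda>u. (1 - u) powr (- of_real c)) z) > - c / 2"
proof -
  have "c * (-1/2) < c * Re (z / (1 - z))"
    using Re_geometric_gt[OF assms(1)] assms(2) by (intro mult_strict_left_mono)
  moreover have "Re (theta_quotient (\<lambda>u. (1 - u) powr (- of_real c)) z) = c * Re (z / (1 - z))"
  proof -
    have "Re (of_real c * X) = c * Re X" for X by simp
    thus ?thesis unfolding theta_quotient_one_minus_powr[OF assms(1)] .
  qed
  ultimately show ?thesis by linarith
qed

lemma convolution_geometric:
  assumes "K holomorphic_on ball 0 1" "norm z < 1"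
  shows "convolution K (\<lambda>u. (1 - u) powr (- of_real 1)) z = K z"
proof -
  have "binom_coeff 1 n = 1" for n by (simp add: binom_coeff_def pochhammer_fact[symmetric])
  hence "taylor_coeff (\<lambda>u. (1 - u) powr (- of_real 1)) n = 1" for n
    using taylor_coeff_one_minus_powr[of 1 n] by simp
  thus ?thesis using taylor_coeff_sums[OF assms] by (simp add: convolution_eq sums_iff)
qed

lemma theta_quotient_strict:
  assumes "f holomorphic_on ball 0 1" "\<And>z. norm z < 1 \<Longrightarrow> f z \<noteq> 0"
    and "\<And>z. norm z < 1 \<Longrightarrow> Re (theta_quotient f z) \<ge> - c / 2" "0 < c" "norm z < 1"
  shows "Re (theta_quotient f z) > - c / 2"
proof (rule Re_greater_if_nonconst[where S = "ball 0 1" and f = "theta_quotient f" and w = 0])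
  show "theta_quotient f holomorphic_on ball 0 1" using assms(2) by (intro holomorphic_intros assms(1)) auto
qed (use assms in auto)

lemma convolution_binomials_order:
  assumes a: "0 < a" "a \<le> 1" and b: "0 < b" "b \<le> 1" and z: "norm z < 1"
  defines "H \<equiv> convolution (\<lambda>u. (1 - u) powr (- of_real a)) (\<lambda>u. (1 - u) powr (- of_real b))"
  shows "H z \<noteq> 0" "Re (theta_quotient H z) > - b / 2"
proof -
  let ?A = "\<lambda>u :: complex. (1 - u) powr (- of_real a)" and ?B = "\<lambda>u :: complex. (1 - u) powr (- of_real b)"
  have A: "?A holomorphic_on ball 0 1" and B: "?B holomorphic_on ball 0 1"
    by (rule one_minus_powr_holomorphic)+
  interpret prestarlike_kernel ?A 1
  proof
    fix z :: complex assume z: "norm z < 1"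
    show "convolution ?A (\<lambda>u. (1 - u) powr (- of_real 1)) z \<noteq> 0"
      unfolding convolution_geometric[OF A z] using z by auto
    have "theta_quotient (convolution ?A (\<lambda>u. (1 - u) powr (- of_real 1))) z = theta_quotient ?A z"
      by (rule theta_quotient_cong[OF convolution_geometric[OF A] z])
    thus "Re (theta_quotient (convolution ?A (\<lambda>u. (1 - u) powr (- of_real 1))) z) > - 1 / 2"
      using Re_theta_quotient_one_minus_powr[OF z a(1)] a by simp
  qed (use A in auto)
  have B0: "?B z \<noteq> 0" if "norm z < 1" for z using that by auto
  have Bpos: "Re (theta_quotient ?B z) > - b / 2" if "norm z < 1" for z
    by (rule Re_theta_quotient_one_minus_powr[OF that b(1)])
  have Bpos1: "Re (theta_quotient ?B z) > - 1 / 2" if "norm z < 1" for z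
    using Bpos[OF that] b by simp
  have H0: "H z \<noteq> 0" if "norm z < 1" for z
    unfolding H_def by (rule convolution_starlike_half_plane(1)[OF B B0 Bpos1 norm_one that])
  show "H z \<noteq> 0" by (rule H0[OF z])
  have ge: "Re (theta_quotient H z) \<ge> - b / 2" if z: "norm z < 1" for z
  proof -
    obtain \<rho> where \<rho>: "norm z < \<rho>" "\<rho> < 1" using dense[OF z] by blast
    have mem: "theta_quotient ?B u \<in> {w. Re w \<ge> - b / 2}" if "norm u = \<rho>" for u
      using less_imp_le[OF Bpos[of u]] that \<rho> by blast
    have "theta_quotient (convolution ?A ?B) z \<in> {w. Re w \<ge> - b / 2}"
      by (rule theta_quotient_convolution_mem[OF B B0 Bpos1 \<rho> convex_halfspace_Re_ge closed_halfspace_Re_ge])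
         ((assumption | rule mem)+)
    thus ?thesis by (simp add: H_def)
  qed
  have Hh: "H holomorphic_on ball 0 1" unfolding H_def by (rule convolution_holomorphic[OF A B zero_less_one])
  show "Re (theta_quotient H z) > - b / 2"
    by (rule theta_quotient_strict[OF Hh H0 ge b(1) z])
qed

lemma convolution_theta_quotient_hull:
  fixes F G :: "complex \<Rightarrow> complex"
  assumes ab: "0 < a" "a \<le> b" "b \<le> 1"
    and F: "F holomorphic_on ball 0 1" "\<And>z. norm z < 1 \<Longrightarrow> F z \<noteq> 0"
      "\<And>z. norm z < 1 \<Longrightarrow> Re (theta_quotient F z) > - a / 2"
    and G: "G holomorphic_on ball 0 1" "\<And>z. norm z < 1 \<Longrightarrow> G z \<noteq> 0"
      "\<And>z. norm z < 1 \<Longrightarrow> Re (theta_quotient G z) > - b / 2"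
    and z: "norm z < 1"
  defines "H \<equiv> convolution (\<lambda>u. (1 - u) powr (- of_real a)) (\<lambda>u. (1 - u) powr (- of_real b))"
  shows "convolution F G z \<noteq> 0"
    "\<lbrakk>norm z < \<rho>; \<rho> < 1; convex C; closed C; \<And>u. norm u = \<rho> \<Longrightarrow> theta_quotient H u \<in> C\<rbrakk>
       \<Longrightarrow> theta_quotient (convolution F G) z \<in> C"
proof -
  let ?A = "\<lambda>u :: complex. (1 - u) powr (- of_real a)" and ?B = "\<lambda>u :: complex. (1 - u) powr (- of_real b)"
  have A: "?A holomorphic_on ball 0 1" and B: "?B holomorphic_on ball 0 1"
    by (rule one_minus_powr_holomorphic)+
  have Hh: "H holomorphic_on ball 0 1" unfolding H_def by (rule convolution_holomorphic[OF A B zero_less_one])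
  have H0: "H z \<noteq> 0" if "norm z < 1" for z
    unfolding H_def using convolution_binomials_order(1)[of a b z] ab that by auto
  have Hpos: "Re (theta_quotient H z) > - a / 2" if "norm z < 1" for z
    unfolding H_def convolution_commute[of ?A]
    using convolution_binomials_order(2)[of b a z] ab that by auto
  have Hposb: "Re (theta_quotient H z) > - b / 2" if "norm z < 1" for z
    using Hpos[OF that] ab by simp
  obtain Kb where Kb: "prestarlike_kernel Kb b" "\<And>z. norm z < 1 \<Longrightarrow> convolution Kb ?B z = G z"
    by (rule prestarlike_kernel_exists[OF G(1) _ ab(3) G(2,3)]) (use ab in auto)
  obtain Ka where Ka: "prestarlike_kernel Ka a" "\<And>z. norm z < 1 \<Longrightarrow> convolution Ka ?A z = F z"
    by (rule prestarlike_kernel_exists[OF F(1) ab(1) _ F(2,3)]) (use ab in auto)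
  interpret b: prestarlike_kernel Kb b by (rule Kb(1))
  interpret a: prestarlike_kernel Ka a by (rule Ka(1))
  define f where "f = convolution ?A G"
  have f_eq: "f = convolution Kb H"
  proof -
    have "f = convolution ?A (convolution Kb ?B)"
      unfolding f_def by (rule convolution_cong[OF zero_less_one]) (simp add: Kb(2))
    also have "\<dots> = convolution (convolution Kb ?B) ?A" by (rule convolution_commute)
    also have "\<dots> = convolution Kb (convolution ?B ?A)" by (rule convolution_assoc[OF b.K B A])
    finally show ?thesis by (simp add: H_def convolution_commute[of ?B])
  qed
  have FG: "convolution F G = convolution Ka f"
  proof -
    have "convolution F G = convolution G F" by (rule convolution_commute)
    also have "\<dots> = convolution G (convolution Ka ?A)"
      by (rule convolution_cong[OF zero_less_one]) (simp add: Ka(2))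
    also have "\<dots> = convolution (convolution Ka ?A) G" by (rule convolution_commute)
    also have "\<dots> = convolution Ka f" unfolding f_def by (rule convolution_assoc[OF a.K A G(1)])
    finally show ?thesis .
  qed
  have fh: "f holomorphic_on ball 0 1" unfolding f_def by (rule convolution_holomorphic[OF A G(1) zero_less_one])
  have f0: "f z \<noteq> 0" if "norm z < 1" for z
    unfolding f_eq by (rule b.convolution_starlike_half_plane(1)[OF Hh H0 Hposb norm_one that])
  have fC: "theta_quotient f z \<in> C"
    if "norm z < \<rho>" "\<rho> < 1" "convex C" "closed C" "\<And>u. norm u = \<rho> \<Longrightarrow> theta_quotient H u \<in> C" for z \<rho> C
    unfolding f_eq by (rule b.theta_quotient_convolution_mem[OF Hh H0 Hposb that])
  have fpos: "Re (theta_quotient f z) > - a / 2" if z: "norm z < 1" for z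
  proof (rule theta_quotient_strict[OF fh f0 _ ab(1) z])
    fix z :: complex assume "norm z < 1"
    then obtain \<rho> where \<rho>: "norm z < \<rho>" "\<rho> < 1" using dense by blast
    have mem: "theta_quotient H u \<in> {w. Re w \<ge> - a / 2}" if "norm u = \<rho>" for u
      using less_imp_le[OF Hpos[of u]] that \<rho> by blast
    have "theta_quotient f z \<in> {w. Re w \<ge> - a / 2}"
      by (rule fC[OF \<rho> convex_halfspace_Re_ge closed_halfspace_Re_ge]) ((assumption | rule mem)+)
    thus "Re (theta_quotient f z) \<ge> - a / 2" by simp
  qed
  show "convolution F G z \<noteq> 0"
    unfolding FG by (rule a.convolution_starlike_half_plane(1)[OF fh f0 fpos norm_one z])
  assume *: "norm z < \<rho>" "\<rho> < 1" "convex C" "closed C" "\<And>u. norm u = \<rho> \<Longrightarrow> theta_quotient H u \<in> C"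
  obtain \<rho>' where \<rho>': "norm z < \<rho>'" "\<rho>' < \<rho>" using dense[OF *(1)] by blast
  have \<rho>'1: "\<rho>' < 1" using \<rho>' * by simp
  have mem: "theta_quotient f u \<in> C" if "norm u = \<rho>'" for u
    by (rule fC[OF _ *(2,3,4,5)]) (use that \<rho>' in simp)
  show "theta_quotient (convolution F G) z \<in> C"
    unfolding FG
    by (rule a.theta_quotient_convolution_mem[OF fh f0 fpos \<rho>'(1) \<rho>'1 *(3,4)]) ((assumption | rule mem)+)
qed

section \<open>Numerical estimates near the unit circle\<close>

lemma Re_lower_bound_unit_square:
  fixes w :: complex
  assumes "norm (1 - w\<^sup>2) \<le> 1"
  shows "(norm w)\<^sup>2 / 2 + (norm w) ^ 4 / 4 \<le> (Re w)\<^sup>2"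
proof -
  have "(norm (1 - w\<^sup>2))\<^sup>2 \<le> 1" using assms by (simp add: abs_square_le_1)
  hence 1: "(1 - Re (w\<^sup>2))\<^sup>2 + (Im (w\<^sup>2))\<^sup>2 \<le> 1" by (simp add: cmod_power2)
  have 2: "(Re (w\<^sup>2))\<^sup>2 + (Im (w\<^sup>2))\<^sup>2 = (norm w) ^ 4"
    by (metis cmod_power2 norm_power power_mult[of "norm w" 2 2] mult_2_right numeral_Bit0)
  have 3: "Re (w\<^sup>2) = 2 * (Re w)\<^sup>2 - (norm w)\<^sup>2"
    by (simp add: cmod_power2 Re_power2)
  have "(norm w) ^ 4 \<le> 2 * Re (w\<^sup>2)" using 1 2 by (simp add: power2_eq_square algebra_simps)
  thus ?thesis unfolding 3 by simp
qed

lemma norm_one_minus_sq: "(norm (1 - w :: complex))\<^sup>2 = 1 - 2 * Re w + (norm w)\<^sup>2"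
  by (simp add: cmod_power2) (simp add: power2_eq_square algebra_simps)

text \<open>Here $R$ stands for $|t_0| = |1-z|^\sigma$, and $B$ bounds $|1-t|^2$.\<close>
lemma near_polynomial_bound:
  fixes R :: real
  assumes "0 \<le> R" "R \<le> 1"
  defines "B \<equiv> 1 - (104/100) * R + (56/100) * R\<^sup>2"
  shows "(1155/1000) * (B * R) + (288/1000) * B\<^sup>2 < ((32/100) + (575/1000) * R) * (1 - (289/1000) * (B * R))"
proof -
  have e: "((32/100) + (575/1000) * R) * (1 - (289/1000) * (B * R)) - (1155/1000) * (B * R) - (288/1000) * B\<^sup>2 =
    (32/1000) - (7344/100000) * R + (4971434/10000000) * R\<^sup>2 - (1903044/10000000) * R ^ 3 - (1833748/10000000) * R ^ 4"
    unfolding B_def by (simp add: power2_eq_square power3_eq_cube power4_eq_xxxx field_simps)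
  have "R ^ 3 \<le> R\<^sup>2" "R ^ 4 \<le> R\<^sup>2" using assms by (auto intro: power_decreasing)
  moreover have "0 < (32/1000) - (7344/100000) * R + (1234/10000) * R\<^sup>2"
  proof -
    have "(R - (2976/10000))\<^sup>2 = R\<^sup>2 - (5952/10000) * R + (8856576/100000000)" by (simp add: power2_eq_square field_simps)
    thus ?thesis using zero_le_power2[of "R - (2976/10000)"] assms(1,2) by linarith
  qed
  ultimately show ?thesis using e zero_le_power2[of R] by linarith
qed

lemma quotient_bound:
  fixes X Y :: real
  assumes "X \<le> X'" "Y \<le> Y'" "0 \<le> Y" "Y' < L * (1 - X')" "X' < 1"
  shows "Y / (1 - X) < L"
proof -
  have L: "0 < L" using assms by (intro zero_less_mult_pos2[of L "1 - X'"]) linarith+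
  have "Y < L * (1 - X')" using assms by linarith
  also have "L * (1 - X') \<le> L * (1 - X)" using assms L by (intro mult_left_mono) auto
  finally show ?thesis using assms by (simp add: pos_divide_less_eq mult.commute)
qed

lemma ratio_bounds:
  fixes \<sigma> r :: real
  assumes \<sigma>: "0 < \<sigma>" "\<sigma> \<le> 1/2" and r: "r \<le> (1 - \<sigma>\<^sup>2) / 4"
  shows "4 * r \<le> 1 - \<sigma>\<^sup>2" "r \<le> 1/4" "\<sigma> * r \<le> 3/32"
proof -
  show r4: "4 * r \<le> 1 - \<sigma>\<^sup>2" using r by (simp add: field_simps)
  thus "r \<le> 1/4" using zero_le_power2[of \<sigma>] by linarith
  have "\<sigma> * (4 * r) \<le> \<sigma> * (1 - \<sigma>\<^sup>2)" using \<sigma> r4 by (intro mult_left_mono) auto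
  also have "\<dots> \<le> 3/8"
  proof -
    have "(1/2 - \<sigma>) * (3/4 - \<sigma>/2 - \<sigma>\<^sup>2) = 3/8 - \<sigma> * (1 - \<sigma>\<^sup>2)"
      by (simp add: power2_eq_square field_simps)
    moreover have "0 \<le> (1/2 - \<sigma>) * (3/4 - \<sigma>/2 - \<sigma>\<^sup>2)"
    proof (intro mult_nonneg_nonneg)
      have "\<sigma>\<^sup>2 \<le> (1/2)\<^sup>2" using \<sigma> by (intro power_mono) auto
      thus "0 \<le> 3/4 - \<sigma>/2 - \<sigma>\<^sup>2" using \<sigma> by (simp add: power2_eq_square)
    qed (use \<sigma> in simp)
    ultimately show ?thesis by linarith
  qed
  finally show "\<sigma> * r \<le> 3/32" by simp
qed

context
  fixes z t0 \<tau> :: complex and \<sigma> r :: real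
  assumes \<sigma>: "0 < \<sigma>" "\<sigma> \<le> 1/2" and r: "0 < r" "r \<le> (1 - \<sigma>\<^sup>2) / 4"
    and z: "(99/100) \<le> norm z" and t0: "norm (1 - t0\<^sup>2) \<le> 1" "0 < Re t0"
begin

private lemmas r4 = ratio_bounds(1)[OF \<sigma> r(2)]
  and r_le = ratio_bounds(2)[OF \<sigma> r(2)]
  and \<sigma>r_le = ratio_bounds(3)[OF \<sigma> r(2)]

private lemma r_quotient_le: "r / (1 - 4 * \<sigma> * r / 3)\<^sup>2 \<le> (285/1000)"
proof -
  have "4 * r * (1 + (76/100) * \<sigma>) \<le> (1 - \<sigma>\<^sup>2) * (1 + (76/100) * \<sigma>)" using \<sigma> r4 by (intro mult_right_mono) auto
  also have "\<dots> \<le> (114/100)"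
  proof -
    have "0 \<le> (\<sigma> - (283/1000))\<^sup>2 * ((76/100) * \<sigma> + (143/100))" using \<sigma> by (intro mult_nonneg_nonneg) auto
    moreover have "(\<sigma> - (283/1000))\<^sup>2 * ((76/100) * \<sigma> + (143/100)) =
        (76/100) * \<sigma> ^ 3 + (99984/100000) * \<sigma>\<^sup>2 - (74851236/100000000) * \<sigma> + (11452727/100000000)"
      by (simp add: power2_eq_square power3_eq_cube field_simps)
    moreover have "(1 - \<sigma>\<^sup>2) * (1 + (76/100) * \<sigma>) = 1 + (76/100) * \<sigma> - \<sigma>\<^sup>2 - (76/100) * \<sigma> ^ 3"
      by (simp add: power2_eq_square power3_eq_cube field_simps)
    ultimately show ?thesis using \<sigma> zero_le_power2[of \<sigma>] by linarith
  qed
  finally have "r \<le> (285/1000) * (1 - 8/3 * (\<sigma> * r))" by (simp add: field_simps)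
  also have "1 - 8/3 * (\<sigma> * r) \<le> (1 - 4 * \<sigma> * r / 3)\<^sup>2"
  proof -
    have "(1 - 4 * \<sigma> * r / 3)\<^sup>2 = 1 - 8/3 * (\<sigma> * r) + (4 * \<sigma> * r / 3)\<^sup>2"
      by (simp add: power2_eq_square field_simps)
    thus ?thesis using zero_le_power2[of "4 * \<sigma> * r / 3"] by linarith
  qed
  finally have "r \<le> (285/1000) * (1 - 4 * \<sigma> * r / 3)\<^sup>2" by simp
  moreover have "(1 - 4 * \<sigma> * r / 3)\<^sup>2 > 0" using \<sigma>r_le by simp
  ultimately show ?thesis by (simp add: pos_divide_le_eq)
qed

lemma near_bound:
  assumes d: "norm (1 - z) \<le> (norm t0)\<^sup>2" "norm t0 \<le> 1" and \<tau>: "norm (\<tau> - 1) \<le> 4 * \<sigma> * r / 3"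
  defines "t \<equiv> t0 * \<tau>"
  defines "n2 \<equiv> (norm (1 - t))\<^sup>2" and "D1 \<equiv> norm (1 - z) / (norm t * norm z)"
    and "D2 \<equiv> norm (1 - z) / ((norm t)\<^sup>2 * norm z)"
  shows "r * n2 * D1 < 1" "(n2 * D1 + r * n2\<^sup>2 * D2) / (1 - r * n2 * D1) < (32/100) + Re t"
proof -
  define R where "R = norm t0"
  have R: "0 < R" "R \<le> 1" using t0 d by (auto simp: R_def)
  define \<delta> where "\<delta> = 4 * \<sigma> * r / 3"
  have \<delta>: "0 \<le> \<delta>" "\<delta> \<le> 1/8" using \<sigma> r \<sigma>r_le by (auto simp: \<delta>_def)
  have Ret0: "Re t0 \<ge> R * ((7/10) + (16/100) * R\<^sup>2)"
  proof (rule power2_le_imp_le)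
    have "((7/10) + (16/100) * R\<^sup>2)\<^sup>2 \<le> 1/2 + R\<^sup>2 / 4"
    proof -
      have "R\<^sup>2 * R\<^sup>2 \<le> R\<^sup>2 * 1" using R by (intro mult_left_mono) (auto simp: abs_square_le_1)
      moreover have "((7/10) + (16/100) * R\<^sup>2)\<^sup>2 = (49/100) + (224/1000) * R\<^sup>2 + (256/10000) * (R\<^sup>2 * R\<^sup>2)"
        by (simp add: power2_eq_square field_simps)
      ultimately show ?thesis using zero_le_power2[of R] by linarith
    qed
    hence "R\<^sup>2 * ((7/10) + (16/100) * R\<^sup>2)\<^sup>2 \<le> R\<^sup>2 * (1/2 + R\<^sup>2 / 4)" by (intro mult_left_mono) auto
    also have "\<dots> = R\<^sup>2 / 2 + R ^ 4 / 4" by (simp add: algebra_simps power4_eq_xxxx power2_eq_square)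
    also have "\<dots> \<le> (Re t0)\<^sup>2" using Re_lower_bound_unit_square[OF t0(1)] by (simp add: R_def)
    finally show "(R * ((7/10) + (16/100) * R\<^sup>2))\<^sup>2 \<le> (Re t0)\<^sup>2" by (simp add: power_mult_distrib)
  qed (use t0 in simp)
  have tt0: "norm (t - t0) \<le> R * \<delta>"
  proof -
    have "t - t0 = t0 * (\<tau> - 1)" by (simp add: t_def algebra_simps)
    hence "norm (t - t0) = R * norm (\<tau> - 1)" by (simp only: norm_mult R_def)
    also have "\<dots> \<le> R * \<delta>" unfolding \<delta>_def using R by (intro mult_left_mono \<tau>) auto
    finally show ?thesis .
  qed
  have tt0': "norm (t - t0) \<le> R / 8"
  proof -
    have "R * \<delta> \<le> R * (1/8)" using \<delta> R by (intro mult_left_mono) auto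
    with tt0 show ?thesis by simp
  qed
  have Ret: "Re t \<ge> (575/1000) * R"
  proof -
    have "Re t0 - Re t \<le> R / 8" using abs_Re_le_cmod[of "t - t0"] tt0' by simp
    moreover have "0 \<le> R * R\<^sup>2" using R by simp
    moreover have "R * ((7/10) + (16/100) * R\<^sup>2) = (7/10) * R + (16/100) * (R * R\<^sup>2)" by (simp add: algebra_simps)
    ultimately show ?thesis using Ret0 by linarith
  qed
  have nt: "norm t \<ge> R * (1 - \<delta>)"
    using norm_triangle_ineq2[of t0 "t0 - t"] tt0 by (simp add: R_def norm_minus_commute algebra_simps)
  have nt': "norm t \<ge> 7/8 * R"
  proof -
    have "R * (7/8) \<le> R * (1 - \<delta>)" using \<delta> R by (intro mult_left_mono) auto
    with nt show ?thesis by simp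
  qed
  define B where "B = 1 - (104/100) * R + (56/100) * R\<^sup>2"
  have n2: "n2 \<le> B"
  proof -
    define m where "m = norm (1 - t0)"
    have m2: "m\<^sup>2 \<le> 1 - (14/10) * R + R\<^sup>2 - (32/100) * R ^ 3"
    proof -
      have "2 * (R * ((7/10) + (16/100) * R\<^sup>2)) = (14/10) * R + (32/100) * R ^ 3"
        by (simp add: power2_eq_square power3_eq_cube field_simps)
      thus ?thesis using Ret0 unfolding m_def norm_one_minus_sq R_def[symmetric] by linarith
    qed
    have "norm (1 - t) \<le> m + R / 8"
      using norm_triangle_ineq[of "1 - t0" "t0 - t"] tt0' by (simp add: m_def norm_minus_commute)
    hence "n2 \<le> (m + R / 8)\<^sup>2" unfolding n2_def by (intro power_mono) auto
    also have "\<dots> = m\<^sup>2 + R / 4 * m + R\<^sup>2 / 64" by (simp add: power2_eq_square algebra_simps)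
    also have "R / 4 * m \<le> R / 4 * ((1 + m\<^sup>2) / 2)"
    proof (rule mult_left_mono)
      have "0 \<le> (m - 1)\<^sup>2" by simp
      thus "m \<le> (1 + m\<^sup>2) / 2" by (simp add: power2_eq_square algebra_simps)
    qed (use R in simp)
    also have "m\<^sup>2 + R / 4 * ((1 + m\<^sup>2) / 2) + R\<^sup>2 / 64 = m\<^sup>2 * (1 + R / 8) + R / 8 + R\<^sup>2 / 64"
      by (simp add: algebra_simps)
    also have "m\<^sup>2 * (1 + R / 8) \<le> (1 - (14/10) * R + R\<^sup>2 - (32/100) * R ^ 3) * (1 + R / 8)"
      using R by (intro mult_right_mono m2) auto
    also have "\<dots> + R / 8 + R\<^sup>2 / 64 \<le> B"
    proof -
      have "(R - (72/100))\<^sup>2 = R\<^sup>2 - (144/100) * R + (5184/10000)" by (simp add: power2_eq_square field_simps)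
      hence "0 \<le> (11/100) - (280625/1000000) * R + (195/1000) * R\<^sup>2"
        using zero_le_power2[of "R - (72/100)"] R by linarith
      hence "0 \<le> R * ((11/100) - (280625/1000000) * R + (195/1000) * R\<^sup>2)" using R by (intro mult_nonneg_nonneg) auto
      moreover have "0 \<le> R ^ 4" by simp
      moreover have "B - ((1 - (14/10) * R + R\<^sup>2 - (32/100) * R ^ 3) * (1 + R / 8) + R / 8 + R\<^sup>2 / 64) =
          R * ((11/100) - (280625/1000000) * R + (195/1000) * R\<^sup>2) + (4/100) * R ^ 4"
        unfolding B_def by (simp add: power2_eq_square power3_eq_cube power4_eq_xxxx field_simps)
      ultimately show ?thesis by linarith
    qed
    finally show ?thesis by simp
  qed
  have n20: "0 \<le> n2" by (simp add: n2_def)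
  have B1: "0 \<le> B" "B \<le> 1"
  proof -
    show "0 \<le> B" using n20 n2 by linarith
    have "R * R \<le> R * 1" using R by (intro mult_left_mono) auto
    thus "B \<le> 1" using R by (simp add: B_def power2_eq_square)
  qed
  have tz: "0 < norm t" "0 < norm z" using nt' R z by linarith+
  have D1: "0 \<le> D1" "D1 \<le> (1155/1000) * R"
  proof -
    have "7/8 * R * (99/100) \<le> norm t * norm z" using nt' z R by (intro mult_mono) auto
    hence "(1155/1000) * R * (7/8 * R * (99/100)) \<le> (1155/1000) * R * (norm t * norm z)" using R by (intro mult_left_mono) auto
    moreover have "R\<^sup>2 \<le> (1155/1000) * R * (7/8 * R * (99/100))" using R by (simp add: power2_eq_square)
    ultimately have "norm (1 - z) \<le> (1155/1000) * R * (norm t * norm z)"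
      using d(1) unfolding R_def[symmetric] by linarith
    thus "D1 \<le> (1155/1000) * R" using tz by (simp add: D1_def pos_divide_le_eq)
  qed (simp add: D1_def)
  have rD2: "0 \<le> r * D2" "r * D2 \<le> (288/1000)"
  proof -
    have "(R * (1 - \<delta>))\<^sup>2 * (99/100) \<le> (norm t)\<^sup>2 * norm z"
      using nt z R \<delta> by (intro mult_mono power_mono) auto
    hence *: "R\<^sup>2 * ((1 - \<delta>)\<^sup>2 * (99/100)) \<le> (norm t)\<^sup>2 * norm z"
      by (simp only: power_mult_distrib mult.assoc)
    have "(1 - \<delta>)\<^sup>2 > 0" using \<delta> by simp
    hence "r \<le> (285/1000) * (1 - \<delta>)\<^sup>2" using r_quotient_le by (simp add: \<delta>_def pos_divide_le_eq)
    hence "r * norm (1 - z) \<le> (285/1000) * (1 - \<delta>)\<^sup>2 * R\<^sup>2"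
      using d r by (intro mult_mono) (auto simp: R_def)
    also have "\<dots> \<le> (288/1000) * (R\<^sup>2 * ((1 - \<delta>)\<^sup>2 * (99/100)))" by (simp add: mult_nonneg_nonneg)
    also have "\<dots> \<le> (288/1000) * ((norm t)\<^sup>2 * norm z)" by (rule mult_left_mono[OF *]) simp
    finally show "r * D2 \<le> (288/1000)" using tz by (simp add: D2_def pos_divide_le_eq)
  qed (use r in \<open>simp add: D2_def\<close>)
  have nD: "n2 * D1 \<le> (1155/1000) * (B * R)"
    using mult_mono[OF n2 D1(2) B1(1) D1(1)] by (simp add: algebra_simps)
  have X: "r * n2 * D1 \<le> (289/1000) * (B * R)"
  proof -
    have "r * (n2 * D1) \<le> 1/4 * ((1155/1000) * (B * R))"
      using mult_mono[OF r_le nD] n20 D1 by simp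
    moreover have "0 \<le> B * R" using B1 R by simp
    ultimately show ?thesis by (simp add: mult.assoc)
  qed
  have BR: "B * R \<le> 1" using B1 R by (intro mult_le_one) auto
  show "r * n2 * D1 < 1" using X BR by linarith
  have Y: "n2 * D1 + r * n2\<^sup>2 * D2 \<le> (1155/1000) * (B * R) + (288/1000) * B\<^sup>2"
  proof -
    have "n2\<^sup>2 * (r * D2) \<le> B\<^sup>2 * (288/1000)"
      using n2 n20 rD2 by (intro mult_mono power_mono) auto
    thus ?thesis using nD by (simp add: mult_ac)
  qed
  have "(n2 * D1 + r * n2\<^sup>2 * D2) / (1 - r * n2 * D1) < (32/100) + (575/1000) * R"
  proof (rule quotient_bound[OF X Y])
    show "0 \<le> n2 * D1 + r * n2\<^sup>2 * D2"
      using n20 D1 rD2 mult_nonneg_nonneg[OF zero_le_power2[of n2] rD2(1)] by (simp add: mult_ac)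
    show "(1155/1000) * (B * R) + (288/1000) * B\<^sup>2 < ((32/100) + (575/1000) * R) * (1 - (289/1000) * (B * R))"
      unfolding B_def using R by (intro near_polynomial_bound) auto
  qed (use BR in linarith)
  thus "(n2 * D1 + r * n2\<^sup>2 * D2) / (1 - r * n2 * D1) < (32/100) + Re t" using Ret by linarith
qed

lemma far_bound:
  assumes d: "1 \<le> norm t0" "(norm t0)\<^sup>2 \<le> 2" "norm (1 - z) \<le> 2" and \<tau>: "norm (\<tau> - 1) \<le> (55/1000)"
  defines "t \<equiv> t0 * \<tau>"
  defines "n2 \<equiv> (norm (1 - t))\<^sup>2" and "D1 \<equiv> norm (1 - z) / (norm t * norm z)"
    and "D2 \<equiv> norm (1 - z) / ((norm t)\<^sup>2 * norm z)"
  shows "r * n2 * D1 < 1" "(n2 * D1 + r * n2\<^sup>2 * D2) / (1 - r * n2 * D1) < (32/100) + Re t"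
proof -
  define R where "R = norm t0"
  have R: "1 \<le> R" "R\<^sup>2 \<le> 2" using d by (auto simp: R_def)
  have R': "R \<le> (14143/10000)"
    by (rule power2_le_imp_le) (use R in \<open>auto simp: power2_eq_square\<close>)
  have R2: "1 \<le> R\<^sup>2" using R by (simp add: one_le_power)
  have sq: "R\<^sup>2 / 2 + R\<^sup>2 * R\<^sup>2 / 4 \<le> (Re t0)\<^sup>2"
    using Re_lower_bound_unit_square[OF t0(1)] by (simp add: R_def power2_eq_square power4_eq_xxxx mult.assoc)
  have Ret0: "Re t0 \<ge> (366/1000) + R\<^sup>2 / 2"
  proof (rule power2_le_imp_le)
    have "((366/1000) + R\<^sup>2 / 2)\<^sup>2 = ((535824/1000000) + (1464/1000) * R\<^sup>2 + R\<^sup>2 * R\<^sup>2) / 4"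
      by (simp add: power2_eq_square field_simps)
    also have "\<dots> \<le> R\<^sup>2 / 2 + R\<^sup>2 * R\<^sup>2 / 4" using R2 by (simp add: field_simps)
    finally show "((366/1000) + R\<^sup>2 / 2)\<^sup>2 \<le> (Re t0)\<^sup>2" using sq by linarith
  qed (use t0 in simp)
  have tt0: "norm (t - t0) \<le> (55/1000) * R"
  proof -
    have "t - t0 = t0 * (\<tau> - 1)" by (simp add: t_def algebra_simps)
    hence "norm (t - t0) = R * norm (\<tau> - 1)" by (simp only: norm_mult R_def)
    thus ?thesis using R mult_left_mono[OF \<tau>, of R] by simp
  qed
  have tt0': "norm (t - t0) \<le> (778/10000)" using tt0 R' by linarith
  have Ret: "Re t \<ge> (788/1000)"
  proof -
    have "Re t0 - Re t \<le> (778/10000)" using abs_Re_le_cmod[of "t - t0"] tt0' by simp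
    thus ?thesis using Ret0 R2 by linarith
  qed
  have nt: "norm t \<ge> (945/1000)"
    using norm_triangle_ineq2[of t0 "t0 - t"] tt0 R by (simp add: R_def norm_minus_commute)
  have n1: "norm (1 - t) \<le> (5956/10000)"
  proof -
    have "(norm (1 - t0))\<^sup>2 \<le> (268/1000)" using Ret0 by (simp add: norm_one_minus_sq R_def)
    hence "(norm (1 - t0))\<^sup>2 \<le> (5178/10000)\<^sup>2" by (simp add: power2_eq_square)
    hence "norm (1 - t0) \<le> (5178/10000)" by (rule power2_le_imp_le) simp
    thus ?thesis using norm_triangle_ineq[of "1 - t0" "t0 - t"] tt0' by (simp add: norm_minus_commute)
  qed
  have n2: "0 \<le> n2" "n2 \<le> (355/1000)"
  proof -
    have "n2 \<le> (5956/10000)\<^sup>2" unfolding n2_def by (intro power_mono n1) auto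
    thus "n2 \<le> (355/1000)" by (simp add: power2_eq_square)
  qed (simp add: n2_def)
  have tz: "0 < norm t" "0 < norm z" using nt z by linarith+
  have D1: "0 \<le> D1" "D1 \<le> (2138/1000)"
  proof -
    have "(945/1000) * (99/100) \<le> norm t * norm z" using nt z by (intro mult_mono) auto
    hence "norm (1 - z) \<le> (2138/1000) * (norm t * norm z)" using d(3) by linarith
    thus "D1 \<le> (2138/1000)" using tz by (simp add: D1_def pos_divide_le_eq)
  qed (simp add: D1_def)
  have D2: "0 \<le> D2" "D2 \<le> (2263/1000)"
  proof -
    have "(945/1000)\<^sup>2 * (99/100) \<le> (norm t)\<^sup>2 * norm z" using nt z by (intro mult_mono power_mono) auto
    hence "norm (1 - z) \<le> (2263/1000) * ((norm t)\<^sup>2 * norm z)" using d(3) by (simp add: power2_eq_square)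
    thus "D2 \<le> (2263/1000)" using tz by (simp add: D2_def pos_divide_le_eq)
  qed (simp add: D2_def)
  have nD: "n2 * D1 \<le> (759/1000)"
    using mult_mono[OF n2(2) D1(2)] D1 by simp
  have X: "r * n2 * D1 \<le> (19/100)"
  proof -
    have "r * (n2 * D1) \<le> 1/4 * (759/1000)" using nD r r_le n2 D1 by (intro mult_mono) auto
    thus ?thesis by (simp add: mult.assoc)
  qed
  thus "r * n2 * D1 < 1" by simp
  have Y: "n2 * D1 + r * n2\<^sup>2 * D2 \<le> (831/1000)"
  proof -
    have "n2\<^sup>2 * D2 \<le> (355/1000)\<^sup>2 * (2263/1000)" using n2 D2 by (intro mult_mono power_mono) auto
    hence "r * (n2\<^sup>2 * D2) \<le> 1/4 * ((355/1000)\<^sup>2 * (2263/1000))" using r r_le n2 D2 by (intro mult_mono) auto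
    thus ?thesis using nD by (simp add: mult.assoc power2_eq_square)
  qed
  have "(n2 * D1 + r * n2\<^sup>2 * D2) / (1 - r * n2 * D1) < (11/10)"
    by (rule quotient_bound[OF X Y]) (use n2 D1 D2 r in auto)
  thus "(n2 * D1 + r * n2\<^sup>2 * D2) / (1 - r * n2 * D1) < (32/100) + Re t" using Ret by linarith
qed

end

text \<open>
  Main terms and error of $1 + zq''/q'$: with $V = r(1-t)^2/t$ one has
  $h/(1-x) = h + V + x(1+V)/(1-x)$, where $h = 1/(1-z)$. The constant $32/100$ in the error is
  admissible because $r(182/100 - \sigma) \le (1-\sigma)/2$.
\<close>
lemma Re_positive_of_error_bound:
  fixes z t :: complex and \<sigma> r :: real
  assumes \<sigma>: "0 < \<sigma>" "\<sigma> \<le> 1/2" and r: "0 < r" "r \<le> (1 - \<sigma>\<^sup>2) / 4"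
    and z: "norm z < 1" "z \<noteq> 0" and \<zeta>: "Re (z / (1 - z)) > -1/2" and t: "t \<noteq> 0" "norm (1 - t) < 1"
  defines "n2 \<equiv> (norm (1 - t))\<^sup>2" and "D1 \<equiv> norm (1 - z) / (norm t * norm z)"
    and "D2 \<equiv> norm (1 - z) / ((norm t)\<^sup>2 * norm z)"
  assumes X: "r * n2 * D1 < 1" and Y: "(n2 * D1 + r * n2\<^sup>2 * D2) / (1 - r * n2 * D1) < (32/100) + Re t"
  defines "x \<equiv> of_real r * (1 - t)\<^sup>2 * (1 - z) / (z * t)"
  shows "norm x < 1"
    "Re (of_real \<sigma> * (z / (1 - z)) - 2 * (of_real (r * \<sigma>) * (1 - t) / t) + 1 / (1 - z) / (1 - x)) > 0"
proof -
  have z1: "1 - z \<noteq> 0" using z by auto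
  have nx: "norm x = r * n2 * D1" using r by (simp add: x_def n2_def D1_def norm_mult norm_divide norm_power)
  show x1: "norm x < 1" unfolding nx by (rule X)
  define V where "V = of_real r * (1 - t)\<^sup>2 / t"
  define E where "E = x * (1 + V) / (1 - x)"
  have x10: "1 - x \<noteq> 0" using x1 by auto
  have hx: "1 / (1 - z) * x = V + x"
    using z z1 t by (simp add: x_def V_def field_simps)
  have split: "1 / (1 - z) / (1 - x) = 1 / (1 - z) + V + E"
  proof -
    have "g = g * (1 - x) + g * x" for g :: complex by (simp add: algebra_simps)
    from this[of "1 / (1 - z)"] have "1 / (1 - z) = 1 / (1 - z) * (1 - x) + (V + x)" unfolding hx .
    moreover have "g * (1 - x) + (V + x) = (g + V) * (1 - x) + x * (1 + V)" for g by (simp add: algebra_simps)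
    ultimately have "1 / (1 - z) = (1 / (1 - z) + V) * (1 - x) + x * (1 + V)" by (rule trans)
    hence "1 / (1 - z) / (1 - x) = ((1 / (1 - z) + V) * (1 - x) + x * (1 + V)) / (1 - x)" by simp
    thus ?thesis using x10 by (simp add: E_def add_divide_distrib)
  qed
  have main: "V - 2 * (of_real (r * \<sigma>) * (1 - t) / t) =
      of_real r * (of_real (1 - 2 * \<sigma>) * (1 / t) - of_real (2 * (1 - \<sigma>)) + t)"
    using t by (simp add: V_def field_simps power2_eq_square)
  have h: "1 / (1 - z) = 1 + z / (1 - z)" using z1 by (simp add: field_simps)
  have lin: "Re (of_real k * w) = k * Re w" for k w by simp
  have "Re (of_real \<sigma> * (z / (1 - z)) - 2 * (of_real (r * \<sigma>) * (1 - t) / t) + 1 / (1 - z) / (1 - x)) =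
     Re (of_real (1 + \<sigma>) * (z / (1 - z)) + 1 + (V - 2 * (of_real (r * \<sigma>) * (1 - t) / t)) + E)"
  proof -
    have "of_real \<sigma> * Z - 2 * Y + (1 + Z + V + E) = of_real (1 + \<sigma>) * Z + 1 + (V - 2 * Y) + E" for Z Y :: complex
      by (simp add: algebra_simps)
    thus ?thesis unfolding split unfolding h by (simp only:)
  qed
  also have "\<dots> = (1 + \<sigma>) * Re (z / (1 - z)) + 1 + r * ((1 - 2 * \<sigma>) * Re (1 / t) - 2 * (1 - \<sigma>) + Re t) + Re E"
    unfolding main plus_complex.sel lin minus_complex.sel by simp
  finally have ReP: "Re (of_real \<sigma> * (z / (1 - z)) - 2 * (of_real (r * \<sigma>) * (1 - t) / t) + 1 / (1 - z) / (1 - x)) =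
     (1 + \<sigma>) * Re (z / (1 - z)) + 1 + r * ((1 - 2 * \<sigma>) * Re (1 / t) - 2 * (1 - \<sigma>) + Re t) + Re E" .
  have p1: "(1 + \<sigma>) * Re (z / (1 - z)) > (1 + \<sigma>) * (-1/2)" using \<zeta> \<sigma> by (intro mult_strict_left_mono) auto
  have ReT: "Re (1 / t) \<ge> 1/2"
  proof -
    have "(norm (1 - t))\<^sup>2 < 1" using t by (simp add: abs_square_less_1)
    hence "(norm t)\<^sup>2 < 2 * Re t" unfolding norm_one_minus_sq by simp
    moreover have "Re (1 / t) = Re t / (norm t)\<^sup>2" by (simp add: Re_divide cmod_power2)
    moreover have "(norm t)\<^sup>2 > 0" using t by simp
    ultimately show ?thesis by (simp add: pos_le_divide_eq)
  qed
  have E: "norm E \<le> r * ((32/100) + Re t)"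
  proof -
    have "norm E = norm x * norm (1 + V) / norm (1 - x)" by (simp add: E_def norm_mult norm_divide)
    also have "\<dots> \<le> norm x * (1 + norm V) / (1 - norm x)"
      using x1 norm_triangle_ineq[of 1 V] norm_triangle_ineq2[of 1 x]
      by (intro frac_le mult_left_mono) auto
    also have "norm x * (1 + norm V) = r * (n2 * D1 + r * n2\<^sup>2 * D2)"
    proof -
      have "norm V = r * n2 / norm t" using r by (simp add: V_def n2_def norm_mult norm_divide norm_power)
      moreover have "D2 = D1 / norm t" by (simp add: D1_def D2_def power2_eq_square)
      ultimately show ?thesis unfolding nx by (simp add: algebra_simps power2_eq_square)
    qed
    also have "r * (n2 * D1 + r * n2\<^sup>2 * D2) / (1 - norm x) = r * ((n2 * D1 + r * n2\<^sup>2 * D2) / (1 - r * n2 * D1))"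
      by (simp add: nx)
    also have "\<dots> \<le> r * ((32/100) + Re t)" using Y r by (intro mult_left_mono) auto
    finally show ?thesis .
  qed
  have "- (r * ((32/100) + Re t)) \<le> Re E" using E abs_Re_le_cmod[of E] by linarith
  moreover have "r * ((1 - 2 * \<sigma>) * (1/2) - 2 * (1 - \<sigma>) + Re t) \<le> r * ((1 - 2 * \<sigma>) * Re (1 / t) - 2 * (1 - \<sigma>) + Re t)"
    using ReT \<sigma> r by (intro mult_left_mono add_right_mono diff_right_mono) auto
  moreover have "r * ((182/100) - \<sigma>) \<le> (1 - \<sigma>) / 2"
  proof -
    have "4 * r * ((182/100) - \<sigma>) \<le> (1 - \<sigma>\<^sup>2) * ((182/100) - \<sigma>)"
      using \<sigma> ratio_bounds(1)[OF \<sigma> r(2)] by (intro mult_right_mono) auto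
    also have "\<dots> = (1 - \<sigma>) * ((1 + \<sigma>) * ((182/100) - \<sigma>))" by (simp add: power2_eq_square algebra_simps)
    also have "\<dots> \<le> (1 - \<sigma>) * 2"
    proof (rule mult_left_mono)
      have "2 - (1 + \<sigma>) * ((182/100) - \<sigma>) = (\<sigma> - (41/100))\<^sup>2 + (119/10000)" by (simp add: power2_eq_square field_simps)
      thus "(1 + \<sigma>) * ((182/100) - \<sigma>) \<le> 2" using zero_le_power2[of "\<sigma> - (41/100)"] by linarith
    qed (use \<sigma> in simp)
    finally show ?thesis by simp
  qed
  ultimately show "Re (of_real \<sigma> * (z / (1 - z)) - 2 * (of_real (r * \<sigma>) * (1 - t) / t) + 1 / (1 - z) / (1 - x)) > 0"
    unfolding ReP using p1 by (simp add: field_simps)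
qed

section \<open>Convexity of the extremal quotient\<close>

locale gauss_quotient =
  fixes a b :: real
  assumes a: "0 < a" "a \<le> b" and sum_le: "a + b \<le> 1/2"
    and prod_le: "4 * (a * b) \<le> (a + b)\<^sup>2 * (1 - (a + b)\<^sup>2)"
begin

definition \<sigma> :: real where "\<sigma> = a + b"
definition r :: real where "r = a * b / \<sigma>\<^sup>2"

definition H :: "complex \<Rightarrow> complex" where
  "H = convolution (\<lambda>u. (1 - u) powr (- of_real a)) (\<lambda>u. (1 - u) powr (- of_real b))"

definition q :: "complex \<Rightarrow> complex" where "q z = z * deriv H z / H z"

text \<open>
  By the Riccati equation $q' = W(1-x)/(1-z)$ and $t' = -\sigma t(1-x)/(1-z)$, with $x$ small near the
  unit circle; hence $t$ is comparable to $(1-z)^\sigma$ there.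
\<close>
definition W :: "complex \<Rightarrow> complex" where "W z = of_real (a * b) + of_real \<sigma> * q z"
definition t :: "complex \<Rightarrow> complex" where "t z = of_real (a * b) / W z"
definition x :: "complex \<Rightarrow> complex" where "x z = z * (1 - z) * (deriv H z / H z)\<^sup>2 / W z"

lemma \<sigma>: "0 < \<sigma>" "\<sigma> \<le> 1/2" and ab_pos: "0 < a * b" and b_le: "0 < b" "b \<le> 1" "a \<le> 1"
  using a sum_le by (auto simp: \<sigma>_def)

lemma r: "0 < r" "r \<le> (1 - \<sigma>\<^sup>2) / 4" "r * \<sigma>\<^sup>2 = a * b"
proof -
  have "\<sigma>\<^sup>2 > 0" using \<sigma> by simp
  thus "0 < r" "r * \<sigma>\<^sup>2 = a * b" using ab_pos by (auto simp: r_def)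
  have "4 * (a * b) \<le> (1 - \<sigma>\<^sup>2) * \<sigma>\<^sup>2" using prod_le by (simp add: \<sigma>_def mult.commute)
  thus "r \<le> (1 - \<sigma>\<^sup>2) / 4" using \<open>\<sigma>\<^sup>2 > 0\<close> by (simp add: r_def pos_divide_le_eq)
qed

lemma H_hol: "H holomorphic_on ball 0 1"
  unfolding H_def by (intro convolution_holomorphic one_minus_powr_holomorphic) auto

lemma H_nz: "norm z < 1 \<Longrightarrow> H z \<noteq> 0"
  unfolding H_def using convolution_binomials_order(1)[of a b z] a b_le by auto

lemma Re_q: "norm z < 1 \<Longrightarrow> Re (q z) > - a / 2"
  unfolding q_def H_def convolution_commute[of "\<lambda>u. (1 - u) powr (- of_real a)"]
  using convolution_binomials_order(2)[of b a z] a b_le by auto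

lemma dH_hol: "deriv H holomorphic_on ball 0 1" by (intro holomorphic_intros H_hol) auto

lemma quot_hol: "(\<lambda>z. deriv H z / H z) holomorphic_on ball 0 1"
  using H_nz by (intro holomorphic_intros dH_hol H_hol) auto

lemma q_hol: "q holomorphic_on ball 0 1"
  unfolding q_def using H_nz by (intro holomorphic_intros dH_hol H_hol) auto

lemma q_0: "q 0 = 0" by (simp add: q_def)

lemma Re_W: assumes "norm z < 1" shows "Re (W z) > 0"
proof -
  have "\<sigma> * (- a / 2) < \<sigma> * Re (q z)" using Re_q[OF assms] \<sigma> by (intro mult_strict_left_mono)
  moreover have "0 \<le> a * b - \<sigma> * (a / 2)"
  proof -
    have "0 \<le> a * (b - a) / 2" using a by simp
    thus ?thesis by (simp add: \<sigma>_def algebra_simps)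
  qed
  moreover have "Re (W z) = a * b + \<sigma> * Re (q z)" by (simp add: W_def)
  ultimately show ?thesis by simp
qed

lemma W_nz: "norm z < 1 \<Longrightarrow> W z \<noteq> 0" using Re_W by force

lemma W_hol: "W holomorphic_on ball 0 1" unfolding W_def by (intro holomorphic_intros q_hol)

lemma t_nz: "norm z < 1 \<Longrightarrow> t z \<noteq> 0" using W_nz a b_le by (simp add: t_def)

lemma t_hol: "t holomorphic_on ball 0 1"
  unfolding t_def using W_nz by (intro holomorphic_intros W_hol) auto

lemma x_hol: "x holomorphic_on ball 0 1"
  unfolding x_def using W_nz by (intro holomorphic_intros W_hol quot_hol) auto

lemma x_eq: assumes "z \<noteq> 0" shows "x z = (1 - z) * (q z)\<^sup>2 / (z * W z)"
proof -
  have "z * (1 - z) * d\<^sup>2 / w = (1 - z) * (z * d)\<^sup>2 / (z * w)" if "z \<noteq> 0" for d w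
    using that by (simp add: power2_eq_square)
  from this[OF assms] have "x z = (1 - z) * (z * (deriv H z / H z))\<^sup>2 / (z * W z)" by (simp only: x_def)
  thus ?thesis by (simp add: q_def)
qed

lemma one_minus_t: "norm z < 1 \<Longrightarrow> 1 - t z = of_real \<sigma> * q z / W z"
  using W_nz[of z] by (simp add: t_def W_def field_simps)

lemma t_0: "t 0 = 1" using a b_le by (simp add: t_def W_def q_0)

lemma q_eq_t: assumes "norm z < 1" shows "q z = of_real (r * \<sigma>) * (1 - t z) / t z"
proof -
  have "complex_of_real (a * b) = of_real r * of_real \<sigma> * of_real \<sigma>"
    using r(3) by (simp add: power2_eq_square flip: of_real_mult)
  moreover have "complex_of_real (a * b) \<noteq> 0" using a b_le by simp
  ultimately show ?thesis
    unfolding one_minus_t[OF assms] using W_nz[OF assms] by (simp add: t_def field_simps)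
qed

lemma x_eq_t:
  assumes z: "norm z < 1" "z \<noteq> 0"
  shows "x z = of_real r * (1 - t z)\<^sup>2 * (1 - z) / (z * t z)"
proof -
  have k: "complex_of_real (a * b) = of_real r * (of_real \<sigma>)\<^sup>2"
    using r(3) by (simp flip: of_real_mult of_real_power)
  have k0: "complex_of_real r * (of_real \<sigma>)\<^sup>2 \<noteq> 0" using r(1) \<sigma> by simp
  have "of_real r * (1 - t z)\<^sup>2 * (1 - z) / (z * t z) =
      of_real r * (of_real \<sigma>)\<^sup>2 * ((q z)\<^sup>2 * (1 - z)) / (z * W z * (of_real r * (of_real \<sigma>)\<^sup>2))"
  proof -
    have gen: "R * (S * y / w)\<^sup>2 * (1 - z) / (z * (R * S\<^sup>2 / w)) = R * S\<^sup>2 * (y\<^sup>2 * (1 - z)) / (z * w * (R * S\<^sup>2))"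
      if "w \<noteq> 0" "R \<noteq> 0" "S \<noteq> 0" for R S y w :: complex
      using that z by (simp add: field_simps power2_eq_square)
    show ?thesis unfolding one_minus_t[OF z(1)] unfolding t_def k
      by (rule gen) (use W_nz[OF z(1)] r \<sigma> in auto)
  qed
  also have "\<dots> = x z" unfolding x_eq[OF z(2)] using k0 by (simp add: mult.commute)
  finally show ?thesis ..
qed

lemma taylor_coeff_H: "taylor_coeff H n = binom_coeff a n * binom_coeff b n"
  unfolding H_def
  by (simp add: taylor_coeff_convolution[OF one_minus_powr_holomorphic one_minus_powr_holomorphic zero_less_one]
      taylor_coeff_one_minus_powr)

lemma H_ode:
  assumes z: "norm z < 1"
  defines "D \<equiv> \<lambda>z. z * deriv H z"
  shows "(1 - z) * (z * deriv D z) = z * (of_real \<sigma> * D z + of_real (a * b) * H z)"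
proof -
  have Dh: "D holomorphic_on ball 0 1" unfolding D_def by (intro holomorphic_intros H_hol) auto
  have D1h: "(\<lambda>z. z * deriv D z) holomorphic_on ball 0 1" by (intro holomorphic_intros Dh) auto
  define h where "h n = taylor_coeff H n" for n
  have s0: "(\<lambda>n. h n * z ^ n) sums H z" unfolding h_def by (rule taylor_coeff_sums[OF H_hol z])
  have s1: "(\<lambda>n. of_nat n * h n * z ^ n) sums D z"
    using taylor_coeff_sums[OF Dh z] taylor_coeff_theta[OF H_hol zero_less_one] by (simp add: h_def D_def)
  have s2: "(\<lambda>n. of_nat n * (of_nat n * h n) * z ^ n) sums (z * deriv D z)"
    using taylor_coeff_sums[OF D1h z] taylor_coeff_theta[OF Dh zero_less_one]
      taylor_coeff_theta[OF H_hol zero_less_one] by (simp add: h_def D_def)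
  have rec: "of_nat (Suc n) * (of_nat (Suc n) * h (Suc n)) =
      of_nat n * (of_nat n * h n) + of_real \<sigma> * (of_nat n * h n) + of_real (a * b) * h n" for n
  proof -
    have "of_nat (Suc n) * (of_nat (Suc n) * h (Suc n)) =
        (of_nat (Suc n) * binom_coeff a (Suc n)) * (of_nat (Suc n) * binom_coeff b (Suc n))"
      by (simp add: h_def taylor_coeff_H mult_ac del: of_nat_Suc)
    also have "\<dots> = (of_real a + of_nat n) * binom_coeff a n * ((of_real b + of_nat n) * binom_coeff b n)"
      unfolding binom_coeff_Suc ..
    finally show ?thesis by (simp add: h_def taylor_coeff_H \<sigma>_def algebra_simps)
  qed
  have "(\<lambda>n. z * (of_nat n * (of_nat n * h n) * z ^ n + of_real \<sigma> * (of_nat n * h n * z ^ n) + of_real (a * b) * (h n * z ^ n)))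
      sums (z * (z * deriv D z + of_real \<sigma> * D z + of_real (a * b) * H z))"
    by (intro sums_mult sums_add s0 s1 s2)
  moreover have "z * (of_nat n * (of_nat n * h n) * z ^ n + of_real \<sigma> * (of_nat n * h n * z ^ n) + of_real (a * b) * (h n * z ^ n)) =
      of_nat (Suc n) * (of_nat (Suc n) * h (Suc n)) * z ^ Suc n" for n
    unfolding rec by (simp add: algebra_simps)
  ultimately have "(\<lambda>n. of_nat (Suc n) * (of_nat (Suc n) * h (Suc n)) * z ^ Suc n)
      sums (z * (z * deriv D z + of_real \<sigma> * D z + of_real (a * b) * H z))" by (simp only:)
  from sums_Suc[OF this] have "(\<lambda>n. of_nat n * (of_nat n * h n) * z ^ n) sums
      (z * (z * deriv D z + of_real \<sigma> * D z + of_real (a * b) * H z))" by simp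
  from sums_unique2[OF s2 this] show ?thesis by (simp add: algebra_simps)
qed

lemma H_deriv: "norm z < 1 \<Longrightarrow> (H has_field_derivative deriv H z) (at z)"
  using H_hol by (intro holomorphic_derivI[of H "ball 0 1"]) auto

lemma q_deriv: "norm z < 1 \<Longrightarrow> (q has_field_derivative deriv q z) (at z)"
  using q_hol by (intro holomorphic_derivI[of q "ball 0 1"]) auto

lemma riccati:
  assumes z: "norm z < 1"
  shows "(1 - z) * (z * deriv q z) = z * W z - (1 - z) * (q z)\<^sup>2"
proof -
  define D where "D = (\<lambda>z. z * deriv H z)"
  have Dd: "(D has_field_derivative deriv D z) (at z)"
    using z by (intro holomorphic_derivI[of D "ball 0 1"]) (auto simp: D_def intro!: holomorphic_intros H_hol)
  have "((\<lambda>z. D z / H z) has_field_derivative ((deriv D z * H z - D z * deriv H z) / (H z * H z))) (at z)"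
    by (rule DERIV_divide[OF Dd H_deriv[OF z] H_nz[OF z]])
  hence "deriv q z = (deriv D z * H z - D z * deriv H z) / (H z * H z)"
    unfolding q_def[abs_def] D_def[symmetric] by (simp add: DERIV_imp_deriv D_def)
  moreover have "(1 - z) * (z * ((d * h - e * h') / (h * h))) = (1 - z) * (z * d) / h - (1 - z) * (e / h) * (z * h' / h)"
    if "h \<noteq> 0" for d e h h' :: complex
    using that by (simp add: field_simps)
  ultimately have "(1 - z) * (z * deriv q z) = (1 - z) * (z * deriv D z) / H z - (1 - z) * (D z / H z) * (z * deriv H z / H z)"
    using H_nz[OF z] by (simp only:)
  hence "(1 - z) * (z * deriv q z) = (1 - z) * (z * deriv D z) / H z - (1 - z) * (q z)\<^sup>2"
    by (simp add: q_def D_def power2_eq_square)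
  also have "(1 - z) * (z * deriv D z) = z * (of_real \<sigma> * D z + of_real (a * b) * H z)"
    unfolding D_def by (rule H_ode[OF z])
  also have "\<dots> / H z = z * W z"
  proof -
    have "z * (s * d + k * h) / h = z * (k + s * (d / h))" if "h \<noteq> 0" for s d k h :: complex
      using that by (simp add: field_simps)
    from this[OF H_nz[OF z]] show ?thesis by (simp only: W_def q_def D_def)
  qed
  finally show ?thesis .
qed

lemma deriv_q:
  assumes z: "norm z < 1"
  shows "deriv q z = W z * (1 - x z) / (1 - z)"
proof (cases "z = 0")
  case True
  have "((\<lambda>z. deriv H z / H z) has_field_derivative deriv (\<lambda>z. deriv H z / H z) 0) (at 0)"
    using quot_hol by (intro holomorphic_derivI[of _ "ball 0 1"]) auto
  hence "((\<lambda>z. z * (deriv H z / H z)) has_field_derivative (deriv H 0 / H 0)) (at 0)"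
    using DERIV_mult[OF DERIV_ident] by fastforce
  hence "deriv q 0 = deriv H 0 / H 0" by (simp add: q_def[abs_def] DERIV_imp_deriv)
  moreover have "deriv H 0 = taylor_coeff H 1" "H 0 = taylor_coeff H 0"
    by (simp_all add: taylor_coeff_def fps_expansion_def)
  ultimately have "deriv q 0 = of_real (a * b)" by (simp add: taylor_coeff_H binom_coeff_def)
  thus ?thesis using True by (simp add: W_def q_0 x_def)
next
  case False
  have z1: "1 - z \<noteq> 0" using z by auto
  have "z * (W z * (1 - x z)) = z * W z - (1 - z) * (q z)\<^sup>2"
    using False W_nz[OF z] by (simp add: x_eq[OF False] field_simps)
  hence "z * ((1 - z) * deriv q z) = z * (W z * (1 - x z))" using riccati[OF z] by (simp only: mult_ac)
  hence "(1 - z) * deriv q z = W z * (1 - x z)" using False by simp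
  thus ?thesis using z1 by (simp add: field_simps)
qed

lemma W_deriv: "norm z < 1 \<Longrightarrow> (W has_field_derivative of_real \<sigma> * deriv q z) (at z)"
  unfolding W_def by (auto intro!: derivative_eq_intros q_deriv)

lemma t_deriv:
  assumes z: "norm z < 1"
  shows "(t has_field_derivative (- of_real \<sigma> * t z * (1 - x z) / (1 - z))) (at z)"
proof -
  have "(t has_field_derivative - (of_real (a * b) * (of_real \<sigma> * deriv q z) / (W z * W z))) (at z)"
    unfolding t_def using W_nz[OF z] by (auto intro!: derivative_eq_intros W_deriv z)
  also have "- (of_real (a * b) * (of_real \<sigma> * deriv q z) / (W z * W z)) = - of_real \<sigma> * t z * (1 - x z) / (1 - z)"
    unfolding deriv_q[OF z] using W_nz[OF z] by (simp add: t_def mult_ac)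
  finally show ?thesis .
qed

lemma second_deriv_q:
  assumes z: "norm z < 1" "z \<noteq> 0" and x1: "1 - x z \<noteq> 0"
  shows "1 + z * deriv (deriv q) z / deriv q z =
    of_real \<sigma> * (z / (1 - z)) - 2 * q z + 1 / (1 - z) / (1 - x z)"
proof -
  define y y' w \<xi> where "y = q z" and "y' = deriv q z" and "w = W z" and "\<xi> = x z"
  have z1: "1 - z \<noteq> 0" using z by auto
  have w: "w \<noteq> 0" using W_nz[OF z(1)] by (simp add: w_def)
  have \<xi>: "\<xi> * (z * w) = (1 - z) * y\<^sup>2" using x_eq[OF z(2)] w z by (simp add: \<xi>_def w_def y_def)
  have y': "y' * (1 - z) = w * (1 - \<xi>)" using deriv_q[OF z(1)] z1 by (simp add: y'_def w_def \<xi>_def)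
  have yy: "y' = w * (1 - \<xi>) / (1 - z)" using y' z1 by (simp add: field_simps)
  have zy: "z * y' / w = z / (1 - z) * (1 - \<xi>)" using w by (simp add: yy)
  define \<xi>' where "\<xi>' = ((- (y\<^sup>2) + (1 - z) * (2 * y * y')) * (z * w) - (1 - z) * y\<^sup>2 * (w + z * (of_real \<sigma> * y'))) / (z * w * (z * w))"
  have xd: "(x has_field_derivative \<xi>') (at z)"
  proof (rule has_field_derivative_transform_within_open[where S = "ball 0 1 - {0}" and f = "\<lambda>z. (1 - z) * (q z)\<^sup>2 / (z * W z)"])
    have n: "((\<lambda>z. (1 - z) * (q z)\<^sup>2) has_field_derivative (- (y\<^sup>2) + (1 - z) * (2 * y * y'))) (at z)"
      by (auto intro!: derivative_eq_intros q_deriv z simp: y_def y'_def)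
    have d: "((\<lambda>z. z * W z) has_field_derivative (w + z * (of_real \<sigma> * y'))) (at z)"
      by (auto intro!: derivative_eq_intros W_deriv z simp: w_def y'_def)
    show "((\<lambda>z. (1 - z) * (q z)\<^sup>2 / (z * W z)) has_field_derivative \<xi>') (at z)"
      using DERIV_divide[OF n d] z w by (simp add: \<xi>'_def y_def w_def)
    show "(1 - v) * (q v)\<^sup>2 / (v * W v) = x v" if "v \<in> ball 0 1 - {0}" for v
      using x_eq[of v] that by auto
  qed (use z in auto)
  have z\<xi>': "z * \<xi>' = - (\<xi> * (z / (1 - z))) - \<xi> + 2 * y * (1 - \<xi>) - of_real \<sigma> * \<xi> * (z / (1 - z)) * (1 - \<xi>)"
  proof -
    have "z * \<xi>' = - (y\<^sup>2 / w) + 2 * y * ((1 - z) * y' / w) - (1 - z) * y\<^sup>2 / (z * w)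
        - of_real \<sigma> * ((1 - z) * y\<^sup>2 / (z * w)) * (z * y' / w)"
      using z w by (simp add: \<xi>'_def field_simps)
    also have "y\<^sup>2 / w = \<xi> * (z / (1 - z))"
      using \<xi> w z1 by (simp add: field_simps)
    also have "(1 - z) * y' / w = 1 - \<xi>" using y' w by (simp add: mult.commute)
    also have "(1 - z) * y\<^sup>2 / (z * w) = \<xi>" using \<xi> z w by (simp add: field_simps)
    also note zy
    finally show ?thesis by (simp add: mult_ac)
  qed
  have "((\<lambda>z. W z * (1 - x z) / (1 - z)) has_field_derivative
      (((of_real \<sigma> * y') * (1 - \<xi>) + w * (- \<xi>')) * (1 - z) + w * (1 - \<xi>)) / ((1 - z) * (1 - z))) (at z)"
    using z1 by (auto intro!: derivative_eq_intros W_deriv xd z simp: w_def y'_def \<xi>_def)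
  hence "(deriv q has_field_derivative
      (((of_real \<sigma> * y') * (1 - \<xi>) + w * (- \<xi>')) * (1 - z) + w * (1 - \<xi>)) / ((1 - z) * (1 - z))) (at z)"
    by (rule has_field_derivative_transform_within_open[where S = "ball 0 1"]) (use z deriv_q in auto)
  hence dd: "deriv (deriv q) z = (((of_real \<sigma> * y') * (1 - \<xi>) + w * (- \<xi>')) * (1 - z) + w * (1 - \<xi>)) / ((1 - z) * (1 - z))"
    by (rule DERIV_imp_deriv)
  have x1': "1 - \<xi> \<noteq> 0" using x1 by (simp add: \<xi>_def)
  have gen: "z * (((s * y') * e + w * (- v)) * d + w * e) / (d * d) / (w * e / d) = s * (z * y' / w) - z * v / e + z / d"
    if "d \<noteq> 0" "e \<noteq> 0" for s e d v :: complex
    using that w by (simp add: field_simps)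
  have "1 + z * deriv (deriv q) z / deriv q z = 1 + (of_real \<sigma> * (z / (1 - z) * (1 - \<xi>)) - z * \<xi>' / (1 - \<xi>) + z / (1 - z))"
    unfolding dd y'_def[symmetric] using gen[OF z1 x1', of "of_real \<sigma>" \<xi>'] unfolding zy by (simp add: yy)
  also have "z * \<xi>' / (1 - \<xi>) = - (\<xi> * (1 + z / (1 - z)) / (1 - \<xi>)) + 2 * y - of_real \<sigma> * \<xi> * (z / (1 - z))"
  proof -
    have "z * \<xi>' = (- (\<xi> * (1 + z / (1 - z)) / (1 - \<xi>)) + 2 * y - of_real \<sigma> * \<xi> * (z / (1 - z))) * (1 - \<xi>)"
    proof -
      have "- (\<xi> * v) - \<xi> + 2 * y * (1 - \<xi>) - s * \<xi> * v * (1 - \<xi>) =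
          (- (\<xi> * (1 + v) / (1 - \<xi>)) + 2 * y - s * \<xi> * v) * (1 - \<xi>)" for s v :: complex
        using x1' by (simp add: field_simps)
      thus ?thesis unfolding z\<xi>' .
    qed
    thus ?thesis using x1' by (simp add: nonzero_divide_eq_eq)
  qed
  also have "1 + (of_real \<sigma> * (z / (1 - z) * (1 - \<xi>)) - (- (\<xi> * (1 + z / (1 - z)) / (1 - \<xi>)) + 2 * y - of_real \<sigma> * \<xi> * (z / (1 - z))) + z / (1 - z))
      = of_real \<sigma> * (z / (1 - z)) - 2 * y + (1 + z / (1 - z)) / (1 - \<xi>)"
  proof -
    have "1 + (s * (v * (1 - \<xi>)) - (- (\<xi> * (1 + v) / (1 - \<xi>)) + 2 * y - s * \<xi> * v) + v) = s * v - 2 * y + (1 + v) / (1 - \<xi>)" for s v :: complex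
      using x1' by (simp add: field_simps)
    thus ?thesis .
  qed
  also have "1 + z / (1 - z) = 1 / (1 - z)" using z1 by (simp add: field_simps)
  finally show ?thesis by (simp add: y_def \<xi>_def)
qed

text \<open>
  If $s = 1 - t$ first reaches the unit circle at $z_0$, then by Jack's lemma
  $z_0 s'(z_0) = k\,s(z_0)$ with $k \ge 1$, and the differential equation of $t$ yields
  $\mathrm{Re}\,\frac{z_0}{1-z_0} < -\frac12$.
\<close>
lemma norm_one_minus_t_less:
  assumes z: "norm z < 1"
  shows "norm (1 - t z) < 1"
proof (rule ccontr)
  assume big: "\<not> ?thesis"
  define s where "s w = 1 - t w" for w
  have s_hol: "s holomorphic_on ball 0 1" unfolding s_def by (intro holomorphic_intros t_hol)
  have s_cont: "continuous_on (ball 0 1) s" by (rule holomorphic_on_imp_continuous_on[OF s_hol])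
  have s0: "s 0 = 0" by (simp add: s_def t_0)
  have hit: "\<exists>u. 0 \<le> u \<and> u \<le> 1 \<and> norm (s (of_real u * w)) = 1" if "norm w < 1" "1 \<le> norm (s w)" for w
  proof (rule IVT')
    have "norm (of_real u * w) < 1" if "u \<in> {0..1}" for u
      using mult_mono[of u 1 "norm w" "norm w"] that \<open>norm w < 1\<close> by (auto simp: norm_mult)
    thus "continuous_on {0..1} (\<lambda>u. norm (s (of_real u * w)))"
      by (intro continuous_on_norm continuous_on_compose2[OF s_cont] continuous_intros) auto
  qed (use that s0 in auto)
  define Z where "Z = cball 0 (norm z) \<inter> (\<lambda>w. norm (s w)) -` {1}"
  have "closed Z"
    unfolding Z_def
    by (intro continuous_closed_preimage continuous_on_norm continuous_on_subset[OF s_cont]) (use z in auto)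
  hence "compact Z" by (auto simp: compact_eq_bounded_closed Z_def intro: bounded_subset[OF bounded_cball])
  moreover obtain u where "0 \<le> u" "u \<le> 1" "norm (s (of_real u * z)) = 1" using hit[OF z] big by (auto simp: s_def)
  hence "of_real u * z \<in> Z" using mult_mono[of u 1 "norm z" "norm z"] by (simp add: Z_def norm_mult)
  ultimately obtain z0 where z0: "z0 \<in> Z" "\<And>w. w \<in> Z \<Longrightarrow> norm z0 \<le> norm w"
    using continuous_attains_inf[of Z norm] by (auto intro: continuous_intros)
  have n0: "norm z0 < 1" "norm (s z0) = 1" "norm z0 \<le> norm z" using z0(1) z by (auto simp: Z_def)
  have z00: "z0 \<noteq> 0" using n0 s0 by auto
  have first: "norm (s w) = 1 \<and> norm w = norm z0" if w: "norm w \<le> norm z0" "1 \<le> norm (s w)" for w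
  proof -
    obtain u where u: "0 \<le> u" "u \<le> 1" "norm (s (of_real u * w)) = 1" using hit[of w] w n0 by auto
    have uw: "u * norm w \<le> norm w" using mult_mono[of u 1 "norm w" "norm w"] u by simp
    hence "of_real u * w \<in> Z" using u w n0 by (simp add: Z_def norm_mult)
    from z0(2)[OF this] have "norm z0 \<le> u * norm w" using u by (simp add: norm_mult)
    hence e: "norm w = norm z0" "u * norm w = norm w" using uw w by linarith+
    hence "u = 1" using z00 by auto
    thus ?thesis using u e by simp
  qed
  have schwarz: "norm (s w) \<le> norm w / norm z0" if w: "norm w \<le> norm z0" for w
  proof (cases "norm w < norm z0")
    case True
    define g where "g v = s (of_real (norm z0) * v)" for v
    have sub: "norm (of_real (norm z0) * v) < norm z0" if "norm v < 1" for v :: complex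
      using that z00 by (simp add: norm_mult)
    have "g holomorphic_on ball 0 1"
      unfolding g_def
      using holomorphic_on_compose_gen[of "\<lambda>v. of_real (norm z0) * v" "ball 0 1" s "ball 0 1"] s_hol sub n0
      by (force simp: o_def intro!: holomorphic_intros)
    moreover have g0: "g 0 = 0" by (simp add: g_def s0)
    moreover have "norm (g v) < 1" if "norm v < 1" for v
      using first[of "of_real (norm z0) * v"] sub[OF that] unfolding g_def by force
    ultimately have "norm (g (w / of_real (norm z0))) \<le> norm (w / of_real (norm z0))"
      using True z00 by (intro Schwarz_Lemma(1)[of g]) (auto simp: g0 norm_divide)
    thus ?thesis using z00 by (simp add: g_def norm_divide)
  next
    case False
    thus ?thesis using first[of w] w z00 by force
  qed
  define k where "k = z0 * deriv s z0 / s z0"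
  have sd: "(s has_field_derivative deriv s z0) (at z0)"
    using n0 by (intro holomorphic_derivI[OF s_hol]) auto
  have sz0: "s z0 \<noteq> 0" using n0 by auto
  define g where "g w = - (s w * z0 / (w * s z0))" for w
  have "(g has_field_derivative - ((deriv s z0 * z0 * (z0 * s z0) - s z0 * z0 * s z0) / (z0 * s z0 * (z0 * s z0)))) (at z0)"
    unfolding g_def using z00 sz0 by (auto intro!: derivative_eq_intros sd)
  moreover have "Re (g z0) \<le> Re (g w)" if "norm w \<le> norm z0" for w
  proof -
    have "norm (g w) \<le> 1"
    proof (cases "w = 0")
      case False
      have "norm (s w) * norm z0 \<le> norm w" using schwarz[OF that] z00 by (simp add: pos_le_divide_eq)
      thus ?thesis using False n0 by (simp add: g_def norm_mult norm_divide)
    qed (simp add: g_def)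
    hence "-1 \<le> Re (g w)" using abs_Re_le_cmod[of "g w"] by linarith
    moreover have "g z0 = -1" using z00 sz0 by (simp add: g_def)
    ultimately show ?thesis by simp
  qed
  ultimately have J: "Im (z0 * - ((deriv s z0 * z0 * (z0 * s z0) - s z0 * z0 * s z0) / (z0 * s z0 * (z0 * s z0)))) = 0"
      "Re (z0 * - ((deriv s z0 * z0 * (z0 * s z0) - s z0 * z0 * s z0) / (z0 * s z0 * (z0 * s z0)))) \<le> 0"
    using Jack_Re[of g _ z0] z00 by blast+
  have "z0 * - ((d * z0 * (z0 * S) - S * z0 * S) / (z0 * S * (z0 * S))) = 1 - z0 * d / S" if "S \<noteq> 0" for d S
    using that z00 by (simp add: field_simps)
  from this[OF sz0] have k: "Im k = 0" "1 \<le> Re k" using J unfolding k_def by auto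
  have ks: "k * s z0 = of_real \<sigma> * (z0 / (1 - z0) * (1 - s z0) - of_real r * (s z0)\<^sup>2)"
  proof -
    have z1: "1 - z0 \<noteq> 0" using n0 by auto
    have "(s has_field_derivative (0 - (- of_real \<sigma> * t z0 * (1 - x z0) / (1 - z0)))) (at z0)"
      unfolding s_def by (intro DERIV_diff DERIV_const t_deriv n0)
    hence "deriv s z0 = of_real \<sigma> * t z0 * (1 - x z0) / (1 - z0)" by (simp add: DERIV_imp_deriv)
    moreover have "k * s z0 = z0 * deriv s z0" using sz0 by (simp add: k_def)
    ultimately have "k * s z0 = z0 * (of_real \<sigma> * t z0 * (1 - x z0) / (1 - z0))" by (simp only:)
    also have "\<dots> = of_real \<sigma> * (z0 / (1 - z0) * t z0 - z0 / (1 - z0) * (t z0 * x z0))"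
      by (simp add: divide_inverse algebra_simps)
    also have "t z0 * x z0 = of_real r * (s z0)\<^sup>2 * ((1 - z0) / z0)"
      unfolding x_eq_t[OF n0(1) z00] using t_nz[OF n0(1)] z00 by (simp add: s_def)
    also have "z0 / (1 - z0) * (of_real r * (s z0)\<^sup>2 * ((1 - z0) / z0)) = of_real r * (s z0)\<^sup>2" using z1 z00 by simp
    finally show ?thesis by (simp add: s_def)
  qed
  have s1: "1 - s z0 \<noteq> 0" using t_nz[OF n0(1)] by (simp add: s_def)
  define v where "v = s z0 / (1 - s z0)"
  have "z0 / (1 - z0) = of_real (Re k / \<sigma>) * v + of_real r * (v - s z0)"
  proof -
    have "k = of_real (Re k)" using k by (simp add: complex_eq_iff)
    hence "of_real (Re k) * s z0 = of_real \<sigma> * (z0 / (1 - z0) * (1 - s z0) - of_real r * (s z0)\<^sup>2)" using ks by simp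
    moreover have "of_real (Re k / \<sigma>) * s z0 = of_real (Re k) * s z0 / of_real \<sigma>" by simp
    ultimately have "of_real (Re k / \<sigma>) * s z0 = z0 / (1 - z0) * (1 - s z0) - of_real r * (s z0)\<^sup>2"
      using \<sigma> by simp
    moreover have "Z = K * (S / (1 - S)) + R * (S / (1 - S) - S)"
      if "K * S = Z * (1 - S) - R * S\<^sup>2" "1 - S \<noteq> 0" for Z K R S :: complex
    proof -
      have "Z * (1 - S) = K * S + R * S\<^sup>2" using that(1) by (simp add: algebra_simps)
      hence "Z = (K * S + R * S\<^sup>2) / (1 - S)" using that(2) by (simp add: nonzero_eq_divide_eq)
      also have "\<dots> = K * (S / (1 - S)) + R * (S\<^sup>2 / (1 - S))" by (simp add: add_divide_distrib)
      also have "S\<^sup>2 / (1 - S) = S / (1 - S) - S"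
        using that(2) by (simp add: diff_frac_eq field_simps power2_eq_square)
      finally show ?thesis .
    qed
    ultimately show ?thesis using s1 unfolding v_def by blast
  qed
  moreover have "Re v = -1/2"
  proof -
    have "v = 1 / (1 - s z0) - 1" using s1 by (simp add: v_def field_simps)
    moreover have "Re (1 / (1 - s z0)) = 1/2"
    proof -
      have "(norm (1 - s z0))\<^sup>2 = 2 * Re (1 - s z0)" using n0 unfolding norm_one_minus_sq by simp
      moreover have "Re (1 / (1 - s z0)) = Re (1 - s z0) / (norm (1 - s z0))\<^sup>2" by (simp add: Re_divide cmod_power2)
      moreover have "Re (1 - s z0) \<noteq> 0" using calculation(1) s1 by auto
      ultimately show ?thesis by (simp only:) simp
    qed
    ultimately show ?thesis by simp
  qed
  moreover have "Re (of_real k * w) = k * Re w" for k w by simp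
  ultimately have "Re (z0 / (1 - z0)) = Re k / \<sigma> * (-1/2) + r * (-1/2 - Re (s z0))" by (simp only: plus_complex.sel minus_complex.sel)
  moreover have "1 * 2 \<le> Re k * (1 / \<sigma>)" using k \<sigma> by (intro mult_mono) (auto simp: field_simps)
  moreover have "r * (-1/2 - Re (s z0)) \<le> 1/4 * (1/2)"
  proof -
    have "-1/2 - Re (s z0) \<le> 1/2" using abs_Re_le_cmod[of "s z0"] n0 by linarith
    hence "r * (-1/2 - Re (s z0)) \<le> r * (1/2)" using r by (intro mult_left_mono) auto
    thus ?thesis using ratio_bounds(2)[OF \<sigma> r(2)] by linarith
  qed
  ultimately show False using Re_geometric_gt[OF n0(1)] by simp
qed

lemma norm_one_minus_t_le: "norm z < 1 \<Longrightarrow> norm (1 - t z) \<le> norm z"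
  by (rule Schwarz_Lemma(1)[of "\<lambda>z. 1 - t z"])
     (auto intro!: holomorphic_intros t_hol norm_one_minus_t_less simp: t_0)

definition \<tau> :: "complex \<Rightarrow> complex" where "\<tau> z = t z * (1 - z) powr (- of_real \<sigma>)"

lemma \<tau>_deriv:
  assumes z: "norm z < 1" "z \<noteq> 0"
  shows "(\<tau> has_field_derivative of_real (\<sigma> * r) * ((1 - t z)\<^sup>2 / z) * (1 - z) powr (- of_real \<sigma>)) (at z)"
proof -
  have z1: "1 - z \<noteq> 0" using z by auto
  have p: "((\<lambda>u. (1 - u) powr (- of_real \<sigma>)) has_field_derivative (of_real \<sigma> / (1 - z) * (1 - z) powr (- of_real \<sigma>))) (at z)"
    using one_minus_mult_powr_has_derivative[of 1 z "- of_real \<sigma>"] z by simp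
  have "(\<tau> has_field_derivative (- of_real \<sigma> * t z * (1 - x z) / (1 - z) * (1 - z) powr (- of_real \<sigma>)
      + of_real \<sigma> / (1 - z) * (1 - z) powr (- of_real \<sigma>) * t z)) (at z)"
    unfolding \<tau>_def by (rule DERIV_mult[OF t_deriv[OF z(1)] p])
  also have "- of_real \<sigma> * t z * (1 - x z) / (1 - z) * (1 - z) powr (- of_real \<sigma>)
      + of_real \<sigma> / (1 - z) * (1 - z) powr (- of_real \<sigma>) * t z =
      of_real \<sigma> * (t z * x z / (1 - z)) * (1 - z) powr (- of_real \<sigma>)"
    by (simp add: divide_inverse algebra_simps)
  also have "t z * x z / (1 - z) = of_real r * ((1 - t z)\<^sup>2 / z)"
    unfolding x_eq_t[OF z] using t_nz[OF z(1)] z1 by simp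
  finally show ?thesis by (simp add: mult_ac)
qed

lemma \<tau>_0: "\<tau> 0 = 1" by (simp add: \<tau>_def t_0)

lemma \<tau>_hol: "\<tau> holomorphic_on ball 0 1"
  unfolding \<tau>_def by (intro holomorphic_intros t_hol one_minus_powr_holomorphic)

lemma norm_\<tau>_bound:
  assumes z: "norm z < 1"
    and \<phi>: "continuous_on {0..1} \<phi>" "\<And>u. 0 < u \<Longrightarrow> u < 1 \<Longrightarrow> (\<phi> has_real_derivative \<phi>' u) (at u)"
    and bound: "\<And>u. 0 < u \<Longrightarrow> u < 1 \<Longrightarrow> norm (1 - of_real u * z) powr (- \<sigma>) * (\<sigma> * r * u) \<le> \<phi>' u"
  shows "norm (\<tau> z - 1) \<le> \<phi> 1 - \<phi> 0"
proof (cases "z = 0")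
  case True
  have "\<phi> 0 \<le> \<phi> 1"
  proof (rule DERIV_nonneg_imp_increasing_open[of 0 1])
    show "\<exists>y. (\<phi> has_real_derivative y) (at u) \<and> 0 \<le> y" if "0 < u" "u < 1" for u
    proof -
      have "0 \<le> norm (1 - of_real u * z) powr (- \<sigma>) * (\<sigma> * r * u)" using \<sigma> r that by simp
      thus ?thesis using bound[OF that] \<phi>(2)[OF that] by force
    qed
  qed (use \<phi> in auto)
  thus ?thesis by (simp add: True \<tau>_0)
next
  case False
  define T where "T u = of_real (\<sigma> * r) * ((1 - t u)\<^sup>2 / u) * (1 - u) powr (- of_real \<sigma>)" for u
  have sm: "norm (of_real u * z) < 1" if "0 \<le> u" "u \<le> 1" for u
    using mult_mono[of u 1 "norm z" "norm z"] that z by (auto simp: norm_mult)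
  have "norm (\<tau> (of_real 1 * z) - \<tau> (of_real 0 * z)) \<le> \<phi> 1 - \<phi> 0"
  proof (rule differentiable_bound_general)
    show "continuous_on {0..1} (\<lambda>u. \<tau> (of_real u * z))"
      by (intro continuous_on_compose2[OF holomorphic_on_imp_continuous_on[OF \<tau>_hol]] continuous_intros) (use sm in auto)
    fix u :: real assume u: "0 < u" "u < 1"
    have uz: "norm (of_real u * z) < 1" "of_real u * z \<noteq> 0" using sm[of u] u False by auto
    have "((\<lambda>u. of_real u * z) has_vector_derivative z) (at u)" by (auto intro!: derivative_eq_intros)
    from field_vector_diff_chain_at[OF this \<tau>_deriv[OF uz]]
    show "((\<lambda>u. \<tau> (of_real u * z)) has_vector_derivative (z * T (of_real u * z))) (at u)"
      by (simp only: o_def T_def)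
    show "(\<phi> has_vector_derivative \<phi>' u) (at u)" using \<phi>(2)[OF u] by (simp add: has_real_derivative_iff_has_vector_derivative)
    have "norm (z * T (of_real u * z)) = norm (1 - of_real u * z) powr (- \<sigma>) * (\<sigma> * r * ((norm (1 - t (of_real u * z)))\<^sup>2 / u))"
      using u \<sigma> r False by (simp add: T_def norm_mult norm_divide norm_power norm_powr_real_powr')
    also have "\<dots> \<le> norm (1 - of_real u * z) powr (- \<sigma>) * (\<sigma> * r * u)"
    proof (intro mult_left_mono)
      have "norm (1 - t (of_real u * z)) \<le> u"
      proof -
        have "u * norm z \<le> u" using u z by (simp add: mult_left_le)
        moreover have "norm (1 - t (of_real u * z)) \<le> u * norm z"
          using norm_one_minus_t_le[OF uz(1)] u by (simp add: norm_mult)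
        ultimately show ?thesis by linarith
      qed
      hence "(norm (1 - t (of_real u * z)))\<^sup>2 \<le> u\<^sup>2" by (intro power_mono) auto
      thus "(norm (1 - t (of_real u * z)))\<^sup>2 / u \<le> u" using u by (simp add: pos_divide_le_eq power2_eq_square)
    qed (use \<sigma> r in auto)
    also have "\<dots> \<le> \<phi>' u" by (rule bound[OF u])
    finally show "norm (z * T (of_real u * z)) \<le> \<phi>' u" .
  qed (use \<phi> in auto)
  thus ?thesis by (simp add: \<tau>_0)
qed

lemma norm_\<tau>_near:
  assumes z: "norm z < 1"
  shows "norm (\<tau> z - 1) \<le> 4 * \<sigma> * r / 3"
proof -
  define \<phi> where "\<phi> u = - (2/3) * (\<sigma> * r) * (sqrt (1 - u) * (u + 2))" for u
  have "norm (\<tau> z - 1) \<le> \<phi> 1 - \<phi> 0"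
  proof (rule norm_\<tau>_bound[OF z, where \<phi>' = "\<lambda>u. \<sigma> * r * (u / sqrt (1 - u))"])
    show "continuous_on {0..1} \<phi>" unfolding \<phi>_def by (intro continuous_intros)
    fix u :: real assume u: "0 < u" "u < 1"
    have s: "sqrt (1 - u) > 0" "sqrt (1 - u) * sqrt (1 - u) = 1 - u" using u by auto
    have "((\<lambda>u. sqrt (1 - u) * (u + 2)) has_real_derivative (inverse (sqrt (1 - u)) / 2 * (0 - 1) * (u + 2) + (1 + 0) * sqrt (1 - u))) (at u)"
      using u by (intro DERIV_mult DERIV_add DERIV_ident DERIV_const DERIV_chain2[OF DERIV_real_sqrt] DERIV_diff) auto
    also have "inverse (sqrt (1 - u)) / 2 * (0 - 1) * (u + 2) + (1 + 0) * sqrt (1 - u) = - (3/2) * (u / sqrt (1 - u))"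
      using s by (simp add: field_simps)
    finally have "(\<phi> has_real_derivative - (2/3) * (\<sigma> * r) * (- (3/2) * (u / sqrt (1 - u)))) (at u)"
      unfolding \<phi>_def by (rule DERIV_cmult)
    also have "- (2/3) * (\<sigma> * r) * (- (3/2) * (u / sqrt (1 - u))) = \<sigma> * r * (u / sqrt (1 - u))" by simp
    finally show "(\<phi> has_real_derivative \<sigma> * r * (u / sqrt (1 - u))) (at u)" .
    have "1 - u \<le> norm (1 - of_real u * z)"
    proof -
      have "u * norm z \<le> u" using u z by (simp add: mult_left_le)
      moreover have "1 - u * norm z \<le> norm (1 - of_real u * z)"
        using norm_triangle_ineq2[of 1 "of_real u * z"] u by (simp add: norm_mult)
      ultimately show ?thesis by linarith
    qed
    hence "norm (1 - of_real u * z) powr (- \<sigma>) \<le> (1 - u) powr (- \<sigma>)" using u \<sigma> by (intro powr_mono2') auto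
    also have "\<dots> \<le> (1 - u) powr (- (1/2))" using u \<sigma> by (intro powr_mono') auto
    also have "\<dots> = 1 / sqrt (1 - u)" unfolding powr_minus using u by (subst powr_half_sqrt) (simp_all add: divide_inverse)
    finally have "norm (1 - of_real u * z) powr (- \<sigma>) * (\<sigma> * r * u) \<le> 1 / sqrt (1 - u) * (\<sigma> * r * u)"
      using \<sigma> r u by (intro mult_right_mono) auto
    thus "norm (1 - of_real u * z) powr (- \<sigma>) * (\<sigma> * r * u) \<le> \<sigma> * r * (u / sqrt (1 - u))" by simp
  qed
  thus ?thesis by (simp add: \<phi>_def)
qed

lemma norm_\<tau>_far:
  assumes z: "norm z < 1" "1 \<le> norm (1 - z)"
  shows "norm (\<tau> z - 1) \<le> 55/1000"
proof -
  define c :: real where "c = 866/1000"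
  have c: "c > 0" by (simp add: c_def)
  define \<phi> where "\<phi> u = \<sigma> * r * (1/c) * (u\<^sup>2 / 2)" for u
  have "norm (\<tau> z - 1) \<le> \<phi> 1 - \<phi> 0"
  proof (rule norm_\<tau>_bound[OF z(1), where \<phi>' = "\<lambda>u. \<sigma> * r * (1/c) * u"])
    show "continuous_on {0..1} \<phi>" unfolding \<phi>_def by (intro continuous_intros) auto
    fix u :: real assume u: "0 < u" "u < 1"
    show "(\<phi> has_real_derivative \<sigma> * r * (1/c) * u) (at u)"
      unfolding \<phi>_def using c by (auto intro!: derivative_eq_intros)
    have "c\<^sup>2 \<le> (norm (1 - of_real u * z))\<^sup>2"
    proof -
      have "1 \<le> (norm (1 - z))\<^sup>2" using z(2) by simp
      hence "2 * Re z \<le> (norm z)\<^sup>2" unfolding norm_one_minus_sq by simp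
      hence "u * (2 * Re z) \<le> u * (norm z)\<^sup>2" using u by (intro mult_left_mono) auto
      moreover have "(u - u\<^sup>2) * (norm z)\<^sup>2 \<le> (u - u\<^sup>2) * 1"
        using z(1) u by (intro mult_left_mono) (auto simp: power2_eq_square abs_square_le_1 mult_le_one)
      moreover have "(norm (1 - of_real u * z))\<^sup>2 = 1 - u * (2 * Re z) + u\<^sup>2 * (norm z)\<^sup>2"
        unfolding norm_one_minus_sq using u by (simp add: norm_mult power_mult_distrib)
      moreover have "0 \<le> (u - 1/2)\<^sup>2" by simp
      hence "u - u\<^sup>2 \<le> 1/4" by (simp add: power2_eq_square algebra_simps)
      ultimately have "3/4 \<le> (norm (1 - of_real u * z))\<^sup>2" by (simp add: left_diff_distrib)
      thus ?thesis by (simp add: c_def power2_eq_square)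
    qed
    hence "c \<le> norm (1 - of_real u * z)" by (rule power2_le_imp_le) simp
    hence "norm (1 - of_real u * z) powr (- \<sigma>) \<le> c powr (- \<sigma>)" using \<sigma> by (intro powr_mono2') (auto simp: c_def)
    also have "\<dots> \<le> c powr (- 1)" using \<sigma> by (intro powr_mono') (auto simp: c_def)
    also have "\<dots> = 1 / c" by (simp add: c_def powr_minus_divide)
    finally have "norm (1 - of_real u * z) powr (- \<sigma>) * (\<sigma> * r * u) \<le> 1 / c * (\<sigma> * r * u)"
      using \<sigma> r u by (intro mult_right_mono) auto
    thus "norm (1 - of_real u * z) powr (- \<sigma>) * (\<sigma> * r * u) \<le> \<sigma> * r * (1/c) * u" by (simp add: mult_ac)
  qed
  also have "\<dots> = \<sigma> * r * (500/866)" by (simp add: \<phi>_def c_def)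
  also have "\<dots> \<le> 3/32 * (500/866)" using ratio_bounds(3)[OF \<sigma> r(2)] by (rule mult_right_mono) simp
  finally show ?thesis by simp
qed

definition t0 :: "complex \<Rightarrow> complex" where "t0 z = (1 - z) powr of_real \<sigma>"

lemma t_eq: assumes "norm z < 1" shows "t z = t0 z * \<tau> z"
proof -
  have "1 - z \<noteq> 0" using assms by auto
  thus ?thesis by (simp add: t0_def \<tau>_def powr_minus)
qed

lemma norm_t0: "norm (t0 z) = norm (1 - z) powr \<sigma>" "(norm (t0 z))\<^sup>2 = norm (1 - z) powr (2 * \<sigma>)"
proof -
  show e: "norm (t0 z) = norm (1 - z) powr \<sigma>" by (simp add: t0_def norm_powr_real_powr')
  show "(norm (t0 z))\<^sup>2 = norm (1 - z) powr (2 * \<sigma>)"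
    unfolding e by (simp add: power2_eq_square flip: powr_add)
qed

lemma Re_t0: assumes "norm z < 1" shows "0 < Re (t0 z)"
proof -
  have "Re (1 - z) > 0" using assms abs_Re_le_cmod[of z] by simp
  hence "\<bar>Im (Ln (1 - z))\<bar> < pi / 2" by (rule Re_Ln_pos_lt_imp)
  hence "\<bar>\<sigma> * Im (Ln (1 - z))\<bar> \<le> 1 * \<bar>Im (Ln (1 - z))\<bar>" unfolding abs_mult
    using \<sigma> by (intro mult_right_mono) auto
  hence "\<bar>\<sigma> * Im (Ln (1 - z))\<bar> < pi / 2" using \<open>\<bar>Im (Ln (1 - z))\<bar> < pi / 2\<close> by linarith
  hence "cos (\<sigma> * Im (Ln (1 - z))) > 0" by (intro cos_gt_zero_pi) auto
  moreover have "1 - z \<noteq> 0" using assms by auto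
  ultimately show ?thesis by (simp add: t0_def powr_def Re_exp)
qed

lemma norm_one_minus_t0_sq:
  assumes z: "norm z < 1"
  shows "norm (1 - (t0 z)\<^sup>2) \<le> 1"
proof -
  define p where "p = 2 * \<sigma>"
  have p: "0 < p" "p \<le> 1" using \<sigma> by (auto simp: p_def)
  define f where "f u = (1 - z * of_real u) powr of_real p" for u :: real
  have zu: "norm (z * of_real u) < 1" if "0 \<le> u" "u \<le> 1" for u
    using mult_mono[of "norm z" "norm z" u 1] that z by (auto simp: norm_mult)
  have nz: "1 - z * of_real u \<noteq> 0" if "0 \<le> u" "u \<le> 1" for u using zu[OF that] by auto
  have d: "(f has_vector_derivative (z * (- of_real p / (1 - z * of_real u) * (1 - z * of_real u) powr of_real p))) (at u)"
    if "0 \<le> u" "u \<le> 1" for u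
  proof -
    have "((\<lambda>u. z * of_real u) has_vector_derivative z) (at u)" by (auto intro!: derivative_eq_intros)
    moreover
    have "((\<lambda>u. (1 - 1 * u) powr of_real p) has_field_derivative (- of_real p * 1 / (1 - 1 * (z * of_real u)) * (1 - 1 * (z * of_real u)) powr of_real p)) (at (z * of_real u))"
      by (rule one_minus_mult_powr_has_derivative) (use zu[OF that] in simp)
    from field_vector_diff_chain_at[OF calculation this] show ?thesis unfolding f_def o_def mult_1 mult_1_right .
  qed
  have "norm (f 1 - f 0) \<le> - ((1 - 1) powr p) - (- ((1 - 0) powr p))"
  proof (rule differentiable_bound_general[of 0 1 f "\<lambda>u. - ((1 - u) powr p)", where \<phi>' = "\<lambda>u. p * (1 - u) powr (p - 1)"])
    show "continuous_on {0..1} f"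
      by (rule continuous_on_vector_derivative[OF has_vector_derivative_at_within[OF d]]) auto
    show "continuous_on {0..1} (\<lambda>u. - ((1 - u) powr p))"
      using p by (intro continuous_intros continuous_on_powr') auto
    fix u :: real assume u: "0 < u" "u < 1"
    show "(f has_vector_derivative (z * (- of_real p / (1 - z * of_real u) * (1 - z * of_real u) powr of_real p))) (at u)"
      using d u by simp
    have "((\<lambda>u. - ((1 - u) powr p)) has_real_derivative p * (1 - u) powr (p - 1)) (at u)"
      using u by (auto intro!: derivative_eq_intros DERIV_powr simp: powr_diff)
    thus "((\<lambda>u. - ((1 - u) powr p)) has_vector_derivative p * (1 - u) powr (p - 1)) (at u)"
      by (simp add: has_real_derivative_iff_has_vector_derivative)
    define m where "m = norm (1 - z * of_real u)"
    have m: "1 - u \<le> m" "0 < m"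
    proof -
      have "norm z * u \<le> u" using u z by (simp add: mult_right_le_one_le mult_left_le_one_le)
      moreover have "1 - norm z * u \<le> m"
        using norm_triangle_ineq2[of 1 "z * of_real u"] u by (simp add: norm_mult m_def)
      ultimately show "1 - u \<le> m" by linarith
      show "0 < m" using u nz[of u] by (simp add: m_def)
    qed
    have "norm (z * (- of_real p / (1 - z * of_real u) * (1 - z * of_real u) powr of_real p)) = norm z * (p * (m powr p / m))"
      using p by (simp add: norm_mult norm_divide norm_powr_real_powr' m_def)
    also have "\<dots> \<le> 1 * (p * (m powr p / m))" using z p m by (intro mult_right_mono) auto
    also have "m powr p / m = m powr (p - 1)" using m by (simp add: powr_diff)
    also have "1 * (p * m powr (p - 1)) \<le> p * (1 - u) powr (p - 1)"
      using m p u by (auto intro!: mult_left_mono powr_mono2')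
    finally show "norm (z * (- of_real p / (1 - z * of_real u) * (1 - z * of_real u) powr of_real p)) \<le> p * (1 - u) powr (p - 1)" .
  qed auto
  hence "norm (f 1 - f 0) \<le> 1" by simp
  moreover have "f 0 = 1" by (simp add: f_def)
  moreover have "f 1 = (t0 z)\<^sup>2" by (simp add: f_def t0_def p_def power2_eq_square flip: powr_add)
  ultimately show ?thesis by (simp add: norm_minus_commute)
qed

lemma near_boundary:
  assumes z: "99/100 \<le> norm z" "norm z < 1"
  shows "norm (x z) < 1" "Re (of_real \<sigma> * (z / (1 - z)) - 2 * q z + 1 / (1 - z) / (1 - x z)) > 0"
proof -
  have z0: "z \<noteq> 0" using z by auto
  note t0 = norm_one_minus_t0_sq[OF z(2)] Re_t0[OF z(2)]
  have B: "r * (norm (1 - t z))\<^sup>2 * (norm (1 - z) / (norm (t z) * norm z)) < 1 \<and>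
    ((norm (1 - t z))\<^sup>2 * (norm (1 - z) / (norm (t z) * norm z)) +
      r * ((norm (1 - t z))\<^sup>2)\<^sup>2 * (norm (1 - z) / ((norm (t z))\<^sup>2 * norm z))) /
      (1 - r * (norm (1 - t z))\<^sup>2 * (norm (1 - z) / (norm (t z) * norm z))) < 32/100 + Re (t z)"
  proof (cases "norm (1 - z) \<le> 1")
    case True
    have "norm (1 - z) powr 1 \<le> norm (1 - z) powr (2 * \<sigma>)" using True \<sigma> by (intro powr_mono') auto
    hence "norm (1 - z) \<le> (norm (t0 z))\<^sup>2" unfolding norm_t0(2) by simp
    moreover have "norm (t0 z) \<le> 1" unfolding norm_t0 using True \<sigma> by (intro powr_le1) auto
    ultimately show ?thesis
      unfolding t_eq[OF z(2)] using near_bound[OF \<sigma> r(1,2) z(1) t0 _ _ norm_\<tau>_near[OF z(2)]] by blast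
  next
    case False
    have "1 \<le> norm (t0 z)" unfolding norm_t0 using False \<sigma> by (intro ge_one_powr_ge_zero) auto
    moreover have le2: "norm (1 - z) \<le> 2" using norm_triangle_ineq4[of 1 z] z by simp
    moreover have "norm (1 - z) powr (2 * \<sigma>) \<le> norm (1 - z) powr 1" using False \<sigma> by (intro powr_mono) auto
    hence "(norm (t0 z))\<^sup>2 \<le> 2" unfolding norm_t0(2) using le2 False by simp
    moreover have "norm (\<tau> z - 1) \<le> 55/1000" using norm_\<tau>_far[OF z(2)] False by simp
    ultimately show ?thesis
      unfolding t_eq[OF z(2)] using far_bound[OF \<sigma> r(1,2) z(1) t0] by blast
  qed
  note R = Re_positive_of_error_bound[OF \<sigma> r(1,2) z(2) z0 Re_geometric_gt[OF z(2)] t_nz[OF z(2)]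
      norm_one_minus_t_less[OF z(2)] conjunct1[OF B] conjunct2[OF B]]
  show "norm (x z) < 1" unfolding x_eq_t[OF z(2) z0] by (rule R(1))
  show "Re (of_real \<sigma> * (z / (1 - z)) - 2 * q z + 1 / (1 - z) / (1 - x z)) > 0"
    unfolding x_eq_t[OF z(2) z0] q_eq_t[OF z(2)] by (rule R(2))
qed

lemma Re_pos_of_near_boundary:
  assumes f: "f holomorphic_on ball 0 1" and pos: "\<And>z. 99/100 \<le> norm z \<Longrightarrow> norm z < 1 \<Longrightarrow> 0 < Re (f z)"
    and f0: "0 < Re (f 0)" and z: "norm z < 1"
  shows "0 < Re (f z)"
proof (rule Re_greater_if_nonconst[OF f])
  show "0 \<le> Re (f w)" if "w \<in> ball 0 1" for w
  proof (cases "norm w \<le> 99/100")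
    case True
    show ?thesis by (rule Re_nonneg_on_sphere_imp_ball[OF f _ _ _ True]) (use pos in \<open>auto intro: less_imp_le\<close>)
  qed (use pos that in \<open>auto intro: less_imp_le\<close>)
qed (use f0 z in auto)

lemma Re_one_minus_x: assumes "norm z < 1" shows "0 < Re (1 - x z)"
proof (rule Re_pos_of_near_boundary[of "\<lambda>z. 1 - x z"])
  show "(\<lambda>z. 1 - x z) holomorphic_on ball 0 1" by (intro holomorphic_intros x_hol)
  show "0 < Re (1 - x z)" if "99/100 \<le> norm z" "norm z < 1" for z
    using near_boundary(1)[OF that] abs_Re_le_cmod[of "x z"] by simp
qed (use assms in \<open>auto simp: x_def\<close>)

lemma one_minus_x_nz: "norm z < 1 \<Longrightarrow> 1 - x z \<noteq> 0" using Re_one_minus_x[of z] by force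

lemma deriv_q_nz: assumes "norm z < 1" shows "deriv q z \<noteq> 0"
proof -
  have "1 - z \<noteq> 0" using assms by auto
  thus ?thesis using deriv_q[OF assms] W_nz[OF assms] one_minus_x_nz[OF assms] by simp
qed

lemma q_convex:
  assumes z: "norm z < 1"
  shows "0 < Re (1 + z * deriv (deriv q) z / deriv q z)"
proof (cases "z = 0")
  case False
  have "(\<lambda>z. of_real \<sigma> * (z / (1 - z)) - 2 * q z + 1 / (1 - z) / (1 - x z)) holomorphic_on ball 0 1"
    using one_minus_x_nz by (intro holomorphic_intros q_hol x_hol) auto
  hence "0 < Re (of_real \<sigma> * (z / (1 - z)) - 2 * q z + 1 / (1 - z) / (1 - x z))"
    by (rule Re_pos_of_near_boundary) (use near_boundary(2) z in \<open>auto simp: q_0 x_def\<close>)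
  thus ?thesis using second_deriv_q[OF z False one_minus_x_nz[OF z]] by simp
qed simp

lemma subordinate_theta_quotient:
  assumes F: "F holomorphic_on ball 0 1" "\<And>z. norm z < 1 \<Longrightarrow> F z \<noteq> 0"
      "\<And>z. norm z < 1 \<Longrightarrow> Re (theta_quotient F z) > - a / 2"
    and G: "G holomorphic_on ball 0 1" "\<And>z. norm z < 1 \<Longrightarrow> G z \<noteq> 0"
      "\<And>z. norm z < 1 \<Longrightarrow> Re (theta_quotient G z) > - b / 2"
  shows "\<exists>\<omega>. \<omega> holomorphic_on ball 0 1 \<and> \<omega> 0 = 0 \<and>
    (\<forall>z\<in>ball 0 1. norm (\<omega> z) < 1 \<and> theta_quotient (convolution F G) z = q (\<omega> z))"
proof -
  define p where "p = theta_quotient (convolution F G)"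
  have nz: "convolution F G z \<noteq> 0" if "norm z < 1" for z
    by (rule convolution_theta_quotient_hull(1)[OF a b_le(2) F G that])
  have mem: "p z \<in> q ` cball 0 \<rho>" if "norm z < \<rho>" "\<rho> < 1" for z \<rho>
    unfolding p_def
  proof (rule convolution_theta_quotient_hull(2)[OF a b_le(2) F G _ that, folded H_def])
    have \<rho>: "0 < \<rho>" using that norm_ge_zero[of z] by linarith
    show "convex (q ` cball 0 \<rho>)" by (rule convex_function_convex_image[OF q_hol deriv_q_nz q_convex \<rho> that(2)])
    have "continuous_on (cball 0 \<rho>) q"
      by (rule continuous_on_subset[OF holomorphic_on_imp_continuous_on[OF q_hol]]) (use that in auto)
    thus "closed (q ` cball 0 \<rho>)" by (intro compact_imp_closed compact_continuous_image) auto
    show "theta_quotient H u \<in> q ` cball 0 \<rho>" if "norm u = \<rho>" for u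
      using that by (auto simp: q_def)
  qed (use that in auto)
  have mem': "\<exists>w. norm w < 1 \<and> p z = q w" if "norm z < 1" for z
  proof -
    obtain \<rho> where "norm z < \<rho>" "\<rho> < 1" using dense \<open>norm z < 1\<close> by blast
    from mem[OF this] show ?thesis using \<open>\<rho> < 1\<close> by force
  qed
  have p_hol: "p holomorphic_on ball 0 1"
    unfolding p_def using nz
    by (intro holomorphic_intros convolution_holomorphic F G) auto
  have inj: "inj_on q (ball 0 1)" by (rule convex_function_inj_on[OF q_hol deriv_q_nz q_convex])
  obtain g where g: "g holomorphic_on (q ` ball 0 1)" "\<And>z. z \<in> ball 0 1 \<Longrightarrow> g (q z) = z"
    by (rule holomorphic_has_inverse[OF q_hol open_ball inj]) (rule that)
  show ?thesis
  proof (intro exI conjI ballI)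
    show "(g \<circ> p) holomorphic_on ball 0 1"
      by (rule holomorphic_on_compose_gen[OF p_hol g(1)]) (use mem' in force)
    show "(g \<circ> p) 0 = 0" using g(2)[of 0] by (simp add: p_def q_0)
    fix z :: complex assume "z \<in> ball 0 1"
    then obtain w where "norm w < 1" "p z = q w" using mem'[of z] by auto
    thus "norm ((g \<circ> p) z) < 1" "theta_quotient (convolution F G) z = q ((g \<circ> p) z)"
      using g(2)[of w] by (auto simp: p_def)
  qed
qed

end

section \<open>Starlike functions of a given order\<close>

lemma starlike_quotient_times_id:
  assumes F: "F holomorphic_on ball 0 1" and f: "\<And>z. norm z < 1 \<Longrightarrow> f z = z * F z"
    and z: "norm z < 1" "F z \<noteq> 0"
  shows "starlike_quotient f z = 1 + theta_quotient F z"
proof (cases "z = 0")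
  case False
  have "((\<lambda>z. z * F z) has_field_derivative (1 * F z + deriv F z * z)) (at z)"
    using z by (intro DERIV_mult DERIV_ident holomorphic_derivI[OF F]) auto
  hence "(f has_field_derivative (1 * F z + deriv F z * z)) (at z)"
    by (rule has_field_derivative_transform_within_open[of _ _ _ "ball 0 1"]) (use f z in auto)
  hence "deriv f z = F z + deriv F z * z" by (simp add: DERIV_imp_deriv)
  thus ?thesis using False z by (simp add: starlike_quotient_def f field_simps)
qed (simp add: starlike_quotient_def)

lemma starlike_of_orderE:
  assumes f: "f \<in> starlike_of_order \<alpha>" and \<alpha>: "\<alpha> < 1"
  obtains F where "F holomorphic_on ball 0 1" "\<And>z. norm z < 1 \<Longrightarrow> F z \<noteq> 0"
    "\<And>z. norm z < 1 \<Longrightarrow> f z = z * F z" "\<And>z. norm z < 1 \<Longrightarrow> Re (theta_quotient F z) > - (2 - 2 * \<alpha>) / 2"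
proof -
  have f': "f holomorphic_on ball 0 1" "f 0 = 0" "deriv f 0 = 1" "\<And>z. norm z < 1 \<Longrightarrow> z \<noteq> 0 \<Longrightarrow> f z \<noteq> 0"
    using f by (auto simp: starlike_of_order_def normalized_holomorphic_def)
  have ge: "\<alpha> \<le> Re (starlike_quotient f z)" if "norm z < 1" for z
  proof -
    have "ereal \<alpha> \<le> (INF z \<in> ball 0 1. ereal (Re (starlike_quotient f z)))"
      using f by (simp add: starlike_of_order_def)
    also have "\<dots> \<le> ereal (Re (starlike_quotient f z))" using that by (intro INF_lower) auto
    finally show ?thesis by simp
  qed
  define F where "F z = (if z = 0 then deriv f 0 else (f z - f 0) / (z - 0))" for z
  have F: "F holomorphic_on ball 0 1"
    unfolding F_def by (rule pole_lemma[OF f'(1)]) auto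
  have nz: "F z \<noteq> 0" if "norm z < 1" for z using f' that by (simp add: F_def)
  have fF: "f z = z * F z" if "norm z < 1" for z using f' by (simp add: F_def)
  have "Re (theta_quotient F z) \<ge> - (2 - 2 * \<alpha>) / 2" if "norm z < 1" for z
    using ge[OF that] starlike_quotient_times_id[OF F fF that nz[OF that]] by simp
  from theta_quotient_strict[OF F nz this] \<alpha> show ?thesis using F nz fF by (intro that[of F]) auto
qed

lemma taylor_coeff_times_id:
  assumes F: "F holomorphic_on ball 0 1" and f: "\<And>z. norm z < 1 \<Longrightarrow> f z = z * F z"
  shows "f holomorphic_on ball 0 1" "taylor_coeff f n = (case n of 0 \<Rightarrow> 0 | Suc m \<Rightarrow> taylor_coeff F m)"
proof -
  have *: "(\<lambda>n. (case n of 0 \<Rightarrow> 0 | Suc m \<Rightarrow> taylor_coeff F m) * z ^ n) sums f z" if z: "norm z < 1" for z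
  proof -
    have "(\<lambda>n. z * (taylor_coeff F n * z ^ n)) sums (z * F z)" by (intro sums_mult taylor_coeff_sums[OF F z])
    hence "(\<lambda>n. (case Suc n of 0 \<Rightarrow> 0 | Suc m \<Rightarrow> taylor_coeff F m) * z ^ Suc n) sums f z"
      using f[OF z] by (simp add: mult_ac)
    from sums_Suc[OF this] show ?thesis by simp
  qed
  show "f holomorphic_on ball 0 1" "taylor_coeff f n = (case n of 0 \<Rightarrow> 0 | Suc m \<Rightarrow> taylor_coeff F m)"
    by (rule sums_imp_holomorphic_taylor_coeff[OF zero_less_one *]; assumption)+
qed

lemma convolution_times_id:
  assumes F: "F holomorphic_on ball 0 1" and f: "\<And>z. norm z < 1 \<Longrightarrow> f z = z * F z"
    and G: "G holomorphic_on ball 0 1" and g: "\<And>z. norm z < 1 \<Longrightarrow> g z = z * G z" and z: "norm z < 1"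
  shows "convolution f g z = z * convolution F G z"
proof -
  have "(\<lambda>n. z * (taylor_coeff F n * taylor_coeff G n * z ^ n)) sums (z * convolution F G z)"
    by (intro sums_mult convolution_sums[OF F G zero_less_one z])
  hence "(\<lambda>n. taylor_coeff f (Suc n) * taylor_coeff g (Suc n) * z ^ Suc n) sums (z * convolution F G z)"
    by (simp add: taylor_coeff_times_id(2)[OF F f] taylor_coeff_times_id(2)[OF G g] mult_ac)
  from sums_Suc[OF this] have "(\<lambda>n. taylor_coeff f n * taylor_coeff g n * z ^ n) sums (z * convolution F G z)"
    by (simp add: taylor_coeff_times_id(2)[OF F f])
  thus ?thesis unfolding convolution_eq by (rule sums_unique[symmetric])
qed

lemma extremal_starlike_eq:
  "extremal_starlike \<alpha> z = z * (1 - z) powr (- of_real (2 - 2 * \<alpha>))"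
  unfolding powr_minus by (simp add: extremal_starlike_def divide_inverse algebra_simps)

text \<open>
  In terms of $a = 2 - 2\alpha$ and $b = 2 - 2\beta$ the cubic hypothesis amounts to
  $b - a - (a+b)^2 \ge b(3a-b)(1-a-b)$, whence $b - a \ge (a+b)^2$.
\<close>
lemma prod_le_of_cubic:
  fixes a b :: real
  assumes a: "0 < a" "a \<le> b" and s: "a + b \<le> 1/2"
    and cubic: "b * (3 * a - b) * (1 - a - b) \<le> b - a - (a + b)\<^sup>2"
  shows "4 * (a * b) \<le> (a + b)\<^sup>2 * (1 - (a + b)\<^sup>2)"
proof -
  have "(a + b)\<^sup>2 \<le> b - a"
  proof (cases "b \<le> 3 * a")
    case True
    have "0 \<le> b * (3 * a - b) * (1 - a - b)" using True a s by (intro mult_nonneg_nonneg) auto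
    thus ?thesis using cubic by linarith
  next
    case False
    have "(a + b) * (a + b) \<le> 1/2 * (a + b)" using a s by (intro mult_right_mono) auto
    thus ?thesis using False by (simp add: power2_eq_square)
  qed
  hence "((a + b)\<^sup>2)\<^sup>2 \<le> (b - a)\<^sup>2" by (intro power_mono) auto
  moreover have "(a + b)\<^sup>2 * (1 - (a + b)\<^sup>2) - 4 * (a * b) = (b - a)\<^sup>2 - ((a + b)\<^sup>2)\<^sup>2"
    by (simp add: power2_eq_square algebra_simps)
  ultimately show ?thesis by linarith
qed

theorem corollary1p4:
  fixes \<alpha> \<beta> :: real
  assumes "\<alpha> \<in> {1/2..<1}" and "\<beta> \<in> {1/2..<1}"
    and "\<beta> \<le> \<alpha>" and "\<alpha> + \<beta> \<ge> 7/4"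
    and "2 * (5 - 6 * \<beta>) * \<alpha>^2 + (30 * \<beta> - 17 - 8 * \<beta>^2) * \<alpha>
           + 4 - 7 * \<beta> - 4 * \<beta>^2 + 4 * \<beta>^3 \<ge> 0"
  shows "\<forall>f \<in> starlike_of_order \<alpha>. \<forall>g \<in> starlike_of_order \<beta>.
           subordinate (starlike_quotient (convolution f g))
             (starlike_quotient (convolution (extremal_starlike \<alpha>) (extremal_starlike \<beta>)))"
proof (intro ballI)
  fix f g assume f: "f \<in> starlike_of_order \<alpha>" and g: "g \<in> starlike_of_order \<beta>"
  define a b where "a = 2 - 2 * \<alpha>" and "b = 2 - 2 * \<beta>"
  have \<alpha>: "\<alpha> = 1 - a / 2" and \<beta>: "\<beta> = 1 - b / 2" by (simp_all add: a_def b_def field_simps)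
  have ab: "0 < a" "a \<le> b" "a + b \<le> 1/2" using assms by (simp_all add: a_def b_def)
  have "b * (3 * a - b) * (1 - a - b) \<le> b - a - (a + b)\<^sup>2"
    using assms(5) unfolding \<alpha> \<beta> by (simp add: power2_eq_square power3_eq_cube field_simps)
  from prod_le_of_cubic[OF ab this] interpret gauss_quotient a b using ab by unfold_locales
  obtain F where F: "F holomorphic_on ball 0 1" "\<And>z. norm z < 1 \<Longrightarrow> F z \<noteq> 0"
    "\<And>z. norm z < 1 \<Longrightarrow> f z = z * F z" "\<And>z. norm z < 1 \<Longrightarrow> Re (theta_quotient F z) > - a / 2"
    using starlike_of_orderE[OF f] assms unfolding a_def by auto
  obtain G where G: "G holomorphic_on ball 0 1" "\<And>z. norm z < 1 \<Longrightarrow> G z \<noteq> 0"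
    "\<And>z. norm z < 1 \<Longrightarrow> g z = z * G z" "\<And>z. norm z < 1 \<Longrightarrow> Re (theta_quotient G z) > - b / 2"
    using starlike_of_orderE[OF g] assms unfolding b_def by auto
  have FG: "convolution F G holomorphic_on ball 0 1" by (rule convolution_holomorphic[OF F(1) G(1)]) simp
  have p: "starlike_quotient (convolution f g) z = 1 + theta_quotient (convolution F G) z" if "norm z < 1" for z
    by (rule starlike_quotient_times_id[OF FG convolution_times_id[OF F(1,3) G(1,3)] that
        convolution_theta_quotient_hull(1)[OF ab(1,2) b_le(2) F(1,2,4) G(1,2,4) that]])
  have s: "starlike_quotient (convolution (extremal_starlike \<alpha>) (extremal_starlike \<beta>)) z = 1 + q z"
    if "norm z < 1" for z
    unfolding q_def
  proof (rule starlike_quotient_times_id[OF H_hol _ that H_nz[OF that]])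
    show "convolution (extremal_starlike \<alpha>) (extremal_starlike \<beta>) z = z * H z" if "norm z < 1" for z
      unfolding H_def
      by (rule convolution_times_id[OF one_minus_powr_holomorphic extremal_starlike_eq[of \<alpha>, folded a_def]
            one_minus_powr_holomorphic extremal_starlike_eq[of \<beta>, folded b_def] that])
  qed
  obtain \<omega> where \<omega>: "\<omega> holomorphic_on ball 0 1" "\<omega> 0 = 0"
    "\<And>z. norm z < 1 \<Longrightarrow> norm (\<omega> z) < 1 \<and> theta_quotient (convolution F G) z = q (\<omega> z)"
    using subordinate_theta_quotient[OF F(1,2,4) G(1,2,4)] by auto
  have pq: "1 + theta_quotient (convolution F G) z = 1 + q (\<omega> z)" "norm (\<omega> z) < 1" if "norm z < 1" for z
    using \<omega>(3)[OF that] by simp_all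
  have q1: "(\<lambda>z. 1 + q z) holomorphic_on ball 0 1" by (intro holomorphic_intros q_hol)
  have "((\<lambda>z. 1 + q z) \<circ> \<omega>) holomorphic_on ball 0 1"
    by (rule holomorphic_on_compose_gen[OF \<omega>(1) q1]) (use pq(2) in auto)
  hence "starlike_quotient (convolution f g) holomorphic_on ball 0 1"
    by (rule holomorphic_transform) (use p pq(1) in auto)
  moreover have "starlike_quotient (convolution (extremal_starlike \<alpha>) (extremal_starlike \<beta>)) holomorphic_on ball 0 1"
    by (rule holomorphic_transform[OF q1]) (use s in auto)
  ultimately show "subordinate (starlike_quotient (convolution f g))
      (starlike_quotient (convolution (extremal_starlike \<alpha>) (extremal_starlike \<beta>)))"
    unfolding subordinate_def using \<omega>(1,2) p s pq by auto
qed

end
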